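(* Let $f$ be a nonzero function on $\{0,1\}^n$. Then for any $p \ge 2$ and any integer $0 \le k \le n$, \[ \|f_k\|_2 ~\le~ 2^{\left(\pi\left(\min\left(\frac kn, \frac{n-k}{n}\right),\,H^{-1}\left(1 - \frac{p}{p-1} \cdot r(p)\right)\right) - \frac{p-2}{2p - 2} \cdot r(p)\right) \cdot n} \cdot \|f\|_p. \] Moreover, there is an absolute constant $C$ such that if $1\le s\le \frac n2$ is an integer and $f=c\cdot1_S$ with $c\ne0$ and $S$ the Hamming sphere of radius $s$ around $0$, then for every $p\ge2$: for each integer $k$ with $0 \le k \le \frac n2 - \sqrt{s(n-s)}$ or $\frac n2 +\sqrt{s(n-s)} \le k \le n$, the right-hand side is at most $C(\max(k,1)\, s)^{1/4}\|f_k\|_2$; and between any two consecutive roots of the univariate Krawchouk polynomial $K_s$ there is an integer $k$ for which the right-hand side is at most $C n^{5/2}\|f_k\|_2$.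
   Context: Norms w.r.t. uniform measure on $\{0,1\}^n$; $r(p)=\frac1n\log_2\frac{\|f\|_p}{\|f\|_1}$. Walsh characters $W_\alpha(y)=(-1)^{\sum\alpha_iy_i}$, $f=\sum_\alpha\hat f(\alpha)W_\alpha$, and $f_k=\sum_{|\alpha|=k}\hat f(\alpha)W_\alpha$ is the projection onto characters of Hamming weight $k$. Univariate Krawchouk polynomial: $K_s(t)=\sum_{j=0}^s(-1)^j\binom tj\binom{n-t}{s-j}$. $H$ is binary entropy, $H^{-1}:[0,1]\to[0,\frac12]$ its inverse. For $0\le u\le \frac12$ and $0<v\le \frac12-\sqrt{u(1-u)}$, $I(u,v)=\log_2(1-u)+\frac a2\log_2(1-2u-b)+u\log_2\frac{a+b}{2(1-u)}-\frac12\log_2\left(2(1-u)-a^2-ab\right)$ with $a=1-2v$, $b=\sqrt{a^2-4u(1-u)}$; $I(u,0)=-1$. For $0\le x,y\le\frac12$: $\pi(x,y)=I(y,x)-I(0,x)+\frac{H(x)+H(y)-1}2$ if $y\le\frac12-\sqrt{x(1-x)}$, and $\pi(x,y)=0$ otherwise. *)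

theory Defs
  imports "HOL-Analysis.Analysis"
begin

definition cube :: "nat \<Rightarrow> (nat \<Rightarrow> nat) set" where
  "cube n = {..<n} \<rightarrow>\<^sub>E {0, 1}"

definition hamming_weight :: "nat \<Rightarrow> (nat \<Rightarrow> nat) \<Rightarrow> nat" where
  "hamming_weight n x = card {i. i < n \<and> x i \<noteq> 0}"

definition hamming_sphere :: "nat \<Rightarrow> nat \<Rightarrow> (nat \<Rightarrow> nat) set" where
  "hamming_sphere n s = {x \<in> cube n. hamming_weight n x = s}"

definition lp_norm :: "nat \<Rightarrow> real \<Rightarrow> ((nat \<Rightarrow> nat) \<Rightarrow> real) \<Rightarrow> real" where
  "lp_norm n p f = ((\<Sum>x\<in>cube n. \<bar>f x\<bar> powr p) / 2 ^ n) powr (1 / p)"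

definition norm_rate :: "nat \<Rightarrow> ((nat \<Rightarrow> nat) \<Rightarrow> real) \<Rightarrow> real \<Rightarrow> real" where
  "norm_rate n f p = 1 / real n * log 2 (lp_norm n p f / lp_norm n 1 f)"

definition walsh :: "nat \<Rightarrow> (nat \<Rightarrow> nat) \<Rightarrow> (nat \<Rightarrow> nat) \<Rightarrow> real" where
  "walsh n \<alpha> y = (- 1) ^ (\<Sum>i<n. \<alpha> i * y i)"

definition fourier_coeff :: "nat \<Rightarrow> ((nat \<Rightarrow> nat) \<Rightarrow> real) \<Rightarrow> (nat \<Rightarrow> nat) \<Rightarrow> real" where
  "fourier_coeff n f \<alpha> = (\<Sum>y\<in>cube n. f y * walsh n \<alpha> y) / 2 ^ n"

definition level_proj :: "nat \<Rightarrow> ((nat \<Rightarrow> nat) \<Rightarrow> real) \<Rightarrow> nat \<Rightarrow> (nat \<Rightarrow> nat) \<Rightarrow> real" where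
  "level_proj n f k y =
     (\<Sum>\<alpha> | \<alpha> \<in> cube n \<and> hamming_weight n \<alpha> = k. fourier_coeff n f \<alpha> * walsh n \<alpha> y)"

lemma walsh_orthogonal:
  assumes "x \<in> cube n" and "y \<in> cube n"
  shows "(\<Sum>\<alpha>\<in>cube n. walsh n \<alpha> x * walsh n \<alpha> y) = (if x = y then 2 ^ n else 0)"
proof -
  have "(\<Sum>\<alpha>\<in>cube n. walsh n \<alpha> x * walsh n \<alpha> y)
      = (\<Sum>\<alpha>\<in>cube n. \<Prod>i<n. (- 1) ^ (\<alpha> i * (x i + y i)))"
    by (intro sum.cong refl)
       (simp add: walsh_def power_add[symmetric] power_sum[symmetric] sum.distrib[symmetric]
         distrib_left)
  also have "\<dots> = (\<Prod>i<n. \<Sum>a\<in>{0, 1::nat}. (- 1) ^ (a * (x i + y i)))"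
    unfolding cube_def by (subst prod_sum_PiE) auto
  also have "\<dots> = (\<Prod>i<n. if x i = y i then 2 else 0)"
  proof (intro prod.cong refl)
    fix i assume "i \<in> {..<n}"
    then have "x i \<in> {0, 1}" "y i \<in> {0, 1}"
      using assms unfolding cube_def by (auto dest: PiE_mem)
    then show "(\<Sum>a\<in>{0, 1::nat}. (- 1) ^ (a * (x i + y i))) = (if x i = y i then 2 else (0::real))"
      by auto
  qed
  also have "\<dots> = (if x = y then 2 ^ n else 0)"
  proof (cases "x = y")
    case False
    then obtain i where "i < n" "x i \<noteq> y i"
      using assms PiE_ext[of x "{..<n}" _ y] unfolding cube_def by blast
    then show ?thesis using False by (auto intro!: prod_zero)
  qed simp
  finally show ?thesis .
qed

lemma walsh_expansion:
  assumes "x \<in> cube n"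
  shows "f x = (\<Sum>\<alpha>\<in>cube n. fourier_coeff n f \<alpha> * walsh n \<alpha> x)"
proof -
  have fin: "finite (cube n)"
    unfolding cube_def by (simp add: finite_PiE)
  have "(\<Sum>\<alpha>\<in>cube n. fourier_coeff n f \<alpha> * walsh n \<alpha> x)
      = (\<Sum>\<alpha>\<in>cube n. \<Sum>y\<in>cube n. f y / 2 ^ n * (walsh n \<alpha> y * walsh n \<alpha> x))"
    unfolding fourier_coeff_def
    by (simp add: sum_divide_distrib sum_distrib_right sum_distrib_left algebra_simps)
  also have "\<dots> = (\<Sum>y\<in>cube n. f y / 2 ^ n * (\<Sum>\<alpha>\<in>cube n. walsh n \<alpha> y * walsh n \<alpha> x))"
    by (subst sum.swap) (simp add: sum_distrib_left)
  also have "\<dots> = (\<Sum>y\<in>cube n. if y = x then f y else 0)"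
    using assms by (intro sum.cong refl) (simp add: walsh_orthogonal)
  also have "\<dots> = f x" using fin assms by simp
  finally show ?thesis by simp
qed

definition krawchouk :: "nat \<Rightarrow> nat \<Rightarrow> real \<Rightarrow> real" where
  "krawchouk n s t = (\<Sum>j\<le>s. (- 1) ^ j * (t gchoose j) * ((real n - t) gchoose (s - j)))"

definition consecutive_roots :: "(real \<Rightarrow> real) \<Rightarrow> real \<Rightarrow> real \<Rightarrow> bool" where
  "consecutive_roots g t\<^sub>1 t\<^sub>2 \<longleftrightarrow>
     t\<^sub>1 < t\<^sub>2 \<and> g t\<^sub>1 = 0 \<and> g t\<^sub>2 = 0 \<and> (\<forall>t. t\<^sub>1 < t \<and> t < t\<^sub>2 \<longrightarrow> g t \<noteq> 0)"

definition binary_entropy :: "real \<Rightarrow> real" where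
  "binary_entropy x = - x * log 2 x - (1 - x) * log 2 (1 - x)"

definition binary_entropy_inv :: "real \<Rightarrow> real" where
  "binary_entropy_inv = the_inv_into {0..1/2} binary_entropy"

definition I_fun :: "real \<Rightarrow> real \<Rightarrow> real" where
  "I_fun u v =
     (if v = 0 then - 1
      else let a = 1 - 2 * v; b = sqrt (a\<^sup>2 - 4 * u * (1 - u))
        in log 2 (1 - u) + a / 2 * log 2 (1 - 2 * u - b)
           + u * log 2 ((a + b) / (2 * (1 - u)))
           - 1 / 2 * log 2 (2 * (1 - u) - a\<^sup>2 - a * b))"

definition pi_fun :: "real \<Rightarrow> real \<Rightarrow> real" where
  "pi_fun x y =
     (if y \<le> 1 / 2 - sqrt (x * (1 - x))
      then I_fun y x - I_fun 0 x + (binary_entropy x + binary_entropy y - 1) / 2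
      else 0)"

definition level_bound :: "nat \<Rightarrow> ((nat \<Rightarrow> nat) \<Rightarrow> real) \<Rightarrow> real \<Rightarrow> nat \<Rightarrow> real" where
  "level_bound n f p k =
     2 powr ((pi_fun (min (real k / real n) ((real n - real k) / real n))
                (binary_entropy_inv (1 - p / (p - 1) * norm_rate n f p))
              - (p - 2) / (2 * p - 2) * norm_rate n f p) * real n)
     * lp_norm n p f"

end

theory Submission
  imports Defs "HOL-Computational_Algebra.Polynomial"
begin

text \<open>
  For a level \<open>k\<close> and \<open>0 \<le> \<rho> \<le> 1\<close> one has \<open>\<rho>\<^sup>k \<parallel>f\<^sub>k\<parallel>\<^sub>2\<^sup>2 \<le> \<langle>f, T\<^sub>\<rho> f\<rangle>\<close>, and for \<open>1 \<le> q \<le> 2\<close> the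
  inequality \<open>\<langle>f, T\<^sub>\<rho> f\<rangle> \<le> C\<^sup>n \<parallel>f\<parallel>\<^sub>q\<^sup>2\<close> tensorizes from its two-point case, where the best \<open>C\<close>,
  in general larger than 1, can be computed. Interpolating \<open>\<parallel>f\<parallel>\<^sub>q\<close> between \<open>\<parallel>f\<parallel>\<^sub>1\<close> and \<open>\<parallel>f\<parallel>\<^sub>p\<close>
  and optimizing over \<open>\<rho>\<close> and \<open>q\<close> gives the exponent \<open>\<pi>\<close>; the optimum is described by the
  roots \<open>w\<close> of \<open>(1 - x) w\<^sup>2 - (1 - 2 y) w + x = 0\<close>.

  The larger root bounds the ratio \<open>K\<^sub>s(k + 1) / K\<^sub>s(k)\<close> from below as long as it is real: this is the
  fixed point inequality for the three-term recurrence of \<open>K\<^sub>s\<close> in \<open>k\<close>. The product of these bounds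
  is exactly the upper bound, up to the error in \<open>(n choose k) \<approx> 2\<^bsup>n H(k/n)\<^esup>\<close>. Between the roots of
  \<open>K\<^sub>s\<close>, the quadratic form \<open>\<Sum>\<^sub>j\<^sub>\<le>\<^sub>k (n - 2 j) (n choose j) K\<^sub>s(j)\<^sup>2\<close> in \<open>K\<^sub>s(k), K\<^sub>s(k + 1)\<close> is definite and
  varies by at most a polynomial factor, so that one of any two neighbouring values is large.
\<close>

subsection \<open>Fourier analysis on the cube\<close>

text \<open>The two-point problem becomes explicit when it is parametrized by its extremizer 1
  \<plusminus> w instead of q: then q - 1 = artanh(\<rho> w) / artanh w, and hypercontractivity (q =
  1 + \<rho>, C = 1) is the limit w -> 0. With w = \<open>w_plus\<close> and \<rho> w =
  \<open>w_minus\<close>, all constants become symmetric functions of the two roots, which are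
  rational in x and y. For spheres the obstacle is that \<pi> is evaluated not at s/n but at the
  point whose entropy is exactly log (n choose s) / n. This point is at most s/n, and \<pi> is
  monotone in y, so the comparison goes in the useful direction. Between the roots only \<pi> \<le>
  0 is needed: the upper bound is then at most the 2-norm of f, and it remains to find a level
  carrying a polynomial share of its square. That two consecutive roots enclose enough integers
  follows from orthogonality. The delicate case is a pair of roots enclosing no two neighbouring
  integers; it occurs only for n = 2 s, with roots at distance 2.\<close>

lemma finite_cube [simp]: "finite (cube n)"
  unfolding cube_def by (simp add: finite_PiE)

lemma card_cube [simp]: "card (cube n) = 2 ^ n"
  unfolding cube_def by (simp add: card_PiE numeral_2_eq_2)

lemma cube_nth_cases: "x \<in> cube n \<Longrightarrow> i < n \<Longrightarrow> x i = 0 \<or> x i = 1"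
  unfolding cube_def by (auto dest: PiE_mem)

lemma cube_eqI:
  assumes "x \<in> cube n" "y \<in> cube n" "\<And>i. i < n \<Longrightarrow> x i = y i"
  shows "x = y"
  using assms unfolding cube_def by (intro PiE_ext) auto

lemma sum_cube_Suc:
  fixes F :: "(nat \<Rightarrow> nat) \<Rightarrow> 'a::comm_monoid_add"
  shows "sum F (cube (Suc n)) = (\<Sum>x\<in>cube n. F (x(n := 0))) + (\<Sum>x\<in>cube n. F (x(n := 1)))"
proof -
  have c: "cube (Suc n) = (\<lambda>(y, g). g(n := y)) ` ({0, 1} \<times> cube n)"
    unfolding cube_def lessThan_Suc by (rule PiE_insert_eq)
  have inj: "inj_on (\<lambda>(y, g). g(n := y)) ({0, 1} \<times> cube n)"
    unfolding cube_def by (rule inj_combinator) simp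
  have "sum F (cube (Suc n)) = (\<Sum>(y, g)\<in>{0, 1} \<times> cube n. F (g(n := y)))"
    unfolding c by (subst sum.reindex[OF inj]) (auto intro: sum.cong)
  also have "\<dots> = (\<Sum>y\<in>{0, 1}. \<Sum>g\<in>cube n. F (g(n := y)))"
    by (simp add: sum.cartesian_product)
  finally show ?thesis by simp
qed

lemma walsh_commute: "walsh n x y = walsh n y x"
  by (simp add: walsh_def mult.commute)

lemma sum_walsh_mult_walsh:
  assumes "\<alpha> \<in> cube n" "\<beta> \<in> cube n"
  shows "(\<Sum>y\<in>cube n. walsh n \<alpha> y * walsh n \<beta> y) = (if \<alpha> = \<beta> then 2 ^ n else 0)"
  using walsh_orthogonal[OF assms] by (simp add: walsh_commute)

lemma lp_norm_nonneg: "0 \<le> lp_norm n p f"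
  by (simp add: lp_norm_def)

lemma lp_norm_2_squared: "(lp_norm n 2 f)\<^sup>2 = (\<Sum>x\<in>cube n. (f x)\<^sup>2) / 2 ^ n"
proof -
  have "\<bar>f x\<bar> powr 2 = (f x)\<^sup>2" for x
    by simp
  then show ?thesis
    by (simp add: lp_norm_def powr_half_sqrt sum_nonneg)
qed

lemma sum_squared_walsh_sum:
  assumes "A \<subseteq> cube n"
  shows "(\<Sum>y\<in>cube n. (\<Sum>\<alpha>\<in>A. c \<alpha> * walsh n \<alpha> y)\<^sup>2) = 2 ^ n * (\<Sum>\<alpha>\<in>A. (c \<alpha>)\<^sup>2)"
proof -
  have fin: "finite A" using assms finite_subset finite_cube by blast
  have "(\<Sum>y\<in>cube n. (\<Sum>\<alpha>\<in>A. c \<alpha> * walsh n \<alpha> y)\<^sup>2)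
      = (\<Sum>y\<in>cube n. \<Sum>\<alpha>\<in>A. \<Sum>\<beta>\<in>A. c \<alpha> * c \<beta> * (walsh n \<alpha> y * walsh n \<beta> y))"
    by (simp add: power2_eq_square sum_product algebra_simps)
  also have "\<dots> = (\<Sum>\<alpha>\<in>A. \<Sum>\<beta>\<in>A. c \<alpha> * c \<beta> * (\<Sum>y\<in>cube n. walsh n \<alpha> y * walsh n \<beta> y))"
    unfolding sum_distrib_left
    by (rule trans[OF sum.swap]) (rule sum.cong[OF refl], rule sum.swap)
  also have "\<dots> = (\<Sum>\<alpha>\<in>A. \<Sum>\<beta>\<in>A. if \<alpha> = \<beta> then c \<alpha> * c \<beta> * 2 ^ n else 0)"
    using assms by (intro sum.cong refl) (auto simp: sum_walsh_mult_walsh subset_iff)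
  also have "\<dots> = 2 ^ n * (\<Sum>\<alpha>\<in>A. (c \<alpha>)\<^sup>2)"
    using fin by (simp add: sum_distrib_left power2_eq_square mult_ac)
  finally show ?thesis .
qed

lemma parseval: "(\<Sum>\<alpha>\<in>cube n. (fourier_coeff n f \<alpha>)\<^sup>2) = (lp_norm n 2 f)\<^sup>2"
proof -
  have "(\<Sum>x\<in>cube n. (f x)\<^sup>2)
      = (\<Sum>x\<in>cube n. (\<Sum>\<alpha>\<in>cube n. fourier_coeff n f \<alpha> * walsh n \<alpha> x)\<^sup>2)"
    by (intro sum.cong refl) (metis walsh_expansion)
  then show ?thesis
    by (simp add: lp_norm_2_squared sum_squared_walsh_sum)
qed

lemma level_proj_norm_squared:
  "(lp_norm n 2 (level_proj n f k))\<^sup>2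
     = (\<Sum>\<alpha> | \<alpha> \<in> cube n \<and> hamming_weight n \<alpha> = k. (fourier_coeff n f \<alpha>)\<^sup>2)"
  unfolding lp_norm_2_squared level_proj_def
  by (subst sum_squared_walsh_sum) auto

lemma hamming_weight_le: "hamming_weight n x \<le> n"
proof -
  have "card {i. i < n \<and> x i \<noteq> 0} \<le> card {..<n}"
    by (intro card_mono) auto
  then show ?thesis by (simp add: hamming_weight_def)
qed

lemma hamming_weight_fun_upd:
  "hamming_weight (Suc n) (x(n := c)) = hamming_weight n x + (if c = 0 then 0 else 1)"
proof -
  have "{i. i < Suc n \<and> (x(n := c)) i \<noteq> 0}
      = {i. i < n \<and> x i \<noteq> 0} \<union> (if c = 0 then {} else {n})"
    by (auto simp: less_Suc_eq)
  then show ?thesis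
    unfolding hamming_weight_def by (simp add: card_Un_disjoint)
qed

lemma hamming_weight_eq_sum:
  assumes "x \<in> cube n"
  shows "hamming_weight n x = (\<Sum>i<n. x i)"
proof -
  have "(\<Sum>i<n. x i) = (\<Sum>i<n. if x i \<noteq> 0 then 1 else 0)"
    using cube_nth_cases[OF assms] by (intro sum.cong) force+
  also have "\<dots> = card {i \<in> {..<n}. x i \<noteq> 0}"
    by (simp add: sum.If_cases Int_def)
  finally show ?thesis by (simp add: hamming_weight_def)
qed

section \<open>Complementing the frequencies\<close>

definition cube_flip :: "nat \<Rightarrow> (nat \<Rightarrow> nat) \<Rightarrow> nat \<Rightarrow> nat" where
  "cube_flip n x = (\<lambda>i\<in>{..<n}. 1 - x i)"

lemma cube_flip_in_cube: "x \<in> cube n \<Longrightarrow> cube_flip n x \<in> cube n"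
  using cube_nth_cases[of x n] by (auto simp: cube_flip_def cube_def)

lemma cube_flip_cube_flip:
  assumes "x \<in> cube n"
  shows "cube_flip n (cube_flip n x) = x"
proof (rule cube_eqI[of _ n])
  fix i assume "i < n"
  then show "cube_flip n (cube_flip n x) i = x i"
    using cube_nth_cases[OF assms, of i] by (auto simp: cube_flip_def)
qed (use assms in \<open>auto intro: cube_flip_in_cube\<close>)

lemma hamming_weight_cube_flip:
  assumes "x \<in> cube n"
  shows "hamming_weight n (cube_flip n x) = n - hamming_weight n x"
proof -
  have eq: "{i. i < n \<and> cube_flip n x i \<noteq> 0} = {..<n} - {i. i < n \<and> x i \<noteq> 0}"
    using cube_nth_cases[OF assms] by (auto simp: cube_flip_def)
  then show ?thesis
    unfolding hamming_weight_def by (subst eq, subst card_Diff_subset) auto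
qed

lemma walsh_cube_flip:
  assumes "\<alpha> \<in> cube n"
  shows "walsh n (cube_flip n \<alpha>) y = walsh n \<alpha> y * (- 1) ^ (\<Sum>i<n. y i)"
proof -
  \<comment> \<open>For \<open>\<alpha> i = 1\<close> the exponents are 0 and 2 \<open>y i\<close>,
    of equal parity; for \<open>\<alpha> i = 0\<close> they coincide.\<close>
  have "(- 1 :: real) ^ (cube_flip n \<alpha> i * y i) = (- 1) ^ (\<alpha> i * y i + y i)" if "i < n" for i
    using cube_nth_cases[OF assms that] that by (auto simp: cube_flip_def simp flip: mult_2)
  then have "(\<Prod>i<n. (- 1 :: real) ^ (cube_flip n \<alpha> i * y i)) = (\<Prod>i<n. (- 1) ^ (\<alpha> i * y i + y i))"
    by (intro prod.cong) auto
  then show ?thesis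
    by (simp add: walsh_def sum.distrib flip: power_sum power_add)
qed

text \<open>Multiplication by the character of the all-ones vector. It preserves every |f y|, hence
  all norms and rates, and complements each frequency, hence exchanges the levels k and n - k. This
  reduces the level inequality to k \<le> n/2.\<close>

definition sign_twist :: "nat \<Rightarrow> ((nat \<Rightarrow> nat) \<Rightarrow> real) \<Rightarrow> (nat \<Rightarrow> nat) \<Rightarrow> real" where
  "sign_twist n f y = f y * (- 1) ^ (\<Sum>i<n. y i)"

lemma abs_sign_twist [simp]: "\<bar>sign_twist n f y\<bar> = \<bar>f y\<bar>"
  by (simp add: sign_twist_def abs_mult power_abs)

lemma lp_norm_sign_twist [simp]: "lp_norm n p (sign_twist n f) = lp_norm n p f"
  by (simp add: lp_norm_def)

lemma fourier_coeff_sign_twist: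
  assumes "\<alpha> \<in> cube n"
  shows "fourier_coeff n (sign_twist n f) \<alpha> = fourier_coeff n f (cube_flip n \<alpha>)"
  unfolding fourier_coeff_def sign_twist_def walsh_cube_flip[OF assms]
  by (simp add: mult_ac)

lemma level_proj_norm_sign_twist:
  assumes "k \<le> n"
  shows "lp_norm n 2 (level_proj n (sign_twist n f) (n - k)) = lp_norm n 2 (level_proj n f k)"
proof -
  let ?A = "\<lambda>k. {\<alpha>. \<alpha> \<in> cube n \<and> hamming_weight n \<alpha> = k}"
  have bij: "bij_betw (cube_flip n) (?A (n - k)) (?A k)"
    using assms
    by (intro bij_betw_byWitness[of _ "cube_flip n"])
       (auto simp: cube_flip_cube_flip hamming_weight_cube_flip cube_flip_in_cube)
  have "(lp_norm n 2 (level_proj n (sign_twist n f) (n - k)))\<^sup>2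
      = (\<Sum>\<alpha>\<in>?A (n - k). (fourier_coeff n f (cube_flip n \<alpha>))\<^sup>2)"
    unfolding level_proj_norm_squared by (intro sum.cong) (auto simp: fourier_coeff_sign_twist)
  also have "\<dots> = (\<Sum>\<alpha>\<in>?A k. (fourier_coeff n f \<alpha>)\<^sup>2)"
    by (rule sum.reindex_bij_betw[OF bij])
  finally show ?thesis
    by (simp add: level_proj_norm_squared[symmetric] power2_eq_iff_nonneg lp_norm_nonneg)
qed

section \<open>Restrictions to the two values of the last coordinate\<close>

lemma fourier_coeff_fun_upd:
  assumes "c \<in> {0, 1}"
  shows "fourier_coeff (Suc n) f (\<alpha>(n := c))
    = (fourier_coeff n (\<lambda>x. f (x(n := 0))) \<alpha>
        + (- 1) ^ c * fourier_coeff n (\<lambda>x. f (x(n := 1))) \<alpha>) / 2"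
proof -
  have w: "walsh (Suc n) (\<alpha>(n := c)) (x(n := d)) = walsh n \<alpha> x * (- 1) ^ (c * d)" for x d
    by (simp add: walsh_def power_add)
  show ?thesis
    unfolding fourier_coeff_def sum_cube_Suc w
    by (simp add: field_simps sum_distrib_left)
qed

lemma lp_norm_Suc:
  assumes "0 < q"
  shows "lp_norm (Suc n) q f = ((lp_norm n q (\<lambda>x. f (x(n := 0))) powr q
           + lp_norm n q (\<lambda>x. f (x(n := 1))) powr q) / 2) powr (1 / q)"
proof -
  have "lp_norm n q g powr q = (\<Sum>x\<in>cube n. \<bar>g x\<bar> powr q) / 2 ^ n" for g
    using assms by (simp add: lp_norm_def powr_powr sum_nonneg)
  then show ?thesis
    by (simp add: lp_norm_def[of "Suc n"] sum_cube_Suc add_divide_distrib mult.commute)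
qed

subsection \<open>Tensorization of a two-point inequality\<close>

text \<open>The bilinear form of the noise operator, written on the Fourier side. It takes two
  functions because splitting off a coordinate produces a mixed term between the two restrictions of
  f.\<close>

definition noise_form :: "nat \<Rightarrow> real \<Rightarrow> ((nat \<Rightarrow> nat) \<Rightarrow> real) \<Rightarrow> ((nat \<Rightarrow> nat) \<Rightarrow> real) \<Rightarrow> real" where
  "noise_form n \<rho> f g
     = (\<Sum>\<alpha>\<in>cube n. \<rho> ^ hamming_weight n \<alpha> * fourier_coeff n f \<alpha> * fourier_coeff n g \<alpha>)"

lemma noise_form_nonneg: "0 \<le> \<rho> \<Longrightarrow> 0 \<le> noise_form n \<rho> f f"
  unfolding noise_form_def by (intro sum_nonneg) (simp add: mult.assoc)

lemma noise_form_Cauchy_Schwarz: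
  assumes "0 \<le> \<rho>"
  shows "noise_form n \<rho> f g \<le> sqrt (noise_form n \<rho> f f) * sqrt (noise_form n \<rho> g g)"
proof -
  let ?a = "\<lambda>f \<alpha>. sqrt (\<rho> ^ hamming_weight n \<alpha>) * fourier_coeff n f \<alpha>"
  have eq: "noise_form n \<rho> f g = (\<Sum>\<alpha>\<in>cube n. ?a f \<alpha> * ?a g \<alpha>)" for f g
  proof -
    have h: "sqrt (\<rho> ^ m) * u * (sqrt (\<rho> ^ m) * v) = \<rho> ^ m * u * v" for m u v
      using assms by (simp add: mult.commute mult.left_commute)
    show ?thesis by (simp only: noise_form_def h)
  qed
  have "(noise_form n \<rho> f g)\<^sup>2 \<le> noise_form n \<rho> f f * noise_form n \<rho> g g"
    unfolding eq using Cauchy_Schwarz_ineq_sum[of "?a f" "?a g" "cube n"]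
    by (simp add: power2_eq_square)
  then have "\<bar>noise_form n \<rho> f g\<bar> \<le> sqrt (noise_form n \<rho> f f * noise_form n \<rho> g g)"
    by (metis real_sqrt_abs real_sqrt_le_iff)
  then show ?thesis by (simp add: real_sqrt_mult)
qed

text \<open>If a and b are the coefficients of the two restrictions, those of f are (a + b)/2 and (a
  - b)/2, the second with an additional weight \<rho>; expand ((a + b)^2 + \<rho> (a - b)^2) /
  4.\<close>

lemma noise_form_Suc:
  "noise_form (Suc n) \<rho> f f
    = (1 + \<rho>) / 4 * (noise_form n \<rho> (\<lambda>x. f (x(n := 0))) (\<lambda>x. f (x(n := 0)))
        + noise_form n \<rho> (\<lambda>x. f (x(n := 1))) (\<lambda>x. f (x(n := 1))))
      + (1 - \<rho>) / 2 * noise_form n \<rho> (\<lambda>x. f (x(n := 0))) (\<lambda>x. f (x(n := 1)))"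
  unfolding noise_form_def sum_cube_Suc
  by (simp add: fourier_coeff_fun_upd hamming_weight_fun_upd sum_distrib_left
      flip: sum.distrib sum_subtractf)
    (intro sum.cong refl, simp add: field_simps)

text \<open>The case n = 1 of the inequality to be tensorized, for a function with values u and v.
  Nonnegative values suffice, since the induction feeds in norms of restrictions.\<close>

definition two_point_ineq :: "real \<Rightarrow> real \<Rightarrow> real \<Rightarrow> bool" where
  "two_point_ineq \<rho> q C \<longleftrightarrow> (\<forall>u v. 0 \<le> u \<longrightarrow> 0 \<le> v \<longrightarrow>
     (1 + \<rho>) / 4 * (u\<^sup>2 + v\<^sup>2) + (1 - \<rho>) / 2 * (u * v) \<le> C * ((u powr q + v powr q) / 2) powr (2 / q))"

lemma two_point_ineqD:
  assumes "two_point_ineq \<rho> q C" "0 \<le> u" "0 \<le> v"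
  shows "(1 + \<rho>) / 4 * (u\<^sup>2 + v\<^sup>2) + (1 - \<rho>) / 2 * (u * v) \<le> C * ((u powr q + v powr q) / 2) powr (2 / q)"
  using assms unfolding two_point_ineq_def by blast

text \<open>Cauchy-Schwarz bounds the mixed term, whose coefficient is nonnegative because \<rho>
  \<le> 1. The induction hypothesis then replaces both restrictions by their q-norms, and the
  two-point inequality is applied to this pair of numbers, whose q-th power mean is the q-norm of
  f.\<close>

lemma noise_form_le:
  assumes \<rho>: "0 \<le> \<rho>" "\<rho> \<le> 1" and q: "0 < q" and C: "0 \<le> C" "two_point_ineq \<rho> q C"
  shows "noise_form n \<rho> f f \<le> C ^ n * (lp_norm n q f)\<^sup>2"
proof (induction n arbitrary: f)
  case 0
  have "cube 0 = {\<lambda>_. undefined}" by (simp add: cube_def)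
  then show ?case
    using q by (simp add: noise_form_def hamming_weight_def fourier_coeff_def walsh_def lp_norm_def
        powr_powr power2_eq_square)
next
  case (Suc n)
  let ?f0 = "\<lambda>x. f (x(n := 0))" and ?f1 = "\<lambda>x. f (x(n := 1))"
  let ?A0 = "sqrt (noise_form n \<rho> ?f0 ?f0)" and ?A1 = "sqrt (noise_form n \<rho> ?f1 ?f1)"
  let ?N0 = "lp_norm n q ?f0" and ?N1 = "lp_norm n q ?f1"
  have nn: "0 \<le> noise_form n \<rho> g g" for g by (rule noise_form_nonneg[OF \<rho>(1)])
  have A: "sqrt (noise_form n \<rho> g g) \<le> sqrt (C ^ n) * lp_norm n q g" for g
  proof -
    have "sqrt (noise_form n \<rho> g g) \<le> sqrt (C ^ n * (lp_norm n q g)\<^sup>2)"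
      using Suc.IH[of g] by (rule real_sqrt_le_mono)
    then show ?thesis by (simp add: real_sqrt_mult lp_norm_nonneg)
  qed
  have "noise_form (Suc n) \<rho> f f
      = (1 + \<rho>) / 4 * (?A0\<^sup>2 + ?A1\<^sup>2) + (1 - \<rho>) / 2 * noise_form n \<rho> ?f0 ?f1"
    unfolding noise_form_Suc using nn by simp
  also have "\<dots> \<le> (1 + \<rho>) / 4 * (?A0\<^sup>2 + ?A1\<^sup>2) + (1 - \<rho>) / 2 * (?A0 * ?A1)"
    using \<rho> by (intro add_left_mono mult_left_mono noise_form_Cauchy_Schwarz) auto
  also have "\<dots> \<le> (1 + \<rho>) / 4 * ((sqrt (C ^ n) * ?N0)\<^sup>2 + (sqrt (C ^ n) * ?N1)\<^sup>2)
      + (1 - \<rho>) / 2 * ((sqrt (C ^ n) * ?N0) * (sqrt (C ^ n) * ?N1))"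
    using \<rho> nn C by (intro add_mono mult_left_mono mult_mono power_mono A)
      (auto intro!: mult_nonneg_nonneg lp_norm_nonneg)
  also have "\<dots> = C ^ n * ((1 + \<rho>) / 4 * (?N0\<^sup>2 + ?N1\<^sup>2) + (1 - \<rho>) / 2 * (?N0 * ?N1))"
  proof -
    define c where "c = sqrt (C ^ n)"
    have "C ^ n = c\<^sup>2" using C by (simp add: c_def)
    then show ?thesis unfolding c_def[symmetric] by (simp add: power2_eq_square field_simps)
  qed
  also have "\<dots> \<le> C ^ n * (C * ((?N0 powr q + ?N1 powr q) / 2) powr (2 / q))"
    using C by (intro mult_left_mono two_point_ineqD) (auto intro: lp_norm_nonneg)
  also have "((?N0 powr q + ?N1 powr q) / 2) powr (2 / q) = (lp_norm (Suc n) q f)\<^sup>2"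
    unfolding lp_norm_Suc[OF q]
    by (simp add: power2_eq_square flip: powr_add)
  finally show ?case by (simp add: mult_ac)
qed

lemma level_proj_norm_le:
  assumes \<rho>: "0 \<le> \<rho>" "\<rho> \<le> 1" and q: "0 < q" and C: "0 \<le> C" "two_point_ineq \<rho> q C"
  shows "\<rho> ^ k * (lp_norm n 2 (level_proj n f k))\<^sup>2 \<le> C ^ n * (lp_norm n q f)\<^sup>2"
proof -
  let ?A = "{\<alpha>. \<alpha> \<in> cube n \<and> hamming_weight n \<alpha> = k}"
  have "\<rho> ^ k * (lp_norm n 2 (level_proj n f k))\<^sup>2
      = (\<Sum>\<alpha>\<in>?A. \<rho> ^ hamming_weight n \<alpha> * fourier_coeff n f \<alpha> * fourier_coeff n f \<alpha>)"
    unfolding level_proj_norm_squared sum_distrib_left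
    by (intro sum.cong) (auto simp: power2_eq_square)
  also have "\<dots> \<le> noise_form n \<rho> f f"
    unfolding noise_form_def using \<rho> by (intro sum_mono2) (auto simp: mult.assoc)
  also have "\<dots> \<le> C ^ n * (lp_norm n q f)\<^sup>2"
    by (rule noise_form_le[OF assms])
  finally show ?thesis .
qed

subsection \<open>Interpolation of norms\<close>

text \<open>Weighted arithmetic-geometric mean inequality, applied termwise to \<open>a x\<close>
  and \<open>b x\<close> normalized by their sums.\<close>

lemma Hoelder_sum:
  fixes a b :: "'a \<Rightarrow> real"
  assumes "0 \<le> \<theta>" "\<theta> \<le> 1" "finite X" and a: "\<And>x. x \<in> X \<Longrightarrow> 0 \<le> a x" and b: "\<And>x. x \<in> X \<Longrightarrow> 0 \<le> b x"
    and pos: "0 < sum a X" "0 < sum b X"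
  shows "(\<Sum>x\<in>X. a x powr (1 - \<theta>) * b x powr \<theta>) \<le> sum a X powr (1 - \<theta>) * sum b X powr \<theta>"
proof -
  define A B where "A = sum a X" and "B = sum b X"
  have AB: "0 < A" "0 < B" using pos by (auto simp: A_def B_def)
  have "a x powr (1 - \<theta>) * b x powr \<theta>
      \<le> A powr (1 - \<theta>) * B powr \<theta> * ((1 - \<theta>) * (a x / A) + \<theta> * (b x / B))" if "x \<in> X" for x
  \<comment> \<open>\<open>0 powr t\<close> is 0 for every t, even t = 0, so a term with a vanishing
    factor contributes nothing on the left.\<close>
  proof (cases "a x = 0 \<or> b x = 0")
    case True
    then have "a x powr (1 - \<theta>) * b x powr \<theta> = 0" by auto
    moreover have "0 \<le> A powr (1 - \<theta>) * B powr \<theta> * ((1 - \<theta>) * (a x / A) + \<theta> * (b x / B))"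
      using a[OF that] b[OF that] assms AB
      by (intro mult_nonneg_nonneg add_nonneg_nonneg divide_nonneg_pos) auto
    ultimately show ?thesis by linarith
  next
    case False
    then have pos: "0 < a x" "0 < b x" using a[OF that] b[OF that] by auto
    have "(a x / A) powr (1 - \<theta>) * (b x / B) powr \<theta> \<le> (1 - \<theta>) * (a x / A) + \<theta> * (b x / B)"
      using pos AB assms by (intro Youngs_inequality_0) auto
    then have "A powr (1 - \<theta>) * B powr \<theta> * ((a x / A) powr (1 - \<theta>) * (b x / B) powr \<theta>)
        \<le> A powr (1 - \<theta>) * B powr \<theta> * ((1 - \<theta>) * (a x / A) + \<theta> * (b x / B))"
      by (intro mult_left_mono) auto
    moreover have "A powr (1 - \<theta>) * B powr \<theta> * ((a x / A) powr (1 - \<theta>) * (b x / B) powr \<theta>)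
        = a x powr (1 - \<theta>) * b x powr \<theta>"
      using pos AB by (simp add: powr_divide)
    ultimately show ?thesis by simp
  qed
  then have "(\<Sum>x\<in>X. a x powr (1 - \<theta>) * b x powr \<theta>)
      \<le> (\<Sum>x\<in>X. A powr (1 - \<theta>) * B powr \<theta> * ((1 - \<theta>) * (a x / A) + \<theta> * (b x / B)))"
    by (rule sum_mono)
  also have "\<dots> = A powr (1 - \<theta>) * B powr \<theta> * ((1 - \<theta>) * (sum a X / A) + \<theta> * (sum b X / B))"
    by (simp only: sum_distrib_left[symmetric] sum.distrib sum_divide_distrib[symmetric])
  also have "\<dots> = A powr (1 - \<theta>) * B powr \<theta>"
    using AB by (simp flip: A_def B_def)
  finally show ?thesis by (simp add: A_def B_def)
qed

lemma lp_norm_1: "lp_norm n 1 f = (\<Sum>x\<in>cube n. \<bar>f x\<bar>) / 2 ^ n"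
  by (simp add: lp_norm_def sum_nonneg)

text \<open>In these terms the second argument of \<open>\<pi>\<close> in the theorem is \<open>H\<^sup>-\<^sup>1(1 - entropy_deficit n f p)\<close>.\<close>

definition entropy_deficit :: "nat \<Rightarrow> ((nat \<Rightarrow> nat) \<Rightarrow> real) \<Rightarrow> real \<Rightarrow> real" where
  "entropy_deficit n f p = p / (p - 1) * norm_rate n f p"

context
  fixes n :: nat and f :: "(nat \<Rightarrow> nat) \<Rightarrow> real"
  assumes nonzero: "\<exists>x\<in>cube n. f x \<noteq> 0"
begin

lemma sum_abs_powr_pos: "0 < (\<Sum>x\<in>cube n. \<bar>f x\<bar> powr p)"
proof -
  obtain x where "x \<in> cube n" "f x \<noteq> 0" using nonzero by blast
  then show ?thesis by (intro sum_pos2[of _ x]) auto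
qed

lemma lp_norm_pos: "0 < lp_norm n p f"
  using sum_abs_powr_pos[of p] by (simp add: lp_norm_def)

lemma lp_norm_powr: "p \<noteq> 0 \<Longrightarrow> lp_norm n p f powr p = (\<Sum>x\<in>cube n. \<bar>f x\<bar> powr p) / 2 ^ n"
  using sum_abs_powr_pos[of p] by (simp add: lp_norm_def powr_powr)

lemma lp_norm_1_le:
  assumes "1 \<le> p"
  shows "lp_norm n 1 f \<le> lp_norm n p f"
proof -
  have "(\<Sum>x\<in>cube n. 1 powr (1 - 1 / p) * (\<bar>f x\<bar> powr p) powr (1 / p))
      \<le> (\<Sum>x\<in>cube n. 1) powr (1 - 1 / p) * (\<Sum>x\<in>cube n. \<bar>f x\<bar> powr p) powr (1 / p)"
    using assms sum_abs_powr_pos by (intro Hoelder_sum) auto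
  then have "(\<Sum>x\<in>cube n. \<bar>f x\<bar>) \<le> (2 ^ n) powr (1 - 1 / p) * (\<Sum>x\<in>cube n. \<bar>f x\<bar> powr p) powr (1 / p)"
    using assms by (simp add: powr_powr)
  also have "\<dots> = 2 ^ n * lp_norm n p f"
    using sum_abs_powr_pos[of p] by (simp add: lp_norm_def powr_divide powr_diff)
  finally show ?thesis by (simp add: lp_norm_1 field_simps)
qed

text \<open>No |f x| exceeds the sum S of all of them, so |f x|^p \<le> |f x| S^(p-1). This is what
  keeps \<open>entropy_deficit\<close> at most 1, so that \<open>binary_entropy_inv\<close> is
  evaluated inside its domain.\<close>

lemma lp_norm_le_lp_norm_1:
  assumes "1 \<le> p"
  shows "lp_norm n p f \<le> 2 powr (real n * (1 - 1 / p)) * lp_norm n 1 f"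
proof -
  define S where "S = (\<Sum>x\<in>cube n. \<bar>f x\<bar>)"
  have S: "0 < S" using sum_abs_powr_pos[of 1] by (simp add: S_def)
  have "(\<Sum>x\<in>cube n. \<bar>f x\<bar> powr p) \<le> (\<Sum>x\<in>cube n. \<bar>f x\<bar> * S powr (p - 1))"
  proof (rule sum_mono)
    fix x assume x: "x \<in> cube n"
    then have "\<bar>f x\<bar> \<le> S" unfolding S_def by (intro member_le_sum) auto
    then have "\<bar>f x\<bar> * \<bar>f x\<bar> powr (p - 1) \<le> \<bar>f x\<bar> * S powr (p - 1)"
      using assms by (intro mult_left_mono powr_mono2) auto
    then show "\<bar>f x\<bar> powr p \<le> \<bar>f x\<bar> * S powr (p - 1)"
      by (simp add: powr_mult_base)
  qed
  also have "\<dots> = S powr p"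
    using S by (simp add: powr_mult_base flip: sum_distrib_right S_def)
  finally have "lp_norm n p f \<le> (S powr p / 2 ^ n) powr (1 / p)"
    unfolding lp_norm_def using assms
    by (intro powr_mono2 divide_right_mono divide_nonneg_nonneg sum_nonneg) auto
  also have "\<dots> = 2 powr (real n * (1 - 1 / p)) * lp_norm n 1 f"
    using S assms
    by (simp add: lp_norm_1 powr_divide powr_powr right_diff_distrib powr_diff powr_realpow[symmetric] flip: S_def)
  finally show ?thesis .
qed

lemma lp_norm_eq_rate:
  assumes "1 \<le> n"
  shows "lp_norm n p f = 2 powr (real n * norm_rate n f p) * lp_norm n 1 f"
  using assms lp_norm_pos[of p] lp_norm_pos[of 1] by (simp add: norm_rate_def powr_log_cancel)

lemma entropy_deficit_bounds:
  assumes "1 \<le> n" "1 < p"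
  shows "0 \<le> entropy_deficit n f p" "entropy_deficit n f p \<le> 1"
proof -
  have pos: "0 < lp_norm n 1 f" by (rule lp_norm_pos)
  have "1 * lp_norm n 1 f \<le> 2 powr (real n * norm_rate n f p) * lp_norm n 1 f"
    using lp_norm_1_le[of p] lp_norm_eq_rate[OF assms(1), of p] assms by simp
  then have "2 powr 0 \<le> 2 powr (real n * norm_rate n f p)"
    using pos by simp
  then have "0 \<le> norm_rate n f p"
    using assms by (subst (asm) powr_le_cancel_iff) (auto simp: zero_le_mult_iff)
  then show "0 \<le> entropy_deficit n f p" using assms by (simp add: entropy_deficit_def)
  have "2 powr (real n * norm_rate n f p) \<le> 2 powr (real n * (1 - 1 / p))"
    using lp_norm_le_lp_norm_1[of p] lp_norm_eq_rate[OF assms(1), of p] assms pos by simp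
  then have "norm_rate n f p \<le> 1 - 1 / p"
    using assms by (subst (asm) powr_le_cancel_iff) auto
  then show "entropy_deficit n f p \<le> 1"
    using assms by (simp add: entropy_deficit_def field_simps)
qed

text \<open>Logarithmic convexity of the q-th moments: \<theta> solves q = (1 - \<theta>) + p
  \<theta>. The factor p/(p - 1) in the deficit is chosen so that p enters the bound for the q-norm
  through the deficit alone.\<close>

lemma lp_norm_interpolate:
  assumes "1 \<le> n" "1 < p" "1 \<le> q" "q \<le> p"
  shows "lp_norm n q f \<le> 2 powr (real n * (1 - 1 / q) * entropy_deficit n f p) * lp_norm n 1 f"
proof -
  define \<theta> where "\<theta> = (q - 1) / (p - 1)"
  have \<theta>: "0 \<le> \<theta>" "\<theta> \<le> 1" and "\<theta> * (p - 1) = q - 1"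
    using assms by (auto simp: \<theta>_def)
  then have q: "1 - \<theta> + p * \<theta> = q" by (simp add: algebra_simps)
  define u where "u = lp_norm n 1 f"
  have u: "0 < u" unfolding u_def by (rule lp_norm_pos)
  have eq: "\<bar>f x\<bar> powr (1 - \<theta>) * (\<bar>f x\<bar> powr p) powr \<theta> = \<bar>f x\<bar> powr q" for x
    by (simp add: powr_powr q flip: powr_add)
  have "(\<Sum>x\<in>cube n. \<bar>f x\<bar> powr (1 - \<theta>) * (\<bar>f x\<bar> powr p) powr \<theta>)
      \<le> (\<Sum>x\<in>cube n. \<bar>f x\<bar>) powr (1 - \<theta>) * (\<Sum>x\<in>cube n. \<bar>f x\<bar> powr p) powr \<theta>"
    using \<theta> sum_abs_powr_pos[of p] sum_abs_powr_pos[of 1] by (intro Hoelder_sum) auto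
  then have "(\<Sum>x\<in>cube n. \<bar>f x\<bar> powr q)
      \<le> (2 ^ n * u) powr (1 - \<theta>) * (2 ^ n * lp_norm n p f powr p) powr \<theta>"
    using assms by (simp only: eq) (simp add: lp_norm_powr u_def lp_norm_1)
  also have "\<dots> = 2 ^ n * (u powr (1 - \<theta>) * lp_norm n p f powr (p * \<theta>))"
    using u lp_norm_pos[of p]
    by (simp add: powr_mult powr_powr powr_diff)
  also have "lp_norm n p f powr (p * \<theta>) = 2 powr (real n * norm_rate n f p * (p * \<theta>)) * u powr (p * \<theta>)"
    using u by (simp add: lp_norm_eq_rate[OF assms(1), of p] powr_mult powr_powr flip: u_def)
  also have "real n * norm_rate n f p * (p * \<theta>) = real n * (q - 1) * entropy_deficit n f p"
    by (simp add: \<theta>_def entropy_deficit_def)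
  finally have "(\<Sum>x\<in>cube n. \<bar>f x\<bar> powr q)
      \<le> 2 powr (real n * (q - 1) * entropy_deficit n f p) * (u powr (1 - \<theta>) * u powr (p * \<theta>)) * 2 ^ n"
    by (simp only: mult_ac)
  then have "(\<Sum>x\<in>cube n. \<bar>f x\<bar> powr q) / 2 ^ n
      \<le> 2 powr (real n * (q - 1) * entropy_deficit n f p) * u powr q"
    by (simp only: powr_add[symmetric] q pos_divide_le_eq zero_less_power zero_less_numeral)
  then have "lp_norm n q f \<le> (2 powr (real n * (q - 1) * entropy_deficit n f p) * u powr q) powr (1 / q)"
    unfolding lp_norm_def using assms by (intro powr_mono2) (auto intro!: divide_nonneg_nonneg sum_nonneg)
  also have "\<dots> = 2 powr (real n * (1 - 1 / q) * entropy_deficit n f p) * u"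
    using assms u by (simp add: powr_mult powr_powr field_simps)
  finally show ?thesis by (simp add: u_def)
qed

text \<open>The rate r of the p-norm occurs as r - (p - 2)/(2p - 2) r, which is half the deficit. In
  terms of the deficit and the 1-norm, p has disappeared from the bound.\<close>

lemma level_bound_eq:
  assumes "1 \<le> n" "2 \<le> p"
  shows "level_bound n f p k =
    2 powr (real n * (pi_fun (min (real k / real n) ((real n - real k) / real n))
        (binary_entropy_inv (1 - entropy_deficit n f p)) + entropy_deficit n f p / 2)) * lp_norm n 1 f"
proof -
  define \<pi> where "\<pi> = pi_fun (min (real k / real n) ((real n - real k) / real n))
    (binary_entropy_inv (1 - entropy_deficit n f p))"
  define r where "r = norm_rate n f p"
  have "level_bound n f p k
      = 2 powr ((\<pi> - (p - 2) / (2 * p - 2) * r) * real n) * (2 powr (real n * r) * lp_norm n 1 f)"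
    unfolding level_bound_def \<pi>_def r_def entropy_deficit_def
    using lp_norm_eq_rate[OF assms(1), of p] by simp
  also have "\<dots> = 2 powr ((\<pi> - (p - 2) / (2 * p - 2) * r) * real n + real n * r) * lp_norm n 1 f"
    by (simp add: powr_add)
  also have "(\<pi> - (p - 2) / (2 * p - 2) * r) * real n + real n * r
      = real n * (\<pi> + entropy_deficit n f p / 2)"
  proof -
    have "r - (p - 2) / (2 * p - 2) * r = entropy_deficit n f p / 2"
      using assms by (simp add: entropy_deficit_def r_def divide_simps) (simp add: algebra_simps)
    moreover have "(\<pi> - (p - 2) / (2 * p - 2) * r) * real n + real n * r
        = real n * (\<pi> + (r - (p - 2) / (2 * p - 2) * r))"
      by (simp only: ring_distribs mult_ac)
    ultimately show ?thesis by simp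
  qed
  finally show ?thesis by (simp add: \<pi>_def)
qed

end

subsection \<open>Binary entropy\<close>

lemma binary_entropy_0 [simp]: "binary_entropy 0 = 0"
  by (simp add: binary_entropy_def)

lemma binary_entropy_half [simp]: "binary_entropy (1 / 2) = 1"
proof -
  have "log 2 (1 / 2 :: real) = - 1" by (simp add: log_divide)
  then show ?thesis by (simp add: binary_entropy_def)
qed

lemma binary_entropy_has_derivative:
  assumes "0 < x" "x < 1"
  shows "(binary_entropy has_real_derivative log 2 ((1 - x) / x)) (at x)"
proof -
  have "((\<lambda>x. (- x * ln x - (1 - x) * ln (1 - x)) / ln 2) has_real_derivative
      (ln (1 - x) - ln x) / ln 2) (at x)"
    using assms by (auto intro!: derivative_eq_intros)
  moreover have "(ln (1 - x) - ln x) / ln 2 = log 2 ((1 - x) / x)"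
    using assms by (simp add: log_def ln_div)
  moreover have "binary_entropy = (\<lambda>x. (- x * ln x - (1 - x) * ln (1 - x)) / ln 2)"
    by (auto simp: binary_entropy_def log_def diff_divide_distrib)
  ultimately show ?thesis by simp
qed

lemma continuous_on_binary_entropy: "continuous_on {0..1/2} binary_entropy"
proof -
  have *: "((\<lambda>x::real. x * ln x) \<longlongrightarrow> 0) (at_right 0)"
  proof (rule tendsto_sandwich)
    \<comment> \<open>From ln z \<le> z - 1 at z = 1 / sqrt x. Only the endpoint 0 needs this;
      elsewhere the entropy is differentiable.\<close>
    have "- 2 * sqrt x \<le> x * ln x" if "0 < x" for x
    proof -
      have "ln (1 / sqrt x) \<le> 1 / sqrt x - 1" using that by (intro ln_le_minus_one) auto
      then have "- ln x / 2 \<le> 1 / sqrt x" using that by (simp add: ln_div ln_sqrt)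
      then have "x * (- ln x / 2) \<le> x * (1 / sqrt x)" using that by (intro mult_left_mono) auto
      then show ?thesis using that by (simp add: real_div_sqrt)
    qed
    then show "\<forall>\<^sub>F x in at_right 0. - 2 * sqrt x \<le> x * ln x"
      by (auto simp: eventually_at_filter)
    show "\<forall>\<^sub>F x::real in at_right 0. x * ln x \<le> 0"
      unfolding eventually_at_right[OF zero_less_one]
      by (intro exI[of _ 1]) (auto simp: mult_le_0_iff)
    show "((\<lambda>x. - 2 * sqrt x) \<longlongrightarrow> 0) (at_right 0)"
      by (auto intro!: tendsto_eq_intros)
  qed auto
  have "((\<lambda>x. - (x * ln x) / ln 2 - (1 - x) * log 2 (1 - x)) \<longlongrightarrow> 0) (at_right 0)"
  proof -
    have "((\<lambda>x::real. (1 - x) * log 2 (1 - x)) \<longlongrightarrow> (1 - 0) * log 2 (1 - 0)) (at_right 0)"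
      by (intro tendsto_intros) auto
    from tendsto_diff[OF tendsto_divide[OF tendsto_minus[OF *] tendsto_const[of "ln 2"]] this]
    show ?thesis by simp
  qed
  then have "(binary_entropy \<longlongrightarrow> binary_entropy 0) (at_right 0)"
    by (simp add: binary_entropy_def [abs_def] log_def)
  then have "continuous (at 0 within {0..1/2}) binary_entropy"
    by (simp add: continuous_within at_within_Icc_at_right)
  moreover have "continuous (at x within {0..1/2}) binary_entropy" if "x \<in> {0<..1/2}" for x
    using continuous_at_imp_continuous_within[OF DERIV_isCont[OF binary_entropy_has_derivative[of x]]] that
    by simp
  ultimately have "continuous (at x within {0..1/2}) binary_entropy" if "x \<in> {0..1/2}" for x
    using that by (cases "x = 0") auto
  then show ?thesis
    by (simp add: continuous_on_eq_continuous_within)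
qed

lemma binary_entropy_strict_mono:
  assumes "0 \<le> x" "x < y" "y \<le> 1 / 2"
  shows "binary_entropy x < binary_entropy y"
proof (rule DERIV_pos_imp_increasing_open[OF assms(2)])
  fix z assume "x < z" "z < y"
  then show "\<exists>d. (binary_entropy has_real_derivative d) (at z) \<and> 0 < d"
    using assms by (intro exI[of _ "log 2 ((1 - z) / z)"] conjI binary_entropy_has_derivative) auto
qed (use assms in \<open>auto intro: continuous_on_subset[OF continuous_on_binary_entropy]\<close>)

lemma inj_on_binary_entropy: "inj_on binary_entropy {0..1/2}"
proof (rule linorder_inj_onI)
  fix x y :: real assume "x < y" "x \<in> {0..1/2}" "y \<in> {0..1/2}"
  then show "binary_entropy x \<noteq> binary_entropy y"
    using binary_entropy_strict_mono[of x y] by auto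
qed auto

lemma binary_entropy_inv:
  assumes "0 \<le> h" "h \<le> 1"
  shows "binary_entropy_inv h \<in> {0..1/2}" "binary_entropy (binary_entropy_inv h) = h"
proof -
  obtain y where "0 \<le> y" "y \<le> 1 / 2" "binary_entropy y = h"
    using IVT'[of binary_entropy 0 h "1/2"] assms continuous_on_binary_entropy by auto
  then have "h \<in> binary_entropy ` {0..1/2}" by auto
  then show "binary_entropy_inv h \<in> {0..1/2}" "binary_entropy (binary_entropy_inv h) = h"
    unfolding binary_entropy_inv_def
    by (rule the_inv_into_into[OF inj_on_binary_entropy _ order_refl]
        f_the_inv_into_f[OF inj_on_binary_entropy])+
qed

subsection \<open>The two-point inequality\<close>

text \<open>The derivative is required in the open interval only: below, the endpoints w = 0 and w =
  1 are reached by continuity.\<close>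

lemma DERIV_nonneg_imp_nondecreasing_open:
  fixes f :: "real \<Rightarrow> real"
  assumes "a \<le> b"
    and "\<And>x. a < x \<Longrightarrow> x < b \<Longrightarrow> \<exists>y. (f has_real_derivative y) (at x) \<and> 0 \<le> y"
    and "continuous_on {a..b} f"
  shows "f a \<le> f b"
proof (cases "a = b")
  case False
  then have "a < b" using assms by simp
  moreover have "f differentiable (at x)" if "a < x" "x < b" for x
    using assms(2)[OF that] real_differentiable_def by blast
  ultimately obtain l z where z: "a < z" "z < b" "(f has_real_derivative l) (at z)" "f b - f a = (b - a) * l"
    using MVT[OF _ assms(3)] by metis
  then have "0 \<le> l" using assms(2)[of z] DERIV_unique by blast
  then show ?thesis using z \<open>a < b\<close> by (smt (verit) mult_nonneg_nonneg)
qed simp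

lemma DERIV_nonpos_imp_nonincreasing_open:
  fixes f :: "real \<Rightarrow> real"
  assumes "a \<le> b"
    and "\<And>x. a < x \<Longrightarrow> x < b \<Longrightarrow> \<exists>y. (f has_real_derivative y) (at x) \<and> y \<le> 0"
    and "continuous_on {a..b} f"
  shows "f b \<le> f a"
proof -
  have "- f a \<le> - f b"
  proof (rule DERIV_nonneg_imp_nondecreasing_open[OF assms(1)])
    fix x assume "a < x" "x < b"
    then obtain y where "(f has_real_derivative y) (at x)" "y \<le> 0" using assms(2) by blast
    then show "\<exists>y. ((\<lambda>x. - f x) has_real_derivative y) (at x) \<and> 0 \<le> y"
      by (intro exI[of _ "- y"]) (auto intro: derivative_intros)
  qed (intro continuous_intros assms)
  then show ?thesis by simp
qed

section \<open>Monotonicity of quotients of artanh\<close>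

lemma artanh_ge_self:
  assumes "0 \<le> w" "w < 1"
  shows "w \<le> artanh (w::real)"
proof -
  have "artanh 0 - 0 \<le> artanh w - w"
  proof (rule DERIV_nonneg_imp_nondecreasing_open[OF assms(1)])
    fix x assume x: "0 < x" "x < w"
    then have "x\<^sup>2 < 1" using assms by (simp add: abs_square_less_1)
    then have "((\<lambda>w. artanh w - w) has_real_derivative 1 / (1 - x\<^sup>2) - 1) (at x)" "0 \<le> 1 / (1 - x\<^sup>2) - 1"
      using x assms by (auto intro!: derivative_eq_intros simp: field_simps)
    then show "\<exists>y. ((\<lambda>w. artanh w - w) has_real_derivative y) (at x) \<and> 0 \<le> y" by blast
  next
    show "continuous_on {0..w} (\<lambda>w. artanh w - w)"
      using assms by (intro continuous_intros) auto
  qed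
  then show ?thesis by simp
qed

lemma artanh_pos: "0 < w \<Longrightarrow> w < 1 \<Longrightarrow> 0 < artanh (w::real)"
  using artanh_ge_self[of w] by simp

text \<open>The expression is 1/E(w) for the logarithmic slope E(w) = w artanh'(w) / artanh w. Its
  derivative has the sign of w - (1 + w^2) artanh w, which is nonpositive since artanh w \<ge>
  w.\<close>

lemma artanh_scaled_antimono:
  assumes "0 < v" "v \<le> w" "w < 1"
  shows "(1 - w\<^sup>2) * artanh w / w \<le> (1 - v\<^sup>2) * artanh v / (v::real)"
proof (rule DERIV_nonpos_imp_nonincreasing[OF assms(2)])
  fix x assume x: "v \<le> x" "x \<le> w"
  then have x01: "0 < x" "x < 1" using assms by auto
  then have x2: "x\<^sup>2 < 1" by (simp add: abs_square_less_1)
  have "((\<lambda>x. (1 - x\<^sup>2) * artanh x / x) has_real_derivative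
      (((1 - x\<^sup>2) * (1 / (1 - x\<^sup>2)) + (- 2 * x) * artanh x) * x - (1 - x\<^sup>2) * artanh x) / (x * x)) (at x)"
    using x01 by (auto intro!: derivative_eq_intros)
  moreover have "(((1 - x\<^sup>2) * (1 / (1 - x\<^sup>2)) + (- 2 * x) * artanh x) * x - (1 - x\<^sup>2) * artanh x) / (x * x) \<le> 0"
  proof -
    have "((1 - x\<^sup>2) * (1 / (1 - x\<^sup>2)) + (- 2 * x) * artanh x) * x - (1 - x\<^sup>2) * artanh x
        = x - (1 + x\<^sup>2) * artanh x"
      using x2 by (simp add: algebra_simps power2_eq_square)
    also have "\<dots> \<le> 0"
      using artanh_ge_self[of x] x01 mult_mono[of 1 "1 + x\<^sup>2" x "artanh x"] by simp
    finally show ?thesis using x01 by (intro divide_nonpos_pos) auto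
  qed
  ultimately show "\<exists>y. ((\<lambda>x. (1 - x\<^sup>2) * artanh x / x) has_real_derivative y) (at x) \<and> y \<le> 0"
    by blast
qed

lemma scale_in_unit_interval:
  fixes \<rho> w :: real
  assumes "0 < \<rho>" "\<rho> \<le> 1" "0 < w" "w < 1"
  shows "0 < \<rho> * w" "\<rho> * w \<le> w" "\<rho> * w < 1"
  using assms mult_right_mono[of \<rho> 1 w] by (simp, linarith+)

text \<open>With E(z) = z artanh'(z) / artanh z, the logarithmic derivative of the quotient is
  (E(\<rho> x) - E(x)) / x, and E is increasing. This is the source of the single sign change in the
  two-point problem.\<close>

lemma artanh_ratio_antimono:
  fixes \<rho> :: real
  assumes \<rho>: "0 < \<rho>" "\<rho> \<le> 1" and "0 < v" "v \<le> w" "w < 1"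
  shows "artanh (\<rho> * w) / artanh w \<le> artanh (\<rho> * v) / artanh v"
proof (rule DERIV_nonpos_imp_nonincreasing[OF assms(4)])
  fix x assume x: "v \<le> x" "x \<le> w"
  then have x01: "0 < x" "x < 1" using assms by auto
  have rx: "0 < \<rho> * x" "\<rho> * x \<le> x" "\<rho> * x < 1"
    using scale_in_unit_interval[OF \<rho> x01] by auto
  have x2: "x\<^sup>2 < 1" "(\<rho> * x)\<^sup>2 < 1" using x01 rx by (auto simp: abs_square_less_1)
  have a: "0 < artanh x" using x01 by (rule artanh_pos)
  define d where "d = (1 / (1 - (\<rho> * x)\<^sup>2) * \<rho> * artanh x - artanh (\<rho> * x) * (1 / (1 - x\<^sup>2)))
      / (artanh x * artanh x)"
  have "((\<lambda>x. artanh (\<rho> * x)) has_real_derivative 1 / (1 - (\<rho> * x)\<^sup>2) * \<rho>) (at x)"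
    using rx by (intro DERIV_chain2[OF artanh_real_has_field_derivative]) (auto intro!: derivative_eq_intros)
  then have "((\<lambda>x. artanh (\<rho> * x) / artanh x) has_real_derivative d) (at x)"
    unfolding d_def using a x01 by (intro DERIV_divide artanh_real_has_field_derivative) auto
  moreover have "d \<le> 0"
  proof -
    have "(1 - x\<^sup>2) * artanh x / x * (\<rho> * x) \<le> (1 - (\<rho> * x)\<^sup>2) * artanh (\<rho> * x) / (\<rho> * x) * (\<rho> * x)"
      using rx x01 by (intro mult_right_mono artanh_scaled_antimono) auto
    then have "\<rho> * artanh x * (1 - x\<^sup>2) \<le> artanh (\<rho> * x) * (1 - (\<rho> * x)\<^sup>2)"
      using x01 \<rho> by (simp add: mult_ac)
    then have "1 / (1 - (\<rho> * x)\<^sup>2) * \<rho> * artanh x \<le> artanh (\<rho> * x) * (1 / (1 - x\<^sup>2))"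
      using x2 by (simp add: frac_le_eq divide_le_eq pos_le_divide_eq)
    then show ?thesis unfolding d_def using a by (intro divide_nonpos_pos) auto
  qed
  ultimately show "\<exists>y. ((\<lambda>x. artanh (\<rho> * x) / artanh x) has_real_derivative y) (at x) \<and> y \<le> 0"
    by blast
qed

text \<open>The two sides differ by \<rho> u v, so equality holds when one value vanishes. This
  endpoint q = 1 serves k = 0 and deficit 1, where the generic choice degenerates.\<close>

lemma two_point_ineq_1:
  assumes "0 \<le> \<rho>"
  shows "two_point_ineq \<rho> 1 (1 + \<rho>)"
proof -
  have "(1 + \<rho>) / 4 * (u\<^sup>2 + v\<^sup>2) + (1 - \<rho>) / 2 * (u * v) \<le> (1 + \<rho>) * ((u + v) / 2)\<^sup>2"
    if "0 \<le> u" "0 \<le> v" for u v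
  proof -
    have "(1 + \<rho>) * ((u + v) / 2)\<^sup>2 - ((1 + \<rho>) / 4 * (u\<^sup>2 + v\<^sup>2) + (1 - \<rho>) / 2 * (u * v)) = \<rho> * (u * v)"
      by (simp add: power2_eq_square field_simps)
    then show ?thesis using assms that by (smt (verit) mult_nonneg_nonneg)
  qed
  then show ?thesis by (simp add: two_point_ineq_def powr_numeral)
qed

lemma two_point_ineq_2: "two_point_ineq 1 2 1"
  by (simp add: two_point_ineq_def)

definition two_point_mean :: "real \<Rightarrow> real \<Rightarrow> real" where
  "two_point_mean q w = ((1 + w) powr q + (1 - w) powr q) / 2"

text \<open>
  On the functions \<open>1 \<plusminus> w\<close> the logarithm of the quotient of the two sides has a derivative of the
  sign of \<open>artanh (\<rho> w) - (q - 1) artanh w\<close>, which changes only once.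
\<close>

lemma two_point_ineq_optimal:
  fixes \<rho> w\<^sub>0 :: real
  defines "q \<equiv> 1 + artanh (\<rho> * w\<^sub>0) / artanh w\<^sub>0"
  assumes \<rho>: "0 < \<rho>" "\<rho> \<le> 1" and w0: "0 < w\<^sub>0" "w\<^sub>0 < 1"
  shows "two_point_ineq \<rho> q ((1 + \<rho> * w\<^sub>0\<^sup>2) / two_point_mean q w\<^sub>0 powr (2 / q))"
proof -
  have rw: "0 < \<rho> * w \<and> \<rho> * w < 1" if "0 < w" "w < 1" for w
    using scale_in_unit_interval[OF \<rho> that] by simp
  have q: "1 < q"
    unfolding q_def using artanh_pos[of w\<^sub>0] artanh_pos[of "\<rho> * w\<^sub>0"] rw[OF w0] w0 by simp
  have mean_pos: "0 < two_point_mean q w" if "0 \<le> w" for w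
    unfolding two_point_mean_def using that by (simp add: add_pos_nonneg)
  define \<Phi> where "\<Phi> w = ln (1 + \<rho> * w\<^sup>2) - 2 / q * ln (two_point_mean q w)" for w
  define d where "d w = 2 * \<rho> * w / (1 + \<rho> * w\<^sup>2)
      - 2 / q * ((q * (1 + w) powr (q - 1) - q * (1 - w) powr (q - 1)) / 2 / two_point_mean q w)" for w
  have pos1: "0 < 1 + \<rho> * w\<^sup>2" for w
    using \<rho> by (simp add: add_pos_nonneg)
  have cont: "continuous_on {0..1} \<Phi>"
  proof -
    have "continuous_on {0..1} (\<lambda>w::real. (1 - w) powr q)"
      using q by (intro continuous_on_powr' continuous_intros) auto
    moreover have "continuous_on {0..1} (\<lambda>w::real. (1 + w) powr q)"
      using q by (intro continuous_on_powr' continuous_intros) auto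
    ultimately have "continuous_on {0..1} (two_point_mean q)"
      unfolding two_point_mean_def [abs_def]
      by (intro continuous_on_divide continuous_on_add continuous_on_const) auto
    then show ?thesis
      unfolding \<Phi>_def [abs_def] using pos1 mean_pos
      by (intro continuous_on_diff continuous_on_mult continuous_on_ln continuous_intros)
         (auto simp: order_less_imp_not_eq2)
  qed
  have deriv: "(\<Phi> has_real_derivative d w) (at w)" if "0 < w" "w < 1" for w
  proof -
    have "((\<lambda>w. (1 + w) powr q) has_real_derivative q * (1 + w) powr (q - 1) * 1) (at w)"
      using that by (intro DERIV_chain2[OF has_real_derivative_powr]) (auto intro!: derivative_eq_intros)
    moreover have "((\<lambda>w. (1 - w) powr q) has_real_derivative q * (1 - w) powr (q - 1) * (- 1)) (at w)"
      using that by (intro DERIV_chain2[OF has_real_derivative_powr]) (auto intro!: derivative_eq_intros)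
    ultimately have "(two_point_mean q has_real_derivative
        (q * (1 + w) powr (q - 1) * 1 + q * (1 - w) powr (q - 1) * (- 1)) / 2) (at w)"
      unfolding two_point_mean_def [abs_def] by (intro DERIV_cdivide DERIV_add)
    then have "(two_point_mean q has_real_derivative (q * (1 + w) powr (q - 1) - q * (1 - w) powr (q - 1)) / 2) (at w)"
      by simp
    from DERIV_chain2[OF DERIV_ln_divide[OF mean_pos] this] that
    have "((\<lambda>w. ln (two_point_mean q w)) has_real_derivative
        (q * (1 + w) powr (q - 1) - q * (1 - w) powr (q - 1)) / 2 / two_point_mean q w) (at w)"
      by (simp add: mult.commute)
    moreover have "((\<lambda>w. ln (1 + \<rho> * w\<^sup>2)) has_real_derivative 2 * \<rho> * w / (1 + \<rho> * w\<^sup>2)) (at w)"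
      using pos1[of w] by (auto intro!: derivative_eq_intros)
    ultimately show ?thesis
      unfolding \<Phi>_def d_def by (intro DERIV_diff DERIV_cmult)
  qed
  have sgn: "d w = 2 / ((1 + \<rho> * w\<^sup>2) * ((1 + w) powr q + (1 - w) powr q))
        * ((1 - w) powr (q - 1) * (1 + \<rho> * w) - (1 + w) powr (q - 1) * (1 - \<rho> * w))"
    if "0 < w" "w < 1" for w
  proof -
    define U V where "U = (1 + w) powr (q - 1)" and "V = (1 - w) powr (q - 1)"
    have U: "(1 + w) powr q = (1 + w) * U" and V: "(1 - w) powr q = (1 - w) * V"
      using that by (auto simp: U_def V_def powr_mult_base)
    have "0 < U" "0 < V" using that by (auto simp: U_def V_def)
    then have p: "0 < (1 + w) * U + (1 - w) * V" using that by (simp add: add_pos_pos)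
    define R S where "R = 1 + \<rho> * w\<^sup>2" and "S = (1 + w) * U + (1 - w) * V"
    have RS: "0 < R" "0 < S" using p pos1 by (auto simp: R_def S_def)
    have "d w = 2 * \<rho> * w / R - 2 / q * ((q * U - q * V) / 2 / (S / 2))"
      by (simp add: d_def two_point_mean_def U V U_def[symmetric] V_def[symmetric] R_def S_def)
    also have "\<dots> = 2 * \<rho> * w / R - 2 * (U - V) / S"
    proof -
      have "q * U - q * V = q * (U - V)" by (simp add: algebra_simps)
      then show ?thesis using q by simp
    qed
    also have "\<dots> = 2 / (R * S) * (\<rho> * w * S - (U - V) * R)"
      using RS by (simp add: divide_simps)
    also have "\<rho> * w * S - (U - V) * R = V * (1 + \<rho> * w) - U * (1 - \<rho> * w)"
      by (simp add: R_def S_def algebra_simps power2_eq_square)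
    finally show ?thesis
      unfolding U V by (simp only: R_def S_def U_def V_def)
  qed
  \<comment> \<open>Both products in \<open>sgn\<close> are positive; comparing their logarithms
    gives exactly the comparison of artanh(\<rho> w) with (q - 1) artanh w.\<close>
  have sgn': "((q - 1) * artanh w \<le> artanh (\<rho> * w) \<longrightarrow> 0 \<le> d w)
      \<and> (artanh (\<rho> * w) \<le> (q - 1) * artanh w \<longrightarrow> d w \<le> 0)" if "0 < w" "w < 1" for w
  proof -
    have A: "(1 - w) powr (q - 1) * (1 + \<rho> * w) = exp ((q - 1) * ln (1 - w) + ln (1 + \<rho> * w))"
      using that rw[OF that] by (simp add: powr_def exp_add)
    have B: "(1 + w) powr (q - 1) * (1 - \<rho> * w) = exp ((q - 1) * ln (1 + w) + ln (1 - \<rho> * w))"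
      using that rw[OF that] by (simp add: powr_def exp_add)
    have pre: "0 \<le> 2 / ((1 + \<rho> * w\<^sup>2) * ((1 + w) powr q + (1 - w) powr q))"
      using pos1[of w] by simp
    have art: "artanh w = (ln (1 + w) - ln (1 - w)) / 2" "artanh (\<rho> * w) = (ln (1 + \<rho> * w) - ln (1 - \<rho> * w)) / 2"
      using that rw[OF that] by (auto simp: artanh_def ln_div)
    show ?thesis
    proof (intro conjI impI)
      assume "(q - 1) * artanh w \<le> artanh (\<rho> * w)"
      then have "(q - 1) * ln (1 + w) + ln (1 - \<rho> * w) \<le> (q - 1) * ln (1 - w) + ln (1 + \<rho> * w)"
        unfolding art by argo
      then show "0 \<le> d w"
        unfolding sgn[OF that] A B by (intro mult_nonneg_nonneg pre) simp
    next
      assume "artanh (\<rho> * w) \<le> (q - 1) * artanh w"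
      then have "(q - 1) * ln (1 - w) + ln (1 + \<rho> * w) \<le> (q - 1) * ln (1 + w) + ln (1 - \<rho> * w)"
        unfolding art by argo
      then show "d w \<le> 0"
        unfolding sgn[OF that] A B by (intro mult_nonneg_nonpos pre) simp
    qed
  qed
  \<comment> \<open>As q - 1 is the value of the antitone quotient artanh(\<rho> w) / artanh w at
    \<open>w\<^sub>0\<close>, the function \<Phi> increases up to \<open>w\<^sub>0\<close> and
    decreases afterwards.\<close>
  have max: "\<Phi> w \<le> \<Phi> w\<^sub>0" if "0 \<le> w" "w \<le> 1" for w
  proof (cases "w \<le> w\<^sub>0")
    case True
    show ?thesis
    proof (rule DERIV_nonneg_imp_nondecreasing_open[OF True])
      fix x assume x: "w < x" "x < w\<^sub>0"
      then have x01: "0 < x" "x < 1" using that w0 by auto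
      have "q - 1 \<le> artanh (\<rho> * x) / artanh x"
        unfolding q_def using artanh_ratio_antimono[OF \<rho> x01(1) _ w0(2)] x by simp
      then have "0 \<le> d x" using sgn'[OF x01] artanh_pos[OF x01] by (simp add: pos_le_divide_eq)
      then show "\<exists>y. (\<Phi> has_real_derivative y) (at x) \<and> 0 \<le> y" using deriv[OF x01] by blast
    qed (use that w0 in \<open>auto intro: continuous_on_subset[OF cont]\<close>)
  next
    case False
    then have le: "w\<^sub>0 \<le> w" by simp
    show ?thesis
    proof (rule DERIV_nonpos_imp_nonincreasing_open[OF le])
      fix x assume x: "w\<^sub>0 < x" "x < w"
      then have x01: "0 < x" "x < 1" using that w0 by auto
      have "artanh (\<rho> * x) / artanh x \<le> q - 1"
        unfolding q_def using artanh_ratio_antimono[OF \<rho> w0(1) _ x01(2)] x by simp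
      then have "d x \<le> 0" using sgn'[OF x01] artanh_pos[OF x01] by (simp add: pos_divide_le_eq)
      then show "\<exists>y. (\<Phi> has_real_derivative y) (at x) \<and> y \<le> 0" using deriv[OF x01] by blast
    qed (use that w0 in \<open>auto intro: continuous_on_subset[OF cont]\<close>)
  qed
  define C where "C = (1 + \<rho> * w\<^sub>0\<^sup>2) / two_point_mean q w\<^sub>0 powr (2 / q)"
  have exp\<Phi>: "exp (\<Phi> w) = (1 + \<rho> * w\<^sup>2) / two_point_mean q w powr (2 / q)" if "0 \<le> w" for w
    using pos1[of w] mean_pos[OF that] by (simp add: \<Phi>_def exp_diff powr_def)
  have max': "1 + \<rho> * w\<^sup>2 \<le> C * two_point_mean q w powr (2 / q)" if "0 \<le> w" "w \<le> 1" for w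
  proof -
    have "exp (\<Phi> w) \<le> exp (\<Phi> w\<^sub>0)" using max[OF that] by simp
    then show ?thesis
      using mean_pos[OF that(1)] that w0 by (simp add: exp\<Phi> C_def pos_divide_le_eq)
  qed
  \<comment> \<open>Both sides are homogeneous of degree 2, so dividing by the mean h of u and v
    reduces to the values 1 \<plusminus> w. The case w = 1, where v = 0, is included.\<close>
  have *: "(1 + \<rho>) / 4 * (u\<^sup>2 + v\<^sup>2) + (1 - \<rho>) / 2 * (u * v) \<le> C * ((u powr q + v powr q) / 2) powr (2 / q)"
    if uv: "0 \<le> v" "v \<le> u" for u v
  proof (cases "u = 0")
    case True
    then show ?thesis using uv by simp
  next
    case False
    define h w where "h = (u + v) / 2" and "w = (u - v) / (u + v)"
    have h: "0 < h" and w: "0 \<le> w" "w \<le> 1" using False uv by (auto simp: h_def w_def)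
    have u: "u = h * (1 + w)" and v: "v = h * (1 - w)"
      using False uv by (auto simp: h_def w_def field_simps)
    have "(1 + \<rho>) / 4 * (u\<^sup>2 + v\<^sup>2) + (1 - \<rho>) / 2 * (u * v) = h\<^sup>2 * (1 + \<rho> * w\<^sup>2)"
      unfolding u v by (simp add: power2_eq_square field_simps)
    also have "\<dots> \<le> h\<^sup>2 * (C * two_point_mean q w powr (2 / q))"
      using max'[OF w] by (intro mult_left_mono) auto
    also have "h\<^sup>2 = (h powr q) powr (2 / q)"
      using h q by (simp add: powr_powr)
    also have "(h powr q) powr (2 / q) * (C * two_point_mean q w powr (2 / q))
        = C * (h powr q * two_point_mean q w) powr (2 / q)"
      using h mean_pos[OF w(1)] by (simp add: powr_mult)
    also have "h powr q * two_point_mean q w = (u powr q + v powr q) / 2"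
    proof -
      have "u powr q = h powr q * (1 + w) powr q" "v powr q = h powr q * (1 - w) powr q"
        unfolding u v using h w by (auto intro: powr_mult)
      then show ?thesis by (simp add: two_point_mean_def distrib_left)
    qed
    finally show ?thesis .
  qed
  show ?thesis
    unfolding two_point_ineq_def C_def[symmetric]
  proof (intro allI impI)
    fix u v :: real assume uv: "0 \<le> u" "0 \<le> v"
    show "(1 + \<rho>) / 4 * (u\<^sup>2 + v\<^sup>2) + (1 - \<rho>) / 2 * (u * v) \<le> C * ((u powr q + v powr q) / 2) powr (2 / q)"
      using *[of v u] *[of u v] uv by (cases "v \<le> u") (auto simp: add.commute mult.commute)
  qed
qed

subsection \<open>The saddle points and the exponent \<open>\<pi>\<close>\<close>

text \<open>
  The roots \<open>w_minus \<le> w_plus\<close> of \<open>(1 - x) w\<^sup>2 - (1 - 2 y) w + x\<close> are the critical points of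
  \<open>saddle x y\<close>, the exponent of the generating function \<open>(1 + w)\<^bsup>(1-y)n\<^esup> (1 - w)\<^bsup>yn\<^esup> / w\<^bsup>xn\<^esup>\<close>
  of the Krawchouk polynomials.
\<close>

definition w_minus :: "real \<Rightarrow> real \<Rightarrow> real" where
  "w_minus x y = (1 - 2 * y - sqrt ((1 - 2 * y)\<^sup>2 - 4 * x * (1 - x))) / (2 * (1 - x))"

definition w_plus :: "real \<Rightarrow> real \<Rightarrow> real" where
  "w_plus x y = (1 - 2 * y + sqrt ((1 - 2 * y)\<^sup>2 - 4 * x * (1 - x))) / (2 * (1 - x))"

definition saddle :: "real \<Rightarrow> real \<Rightarrow> real \<Rightarrow> real" where
  "saddle x y w = (1 - y) * log 2 (1 + w) + y * log 2 (1 - w) - x * log 2 w"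

text \<open>Nonnegativity of the discriminant of the quadratic. Free of square roots it reads (1 -
  2x)^2 + (1 - 2y)^2 \<ge> 1, which shows the symmetry in x and y.\<close>

definition saddle_region :: "real \<Rightarrow> real \<Rightarrow> bool" where
  "saddle_region x y \<longleftrightarrow> 0 \<le> x \<and> x \<le> 1 / 2 \<and> 0 \<le> y \<and> y \<le> 1 / 2 \<and> 4 * x * (1 - x) \<le> (1 - 2 * y)\<^sup>2"

lemma le_half_minus_sqrt_iff:
  assumes "0 \<le> x" "x \<le> 1" "y \<le> 1 / 2"
  shows "y \<le> 1 / 2 - sqrt (x * (1 - x)) \<longleftrightarrow> 4 * x * (1 - x) \<le> (1 - 2 * (y::real))\<^sup>2"
proof -
  have nn: "0 \<le> x * (1 - x)" using assms by simp
  have "y \<le> 1 / 2 - sqrt (x * (1 - x)) \<longleftrightarrow> 2 * sqrt (x * (1 - x)) \<le> 1 - 2 * y" by auto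
  also have "\<dots> \<longleftrightarrow> (2 * sqrt (x * (1 - x)))\<^sup>2 \<le> (1 - 2 * y)\<^sup>2"
    using assms nn by (subst abs_le_square_iff[symmetric]) simp
  also have "(2 * sqrt (x * (1 - x)))\<^sup>2 = 4 * x * (1 - x)"
    using nn by (simp add: power_mult_distrib)
  finally show ?thesis .
qed

lemma saddle_region_iff:
  assumes "0 \<le> x" "x \<le> 1 / 2" "0 \<le> y" "y \<le> 1 / 2"
  shows "y \<le> 1 / 2 - sqrt (x * (1 - x)) \<longleftrightarrow> saddle_region x y"
  using assms le_half_minus_sqrt_iff[of x y] by (auto simp: saddle_region_def)

lemma saddle_region_mono:
  assumes "saddle_region x' y'" "0 \<le> x" "x \<le> x'" "0 \<le> y" "y \<le> y'"
  shows "saddle_region x y"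
proof -
  have "x * (1 - x) \<le> x' * (1 - x')"
  proof -
    have "x' * (1 - x') - x * (1 - x) = (x' - x) * (1 - x - x')" by (simp add: algebra_simps)
    then show ?thesis using assms by (smt (verit) mult_nonneg_nonneg saddle_region_def field_sum_of_halves)
  qed
  moreover have "(1 - 2 * y')\<^sup>2 \<le> (1 - 2 * y)\<^sup>2"
    using assms by (intro power_mono) (auto simp: saddle_region_def)
  ultimately have "4 * x * (1 - x) \<le> (1 - 2 * y)\<^sup>2"
    using assms unfolding saddle_region_def mult.assoc by linarith
  then show ?thesis using assms by (auto simp: saddle_region_def)
qed

lemma saddle_region_sym: "saddle_region x y \<longleftrightarrow> saddle_region y x"
  by (auto simp: saddle_region_def power2_eq_square algebra_simps)

context
  fixes x y :: real
  assumes region: "saddle_region x y"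
begin

lemma region_bounds: "0 \<le> x" "x \<le> 1 / 2" "x < 1" "0 \<le> y" "y \<le> 1 / 2"
  using region by (auto simp: saddle_region_def)

lemma w_sum: "w_minus x y + w_plus x y = (1 - 2 * y) / (1 - x)"
proof -
  have "w_minus x y + w_plus x y = 2 * (1 - 2 * y) / (2 * (1 - x))"
    by (simp add: w_minus_def w_plus_def add_divide_distrib[symmetric] )
  then show ?thesis by (simp only: mult_divide_mult_cancel_left[OF zero_neq_numeral[symmetric]])
qed

lemma w_prod: "w_minus x y * w_plus x y = x / (1 - x)"
proof -
  have s: "sqrt ((1 - 2 * y)\<^sup>2 - 4 * x * (1 - x)) * sqrt ((1 - 2 * y)\<^sup>2 - 4 * x * (1 - x))
      = (1 - 2 * y)\<^sup>2 - 4 * x * (1 - x)"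
    using region by (simp add: saddle_region_def)
  have "w_minus x y * w_plus x y = ((1 - 2 * y)\<^sup>2
      - sqrt ((1 - 2 * y)\<^sup>2 - 4 * x * (1 - x)) * sqrt ((1 - 2 * y)\<^sup>2 - 4 * x * (1 - x)))
      / (2 * (1 - x) * (2 * (1 - x)))"
    by (simp add: w_minus_def w_plus_def algebra_simps power2_eq_square)
  also have "\<dots> = (4 * x * (1 - x)) / (2 * (1 - x) * (2 * (1 - x)))"
    unfolding s by simp
  also have "\<dots> = (4 * (1 - x) * x) / (4 * (1 - x) * (1 - x))" by (simp only: mult_ac)
  also have "\<dots> = x / (1 - x)" using region_bounds by (subst mult_divide_mult_cancel_left) auto
  finally show ?thesis .
qed

lemma w_factor: "(1 - x) * w\<^sup>2 - (1 - 2 * y) * w + x = (1 - x) * ((w - w_minus x y) * (w - w_plus x y))"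
proof -
  have "(1 - x) * ((w - w_minus x y) * (w - w_plus x y))
      = (1 - x) * w\<^sup>2 - (1 - x) * (w_minus x y + w_plus x y) * w + (1 - x) * (w_minus x y * w_plus x y)"
    by (simp add: algebra_simps power2_eq_square)
  then show ?thesis unfolding w_sum w_prod using region_bounds by simp
qed

lemma w_minus_le_w_plus: "w_minus x y \<le> w_plus x y"
  unfolding w_minus_def w_plus_def
  using region region_bounds by (intro divide_right_mono) (auto simp: saddle_region_def)

lemma w_minus_nonneg: "0 \<le> w_minus x y"
proof -
  have "sqrt ((1 - 2 * y)\<^sup>2 - 4 * x * (1 - x)) \<le> sqrt ((1 - 2 * y)\<^sup>2)"
    using region_bounds by (intro real_sqrt_le_mono) auto
  then show ?thesis unfolding w_minus_def using region_bounds by simp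
qed

lemma w_minus_pos: "0 < x \<Longrightarrow> 0 < w_minus x y"
  using w_prod w_minus_nonneg region_bounds by (cases "w_minus x y = 0") auto

lemma w_plus_nonneg: "0 \<le> w_plus x y"
  using w_minus_nonneg w_minus_le_w_plus by simp

text \<open>At w = 1 the quadratic equals 2y > 0, so 1 is not between the roots; the sum of the
  roots is below 2, so 1 is not below them either.\<close>

lemma w_plus_less_1:
  assumes "0 < y"
  shows "w_plus x y < 1"
proof (rule ccontr)
  assume "\<not> w_plus x y < 1"
  moreover have "(1 - x) * ((1 - w_minus x y) * (1 - w_plus x y)) = 2 * y"
    using w_factor[of 1] by simp
  then have "0 < (1 - w_minus x y) * (1 - w_plus x y)"
    using assms region_bounds by (metis diff_gt_0_iff_gt zero_less_mult_pos mult_pos_pos zero_less_numeral)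
  moreover have "w_minus x y + w_plus x y < 2"
    unfolding w_sum using region_bounds assms by (simp add: pos_divide_less_eq)
  ultimately show False by (auto simp: zero_less_mult_iff)
qed

lemma between_w:
  assumes "(1 - x) * w\<^sup>2 - (1 - 2 * y) * w + x \<le> 0"
  shows "w_minus x y \<le> w" "w \<le> w_plus x y"
proof -
  have "(w - w_minus x y) * (w - w_plus x y) \<le> 0"
    using assms region_bounds unfolding w_factor by (simp add: mult_le_0_iff)
  then show "w_minus x y \<le> w" "w \<le> w_plus x y"
    using w_minus_le_w_plus by (auto simp: mult_le_0_iff)
qed

lemma w_plus_root: "(1 - x) * (w_plus x y)\<^sup>2 - (1 - 2 * y) * w_plus x y + x = 0"
  unfolding w_factor by simp

lemma w_minus_root: "(1 - x) * (w_minus x y)\<^sup>2 - (1 - 2 * y) * w_minus x y + x = 0"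
  unfolding w_factor by simp

lemma saddle_has_derivative:
  assumes "0 < w" "w < 1"
  shows "(saddle x y has_real_derivative
    - ((1 - x) * w\<^sup>2 - (1 - 2 * y) * w + x) / (w * (1 - w\<^sup>2) * ln 2)) (at w)"
proof -
  have "(saddle x y has_real_derivative
      ((1 - y) * (1 / (1 + w)) + y * (- 1 / (1 - w)) - x * (1 / w)) / ln 2) (at w)"
    unfolding saddle_def [abs_def] log_def
    using assms by (auto intro!: derivative_eq_intros simp: diff_divide_distrib add_divide_distrib)
  moreover have "((1 - y) * (1 / (1 + w)) + y * (- 1 / (1 - w)) - x * (1 / w))
      = - ((1 - x) * w\<^sup>2 - (1 - 2 * y) * w + x) / (w * (1 - w\<^sup>2))"
  proof -
    have "1 - w\<^sup>2 = (1 + w) * (1 - w)" by (simp add: algebra_simps power2_eq_square)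
    then show ?thesis using assms
      by (simp add: divide_simps) (simp add: algebra_simps power2_eq_square)
  qed
  ultimately show ?thesis by simp
qed

lemma saddle_denominator_pos:
  assumes "0 < w" "w < 1"
  shows "0 < w * (1 - w\<^sup>2) * ln (2::real)"
  using assms by (simp add: abs_square_less_1)

lemma saddle_mono_between:
  assumes "0 < x" "0 < y" "w_minus x y \<le> v" "v \<le> w" "w \<le> w_plus x y"
  shows "saddle x y v \<le> saddle x y w"
proof (rule DERIV_nonneg_imp_nondecreasing[OF assms(4)])
  fix z assume z: "v \<le> z" "z \<le> w"
  then have z01: "0 < z" "z < 1"
    using assms w_minus_pos w_plus_less_1 by auto
  have "(1 - x) * z\<^sup>2 - (1 - 2 * y) * z + x \<le> 0"
    unfolding w_factor using assms z region_bounds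
    by (intro mult_nonneg_nonpos) (auto simp: mult_le_0_iff)
  then show "\<exists>d. (saddle x y has_real_derivative d) (at z) \<and> 0 \<le> d"
    using saddle_has_derivative[OF z01] saddle_denominator_pos[OF z01]
    by (intro exI conjI) (auto intro: divide_nonneg_pos)
qed

lemma saddle_antimono_above:
  assumes "0 < v" "w_plus x y \<le> v" "v \<le> w" "w < 1"
  shows "saddle x y w \<le> saddle x y v"
proof (rule DERIV_nonpos_imp_nonincreasing[OF assms(3)])
  fix z assume z: "v \<le> z" "z \<le> w"
  then have z01: "0 < z" "z < 1" using assms by auto
  have "0 \<le> (1 - x) * z\<^sup>2 - (1 - 2 * y) * z + x"
    unfolding w_factor using assms z region_bounds w_minus_le_w_plus
    by (intro mult_nonneg_nonneg) auto
  then show "\<exists>d. (saddle x y has_real_derivative d) (at z) \<and> d \<le> 0"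
    using saddle_has_derivative[OF z01] saddle_denominator_pos[OF z01]
    by (intro exI conjI) (auto intro: divide_nonpos_pos)
qed

lemma one_minus_w_prod: "(1 - w_minus x y) * (1 - w_plus x y) = 2 * y / (1 - x)"
  using w_factor[of 1] region_bounds by (simp add: field_simps)

lemma one_plus_w_prod: "(1 + w_minus x y) * (1 + w_plus x y) = 2 * (1 - y) / (1 - x)"
  using w_factor[of "- 1"] region_bounds by (simp add: field_simps)

end

text \<open>Adding over both roots w, v leaves only the logarithms of w v, (1 - w)(1 - v) and (1 +
  w)(1 + v). By Vieta these products are rational in x and y, and the entropies appear.\<close>

lemma saddle_sum:
  assumes r: "saddle_region x y" and "0 < x" "0 < y"
  shows "saddle x y (w_minus x y) + saddle x y (w_plus x y)
    = binary_entropy x + 1 - binary_entropy y"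
proof -
  note b = region_bounds[OF r]
  note pos = w_minus_pos[OF r \<open>0 < x\<close>] w_minus_le_w_plus[OF r] w_plus_less_1[OF r \<open>0 < y\<close>]
  have "log 2 (w_minus x y) + log 2 (w_plus x y) = log 2 (w_minus x y * w_plus x y)"
    using pos by (subst log_mult) auto
  also have "\<dots> = log 2 x - log 2 (1 - x)"
    using w_prod[OF r] assms b by (simp add: log_divide)
  finally have 1: "log 2 (w_minus x y) + log 2 (w_plus x y) = log 2 x - log 2 (1 - x)" .
  have "log 2 (1 - w_minus x y) + log 2 (1 - w_plus x y) = log 2 ((1 - w_minus x y) * (1 - w_plus x y))"
    using pos by (subst log_mult) auto
  also have "\<dots> = 1 + log 2 y - log 2 (1 - x)"
    using one_minus_w_prod[OF r] assms b by (simp add: log_divide log_mult)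
  finally have 2: "log 2 (1 - w_minus x y) + log 2 (1 - w_plus x y) = 1 + log 2 y - log 2 (1 - x)" .
  have "log 2 (1 + w_minus x y) + log 2 (1 + w_plus x y) = log 2 ((1 + w_minus x y) * (1 + w_plus x y))"
    using pos by (subst log_mult) auto
  also have "\<dots> = 1 + log 2 (1 - y) - log 2 (1 - x)"
    unfolding one_plus_w_prod[OF r] using assms b by (subst log_divide) (auto simp: log_mult simp del: right_diff_distrib_numeral)
  finally have 3: "log 2 (1 + w_minus x y) + log 2 (1 + w_plus x y) = 1 + log 2 (1 - y) - log 2 (1 - x)" .
  have "saddle x y (w_minus x y) + saddle x y (w_plus x y)
      = (1 - y) * (log 2 (1 + w_minus x y) + log 2 (1 + w_plus x y))
      + y * (log 2 (1 - w_minus x y) + log 2 (1 - w_plus x y))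
      - x * (log 2 (w_minus x y) + log 2 (w_plus x y))"
    by (simp add: saddle_def algebra_simps)
  also have "\<dots> = binary_entropy x + 1 - binary_entropy y"
    unfolding 1 2 3 binary_entropy_def by (simp add: algebra_simps)
  finally show ?thesis .
qed

text \<open>The discriminant is symmetric in x and y, so the radical b inside
  \<open>I_fun y x\<close> is the one in \<open>w_minus x y\<close>, and 1 - 2y - b = 2(1 - x) w.
  The identities \<open>q1\<close> and \<open>q2\<close> express the other arguments of logarithms
  through w; what remains is linear in the logarithms.\<close>

lemma I_fun_difference:
  assumes r: "saddle_region x y" and "0 < x" "0 < y"
  shows "I_fun y x - I_fun 0 x = saddle x y (w_minus x y) - binary_entropy x"
proof -
  note bd = region_bounds[OF r]
  define w where "w = w_minus x y"
  note w0 = w_minus_pos[OF r \<open>0 < x\<close>, folded w_def]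
  have w1: "w < 1"
    using w_minus_le_w_plus[OF r] w_plus_less_1[OF r \<open>0 < y\<close>] by (simp add: w_def)
  define a b where "a = 1 - 2 * x" and "b = sqrt (a\<^sup>2 - 4 * y * (1 - y))"
  have x2: "x < 1 / 2"
  proof (rule ccontr)
    assume "\<not> x < 1 / 2"
    then have "x = 1 / 2" using bd by simp
    then have "saddle_region (1 / 2) y" using r by (simp only:)
    then have "1\<^sup>2 \<le> (1 - 2 * y)\<^sup>2" by (simp add: saddle_region_def)
    then show False using assms bd by (subst (asm) abs_le_square_iff[symmetric]) auto
  qed
  then have a: "0 < a" by (simp add: a_def)
  have disc: "(1 - 2 * y)\<^sup>2 - 4 * x * (1 - x) = a\<^sup>2 - 4 * y * (1 - y)"
    by (simp add: a_def algebra_simps power2_eq_square)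
  have b2: "b\<^sup>2 = a\<^sup>2 - 4 * y * (1 - y)" "0 \<le> b"
    using r by (auto simp: b_def disc[symmetric] saddle_region_def)
  have w: "w * (2 * (1 - x)) = 1 - 2 * y - b"
    unfolding w_def w_minus_def disc b_def using bd by simp
  define A E where "A = 1 - 2 * y - b" and "E = 2 * (1 - y) - a\<^sup>2 - a * b"
  have A: "0 < A" using w w0 bd by (metis A_def diff_gt_0_iff_gt mult_pos_pos zero_less_numeral)
  have q1: "(a + b) * (1 + w) = 2 * (1 - y) * (1 - w)"
  proof -
    have "(a + b) * (2 * (1 - x) + w * (2 * (1 - x))) = 2 * (1 - y) * (2 * (1 - x) - w * (2 * (1 - x)))"
      unfolding w using b2 by (simp add: a_def algebra_simps power2_eq_square)
    then have "2 * (1 - x) * ((a + b) * (1 + w)) = 2 * (1 - x) * (2 * (1 - y) * (1 - w))"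
      by (simp add: algebra_simps)
    then show ?thesis using bd by simp
  qed
  have q2: "E * (1 - x) * (1 + w)\<^sup>2 = 4 * (1 - y)\<^sup>2 * A"
  proof -
    have "E * (2 * (1 - x) + w * (2 * (1 - x)))\<^sup>2 = 16 * (1 - x) * (1 - y)\<^sup>2 * A"
      unfolding w using b2 unfolding E_def A_def a_def by algebra
    then have "4 * (1 - x) * (E * (1 - x) * (1 + w)\<^sup>2) = 4 * (1 - x) * (4 * (1 - y)\<^sup>2 * A)"
      by (simp add: algebra_simps power2_eq_square)
    then show ?thesis using bd by simp
  qed
  have E: "0 < E"
  proof -
    have "0 < E * ((1 - x) * (1 + w)\<^sup>2)" using q2 A bd by (simp add: mult.assoc)
    moreover have "0 < (1 - x) * (1 + w)\<^sup>2" using bd w0 by simp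
    ultimately show ?thesis by (rule zero_less_mult_pos2)
  qed
  define lP lM lx l1x ly lA lE where "lP = log 2 (1 + w)" and "lM = log 2 (1 - w)" and "lx = log 2 x"
    and "l1x = log 2 (1 - x)" and "ly = log 2 (1 - y)" and "lA = log 2 A" and "lE = log 2 E"
  have L1: "log 2 ((a + b) / (2 * (1 - y))) = lM - lP"
  proof -
    have "(a + b) / (2 * (1 - y)) = (1 - w) / (1 + w)" using q1 w0 bd by (simp add: field_simps)
    then show ?thesis using w0 w1 by (simp add: log_divide lM_def lP_def)
  qed
  have L2: "lE + l1x + 2 * lP = 2 + 2 * ly + lA"
  proof -
    have "log 2 (E * (1 - x) * (1 + w)\<^sup>2) = lE + l1x + 2 * lP"
      using E w0 bd by (simp add: log_mult log_nat_power lE_def l1x_def lP_def)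
    moreover have "log 2 (4 * (1 - y)\<^sup>2 * A) = log 2 4 + 2 * ly + lA"
      using A bd by (simp add: log_mult log_nat_power ly_def lA_def)
    moreover have "log 2 4 = (2::real)" using log_nat_power[of 2 2 2] by simp
    ultimately show ?thesis using q2 by simp
  qed
  have L3: "log 2 w = lA - 1 - l1x"
  proof -
    have "w = A / (2 * (1 - x))" using w bd by (simp add: A_def field_simps)
    moreover have "log 2 (2 * (1 - x)) = 1 + l1x" using bd by (subst log_mult) (auto simp: l1x_def)
    moreover have "log 2 (A / (2 * (1 - x))) = lA - log 2 (2 * (1 - x))"
      unfolding lA_def using A bd by (subst log_divide) auto
    ultimately show ?thesis by (simp only:)
  qed
  have I1: "I_fun y x = ly + a / 2 * lA + y * (lM - lP) - lE / 2"
    using \<open>0 < x\<close> L1 unfolding I_fun_def Let_def ly_def lA_def lE_def A_def E_def a_def b_def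
    by simp
  \<comment> \<open>For first argument 0 the radical b equals a, so the arguments of the logarithms
    become 1 - a = 2x and 2 - 2 a^2 = 8 x (1 - x).\<close>
  have I0: "I_fun 0 x = a / 2 * (1 + lx) - (3 + lx + l1x) / 2"
  proof -
    have "log 2 (2 - a\<^sup>2 - a * a) = log 2 (2 ^ 3 * (x * (1 - x)))"
      by (simp add: a_def algebra_simps power2_eq_square)
    also have "\<dots> = 3 + lx + l1x"
      using \<open>0 < x\<close> bd log_nat_power[of 2 2 3] by (simp add: log_mult lx_def l1x_def)
    finally have "log 2 (2 - a\<^sup>2 - a * a) = 3 + lx + l1x" .
    moreover have "log 2 (1 - a) = 1 + lx" using \<open>0 < x\<close> by (simp add: a_def log_mult lx_def)
    moreover have "sqrt (a\<^sup>2) = a" using a by simp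
    ultimately show ?thesis
      using \<open>0 < x\<close> unfolding I_fun_def Let_def by (simp flip: a_def)
  qed
  have "saddle x y w - binary_entropy x
      = (1 - y) * lP + y * lM - x * (lA - 1 - l1x) + x * lx + (1 - x) * l1x"
    by (simp add: saddle_def binary_entropy_def L3 lP_def lM_def lx_def l1x_def)
  moreover have "ly = (lE + l1x + 2 * lP - 2 - lA) / 2" using L2 by simp
  ultimately show ?thesis
    unfolding I1 I0 w_def[symmetric] by (simp add: a_def field_simps)
qed

text \<open>In this form the sign of \<pi> and its monotonicity in y can be read off, because
  \<open>saddle x y\<close> increases from the smaller to the larger root.\<close>

lemma pi_fun_eq_saddle_diff:
  assumes r: "saddle_region x y" and "0 < x" "0 < y"
  shows "pi_fun x y = (saddle x y (w_minus x y) - saddle x y (w_plus x y)) / 2"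
proof -
  have "pi_fun x y = saddle x y (w_minus x y) - binary_entropy x + (binary_entropy x + binary_entropy y - 1) / 2"
    using saddle_region_iff[of x y] region_bounds[OF r] r I_fun_difference[OF assms]
    by (simp add: pi_fun_def)
  then show ?thesis using saddle_sum[OF assms] by argo
qed

text \<open>The two values of \<open>I_fun\<close> cancel, both being -1. For x = 0 or y = 0 a root
  lies at 0 or 1, on the boundary of the interval where the saddle formulas are derived.\<close>

lemma pi_fun_0_left: "y \<le> 1 / 2 \<Longrightarrow> pi_fun 0 y = (binary_entropy y - 1) / 2"
  by (simp add: pi_fun_def I_fun_def)

lemma pi_fun_0_right:
  assumes "0 \<le> x" "x \<le> 1 / 2"
  shows "pi_fun x 0 = (binary_entropy x - 1) / 2"
proof -
  have "4 * x * (1 - x) = 1 - (1 - 2 * x)\<^sup>2" by (simp add: power2_eq_square algebra_simps)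
  then have "4 * x * (1 - x) \<le> 1" by simp
  then have "0 \<le> 1 / 2 - sqrt (x * (1 - x))"
    using le_half_minus_sqrt_iff[of x 0] assms by simp
  then show ?thesis by (simp add: pi_fun_def)
qed

lemma pi_fun_eq_saddle:
  assumes r: "saddle_region x y" and "0 < x" "0 < y"
  shows "pi_fun x y = (binary_entropy x + 1 - binary_entropy y) / 2 - saddle x y (w_plus x y)"
  using pi_fun_eq_saddle_diff[OF assms] saddle_sum[OF assms] by argo

lemma binary_entropy_mono:
  "0 \<le> x \<Longrightarrow> x \<le> y \<Longrightarrow> y \<le> 1 / 2 \<Longrightarrow> binary_entropy x \<le> binary_entropy y"
  using binary_entropy_strict_mono[of x y] by fastforce

lemma binary_entropy_le_1: "0 \<le> x \<Longrightarrow> x \<le> 1 / 2 \<Longrightarrow> binary_entropy x \<le> 1"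
  using binary_entropy_mono[of x "1/2"] by (simp only: binary_entropy_half)

text \<open>The roots u, v for Y lie between the roots for y, so passing to u, v can only raise
  \<open>saddle\<close> at the lower point and lower it at the upper one. At fixed u \<le> v, the
  difference of the two values increases with y.\<close>

lemma pi_fun_mono:
  assumes R: "saddle_region x Y" and y: "0 < y" "y \<le> Y"
  shows "pi_fun x y \<le> pi_fun x Y"
proof (cases "x = 0")
  case True
  then show ?thesis
    using region_bounds[OF R] y binary_entropy_mono[of y Y] by (auto simp: pi_fun_0_left)
next
  case False
  note B = region_bounds[OF R]
  then have x: "0 < x" using False by simp
  have r: "saddle_region x y" using B y by (intro saddle_region_mono[OF R]) auto
  have Y: "0 < Y" using y by simp
  have below: "w_minus x y \<le> w \<and> w \<le> w_plus x y"
    if "0 \<le> w" "(1 - x) * w\<^sup>2 - (1 - 2 * Y) * w + x = 0" for w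
  proof -
    have "(1 - x) * w\<^sup>2 - (1 - 2 * y) * w + x \<le> (1 - x) * w\<^sup>2 - (1 - 2 * Y) * w + x"
      using mult_right_mono[of "1 - 2 * Y" "1 - 2 * y" w] that(1) y by linarith
    then show ?thesis using that between_w[OF r, of w] by simp
  qed
  note m = below[OF w_minus_nonneg[OF R] w_minus_root[OF R]]
  note p = below[OF w_plus_nonneg[OF R] w_plus_root[OF R]]
  define u v where "u = w_minus x Y" and "v = w_plus x Y"
  have uv: "0 < u" "u \<le> v" "v < 1"
    using w_minus_pos[OF R x] w_minus_le_w_plus[OF R] w_plus_less_1[OF R Y] by (auto simp: u_def v_def)
  have "saddle x y (w_minus x y) \<le> saddle x y u" "saddle x y v \<le> saddle x y (w_plus x y)"
    using m p uv unfolding u_def v_def by (intro saddle_mono_between[OF r x y(1)]; simp)+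
  moreover have "(saddle x y u - saddle x y v) - (saddle x Y u - saddle x Y v)
      = - ((Y - y) * ((log 2 (1 + v) - log 2 (1 + u)) + (log 2 (1 - u) - log 2 (1 - v))))"
    by (simp add: saddle_def algebra_simps)
  moreover have "0 \<le> (Y - y) * ((log 2 (1 + v) - log 2 (1 + u)) + (log 2 (1 - u) - log 2 (1 - v)))"
    using y uv by (intro mult_nonneg_nonneg) auto
  ultimately show ?thesis
    unfolding pi_fun_eq_saddle_diff[OF r x y(1)] pi_fun_eq_saddle_diff[OF R x Y] u_def[symmetric] v_def[symmetric]
    by argo
qed

lemma pi_fun_nonpos:
  assumes "0 \<le> x" "x \<le> 1 / 2" "0 \<le> y" "y \<le> 1 / 2"
  shows "pi_fun x y \<le> 0"
proof (cases "saddle_region x y")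
  case False
  then show ?thesis using saddle_region_iff[OF assms] by (simp add: pi_fun_def)
next
  case r: True
  consider "x = 0" | "y = 0" | "0 < x" "0 < y" using assms by linarith
  then show ?thesis
  proof cases
    case 3
    then show ?thesis
      using saddle_mono_between[OF r 3 order_refl w_minus_le_w_plus[OF r] order_refl]
      by (simp add: pi_fun_eq_saddle_diff[OF r 3])
  qed (use assms binary_entropy_le_1 in \<open>auto simp: pi_fun_0_left pi_fun_0_right\<close>)
qed

subsection \<open>The level inequality\<close>

text \<open>Take \<rho> = u/w for the roots u \<le> w, and w as extremizer. Then \<rho> w^2 = u w =
  x/(1 - x), and q artanh w = artanh u + artanh w, which by Vieta is half of ln((1 - y)/y). So the
  q-th powers of 1 + w and 1 - w stand in the ratio (1 - y) : y, and the constant becomes explicit.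
  In its exponent, the terms with \<rho> and q are those that cancel against the weight of level k
  and the interpolation.\<close>

lemma two_point_ineq_at_saddle:
  assumes r: "saddle_region x y" and x: "0 < x" and y: "0 < y"
  obtains \<rho> q where "0 < \<rho>" "\<rho> \<le> 1" "1 \<le> q" "q \<le> 2"
    "two_point_ineq \<rho> q (2 powr (x * log 2 \<rho> + 2 * pi_fun x y + (1 - binary_entropy y) * (2 / q - 1)))"
proof -
  note b = region_bounds[OF r]
  define u w where "u = w_minus x y" and "w = w_plus x y"
  have u: "0 < u" "u \<le> w" and w: "0 < w" "w < 1"
    using w_minus_pos[OF r x] w_minus_le_w_plus[OF r] w_plus_less_1[OF r y] by (auto simp: u_def w_def)
  then have u1: "u < 1" by simp
  define \<rho> q where "\<rho> = u / w" and "q = 1 + artanh u / artanh w"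
  have \<rho>: "0 < \<rho>" "\<rho> \<le> 1" and \<rho>w: "\<rho> * w = u" using u w by (auto simp: \<rho>_def)
  have art: "0 < artanh w" "0 < artanh u" using artanh_pos u u1 w by auto
  have art_eq: "artanh z = (ln (1 + z) - ln (1 - z)) / 2" if "0 < z" "z < 1" for z :: real
    using that by (simp add: artanh_def ln_div)
  have "artanh u \<le> artanh w"
    unfolding art_eq[OF u(1) u1] art_eq[OF w] using u w
    by (intro divide_right_mono diff_mono) auto
  then have q: "1 \<le> q" "q \<le> 2" using art by (auto simp: q_def)
  define M where "M = two_point_mean q w"
  have ratio: "q * (ln (1 + w) - ln (1 - w)) = ln (1 - y) - ln y"
  proof -
    have "q * artanh w = artanh w + artanh u" using art by (simp add: q_def field_simps)
    then have "q * (ln (1 + w) - ln (1 - w)) = (ln (1 + u) + ln (1 + w)) - (ln (1 - u) + ln (1 - w))"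
      unfolding art_eq[OF u(1) u1] art_eq[OF w] by argo
    also have "\<dots> = ln ((1 + u) * (1 + w)) - ln ((1 - u) * (1 - w))"
      using u w u1 by (simp add: ln_mult)
    also have "\<dots> = ln (2 * (1 - y) / (1 - x)) - ln (2 * y / (1 - x))"
      unfolding u_def w_def one_plus_w_prod[OF r] one_minus_w_prod[OF r] ..
    also have "\<dots> = (ln (2 * (1 - y)) - ln (1 - x)) - (ln (2 * y) - ln (1 - x))"
      using y b ln_div[of "2 * (1 - y)" "1 - x"] ln_div[of "2 * y" "1 - x"] by simp
    also have "\<dots> = ln (1 - y) - ln y"
    proof -
      have "ln (2 * (1 - y)) = ln 2 + ln (1 - y)" "ln (2 * y) = ln 2 + ln y"
        using y b by (subst ln_mult; simp)+
      then show ?thesis by linarith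
    qed
    finally show ?thesis .
  qed
  have "(1 - w) powr q = (1 + w) powr q * (y / (1 - y))"
  proof -
    have "(1 - w) powr q = exp (q * ln (1 + w) + (ln y - ln (1 - y)))"
      using w ratio by (simp add: powr_def algebra_simps)
    then show ?thesis using w y b by (simp add: powr_def exp_add exp_diff)
  qed
  then have M: "M = (1 + w) powr q / (2 * (1 - y))"
    using b by (simp add: M_def two_point_mean_def field_simps)
  have "log 2 M = q * log 2 (1 + w) - log 2 (2 * (1 - y))"
    unfolding M using w b by (subst log_divide) (auto simp: log_powr)
  then have logM: "log 2 M = q * log 2 (1 + w) - (1 + log 2 (1 - y))"
    using b by (subst (asm) log_mult) auto
  have ratio': "q * (log 2 (1 + w) - log 2 (1 - w)) = log 2 (1 - y) - log 2 y"
    using ratio by (simp add: log_def diff_divide_distrib[symmetric] times_divide_eq_right)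
  have logM': "log 2 M = q * ((1 - y) * log 2 (1 + w) + y * log 2 (1 - w)) - 1 + binary_entropy y"
  proof -
    have "log 2 M = q * ((1 - y) * log 2 (1 + w) + y * log 2 (1 - w))
        + y * (q * (log 2 (1 + w) - log 2 (1 - w))) - (1 + log 2 (1 - y))"
      unfolding logM by (simp add: algebra_simps)
    then show ?thesis unfolding ratio' by (simp add: binary_entropy_def algebra_simps)
  qed
  have Mpos: "0 < M" unfolding M using w b by simp
  have prod: "u * w = x / (1 - x)" using w_prod[OF r] by (simp add: u_def w_def)
  define C where "C = (1 + \<rho> * w\<^sup>2) / M powr (2 / q)"
  have "1 + \<rho> * w\<^sup>2 = 1 / (1 - x)"
  proof -
    have "\<rho> * w\<^sup>2 = x / (1 - x)"
      using prod \<rho>w by (simp add: power2_eq_square flip: mult.assoc)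
    then have "1 + \<rho> * w\<^sup>2 = 1 + x / (1 - x)" by simp
    also have "\<dots> = 1 / (1 - x)" using b by (simp add: field_simps)
    finally show ?thesis .
  qed
  then have C: "C = 1 / (1 - x) / M powr (2 / q)" by (simp add: C_def)
  have Cpos: "0 < C" unfolding C using Mpos b by simp
  have "log 2 C = - log 2 (1 - x) - 2 / q * log 2 M"
    unfolding C using Mpos b by (simp add: log_divide log_mult log_powr)
  also have "\<dots> = - log 2 (1 - x) - 2 * ((1 - y) * log 2 (1 + w) + y * log 2 (1 - w))
      + 2 / q * (1 - binary_entropy y)"
    unfolding logM' using q by (simp add: field_simps)
  also have "\<dots> = x * log 2 \<rho> + 2 * pi_fun x y + (1 - binary_entropy y) * (2 / q - 1)"
  proof -
    have "log 2 \<rho> = log 2 u - log 2 w" unfolding \<rho>_def using u w by (simp add: log_divide)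
    moreover have "log 2 u + log 2 w = log 2 x - log 2 (1 - x)"
      using prod u w x b by (metis log_mult log_divide less_eq_real_def not_less
          order_less_irrefl diff_gt_0_iff_gt)
    ultimately have 1: "log 2 \<rho> = log 2 x - log 2 (1 - x) - 2 * log 2 w" by simp
    show ?thesis
      unfolding pi_fun_eq_saddle[OF r x y] saddle_def w_def[symmetric] 1
      by (simp add: binary_entropy_def[of x] field_simps)
  qed
  finally have "C = 2 powr (x * log 2 \<rho> + 2 * pi_fun x y + (1 - binary_entropy y) * (2 / q - 1))"
    using Cpos powr_log_cancel[of 2 C] by simp
  moreover have "two_point_ineq \<rho> q C"
    using two_point_ineq_optimal[OF \<rho> w] by (simp add: \<rho>w q_def[symmetric] C_def M_def)
  ultimately show thesis using that \<rho> q by simp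
qed

lemma level_inequality_lower_half:
  assumes n: "1 \<le> n" and f: "\<exists>x\<in>cube n. f x \<noteq> 0" and p: "2 \<le> p" and k: "real k / real n \<le> 1 / 2"
  shows "lp_norm n 2 (level_proj n f k) \<le> level_bound n f p k"
proof -
  define x a y u where "x = real k / real n" and "a = entropy_deficit n f p"
    and "y = binary_entropy_inv (1 - a)" and "u = lp_norm n 1 f"
  have a: "0 \<le> a" "a \<le> 1" using entropy_deficit_bounds[OF f n, of p] p by (auto simp: a_def)
  have y: "0 \<le> y" "y \<le> 1 / 2" and Hy: "binary_entropy y = 1 - a"
    using binary_entropy_inv[of "1 - a"] a by (auto simp: y_def)
  have x: "0 \<le> x" "x \<le> 1 / 2" using k by (auto simp: x_def)
  have nx: "real n * x = real k" using n by (simp add: x_def)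
  have u: "0 \<le> u" by (simp add: u_def lp_norm_nonneg)
  have min: "min (real k / real n) ((real n - real k) / real n) = x"
    using k n by (simp add: x_def min_def field_simps)
  have bound: "level_bound n f p k = 2 powr (real n * (pi_fun x y + a / 2)) * u"
    unfolding level_bound_eq[OF f n p] min by (simp add: a_def y_def u_def)
  define N where "N = lp_norm n 2 (level_proj n f k)"
  \<comment> \<open>Nothing of \<rho> and q survives: \<rho>^k cancels against 2^(k log \<rho>), and
    squaring the interpolated q-norm contributes a(2 - 2/q), which together with a(2/q - 1) gives
    a.\<close>
  have main: "N \<le> level_bound n f p k"
    if \<rho>: "0 < \<rho>" "\<rho> \<le> 1" and q: "1 \<le> q" "q \<le> 2"
      and tp: "two_point_ineq \<rho> q (2 powr (x * log 2 \<rho> + 2 * pi_fun x y + a * (2 / q - 1)))" for \<rho> q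
  proof -
    define e where "e = x * log 2 \<rho> + 2 * pi_fun x y + a * (2 / q - 1)"
    have "\<rho> ^ k * N\<^sup>2 \<le> (2 powr e) ^ n * (lp_norm n q f)\<^sup>2"
      unfolding N_def e_def using \<rho> q tp by (intro level_proj_norm_le) auto
    also have "\<dots> \<le> (2 powr e) ^ n * (2 powr (real n * (1 - 1 / q) * a) * u)\<^sup>2"
      unfolding a_def u_def using n p q
      by (intro mult_left_mono power_mono lp_norm_interpolate[OF f]) (auto intro: lp_norm_nonneg)
    also have "\<dots> = 2 powr (e * real n + 2 * (real n * (1 - 1 / q) * a)) * u\<^sup>2"
    proof -
      have 1: "(2 powr e) ^ n = 2 powr (e * real n)" by (simp add: powr_power mult.commute)
      have 2: "(2 powr c)\<^sup>2 = 2 powr (2 * c)" for c :: real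
        by (simp add: powr_power mult.commute)
      show ?thesis by (simp only: 1 2 power_mult_distrib powr_add mult.assoc)
    qed
    also have "e * real n + 2 * (real n * (1 - 1 / q) * a)
        = real k * log 2 \<rho> + real n * (2 * pi_fun x y + a)"
      using q unfolding e_def nx[symmetric] by (simp add: field_simps)
    also have "2 powr \<dots> = \<rho> ^ k * 2 powr (real n * (2 * pi_fun x y + a))"
    proof -
      have "2 powr (real k * log 2 \<rho>) = (2 powr log 2 \<rho>) ^ k" by (simp add: powr_power mult.commute)
      then show ?thesis using \<rho> by (simp add: powr_add)
    qed
    finally have "\<rho> ^ k * N\<^sup>2 \<le> \<rho> ^ k * (2 powr (real n * (2 * pi_fun x y + a)) * u\<^sup>2)"
      by (simp add: mult.assoc)
    then have "N\<^sup>2 \<le> 2 powr (real n * (2 * pi_fun x y + a)) * u\<^sup>2"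
      using \<rho> by simp
    also have "\<dots> = (level_bound n f p k)\<^sup>2"
      unfolding bound power_mult_distrib
      by (simp add: power2_eq_square algebra_simps flip: powr_add)
    finally show ?thesis
      by (rule power2_le_imp_le) (simp add: bound u)
  qed
  \<comment> \<open>The last, generic case has both roots strictly inside (0, 1). For k = 0 the
    choice \<rho> = 0 isolates the mean of f, as \<open>0 ^ 0 = 1\<close>. Outside the region \<pi>
    = 0, and \<rho> = 1, q = 2 give the Parseval bound.\<close>
  consider "k = 0" | "\<not> saddle_region x y" | "y = 0" "0 < x" | "saddle_region x y" "0 < x" "0 < y"
    using x y n by (cases "k = 0") (auto simp: x_def order_le_less)
  then have "N \<le> level_bound n f p k"
  proof cases
    case 1
    then have "x = 0" by (simp add: x_def)
    then have "level_bound n f p k = u"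
      using y by (simp add: bound pi_fun_0_left Hy field_simps)
    moreover have "0 ^ k * N\<^sup>2 \<le> (1 + 0) ^ n * (lp_norm n 1 f)\<^sup>2"
      unfolding N_def using two_point_ineq_1[of 0] by (intro level_proj_norm_le) auto
    ultimately have "N\<^sup>2 \<le> (level_bound n f p k)\<^sup>2" using 1 by (simp add: u_def)
    then show ?thesis by (rule power2_le_imp_le) (simp add: bound u)
  next
    case 2
    then have "pi_fun x y = 0" using saddle_region_iff[OF x y] by (simp add: pi_fun_def)
    then show ?thesis using two_point_ineq_2 by (intro main[of 1 2]) auto
  next
    case 3
    then have a1: "a = 1" using Hy by simp
    \<comment> \<open>For y = 0 the roots of the quadratic are x/(1 - x) and 1, so this is their
      quotient as in the generic case.\<close>
    define \<rho> where "\<rho> = x / (1 - x)"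
    have \<rho>: "0 < \<rho>" "\<rho> \<le> 1" using 3 x by (auto simp: \<rho>_def field_simps)
    have "1 + \<rho> = 1 / (1 - x)" using x by (simp add: \<rho>_def field_simps)
    also have "\<dots> = 2 powr (- log 2 (1 - x))"
      using x by (simp add: powr_minus_divide)
    also have "- log 2 (1 - x) = x * log 2 \<rho> + 2 * pi_fun x y + a * (2 / 1 - 1)"
      using 3 x by (simp add: a1 pi_fun_0_right \<rho>_def log_divide binary_entropy_def field_simps)
    finally show ?thesis using two_point_ineq_1[of \<rho>] \<rho> by (intro main[of \<rho> 1]) auto
  next
    case 4
    then obtain \<rho> q where *: "0 < \<rho>" "\<rho> \<le> 1" "1 \<le> q" "q \<le> 2" "two_point_ineq \<rho> q
        (2 powr (x * log 2 \<rho> + 2 * pi_fun x y + (1 - binary_entropy y) * (2 / q - 1)))"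
      by (rule two_point_ineq_at_saddle)
    show ?thesis by (rule main[OF *(1-4)]) (use *(5) in \<open>simp add: Hy\<close>)
  qed
  then show ?thesis by (simp add: N_def)
qed

lemma norm_rate_sign_twist [simp]: "norm_rate n (sign_twist n f) p = norm_rate n f p"
  by (simp add: norm_rate_def)

lemma level_bound_sign_twist:
  assumes "k \<le> n"
  shows "level_bound n (sign_twist n f) p (n - k) = level_bound n f p k"
  using assms by (simp add: level_bound_def of_nat_diff min.commute)

lemma level_inequality:
  assumes n: "1 \<le> n" and f: "\<exists>x\<in>cube n. f x \<noteq> 0" and p: "2 \<le> p" and k: "k \<le> n"
  shows "lp_norm n 2 (level_proj n f k) \<le> level_bound n f p k"
proof (cases "real k / real n \<le> 1 / 2")
  case True
  then show ?thesis by (rule level_inequality_lower_half[OF n f p])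
next
  case False
  then have "real (n - k) / real n \<le> 1 / 2" using n k by (simp add: field_simps of_nat_diff)
  moreover have "\<exists>x\<in>cube n. sign_twist n f x \<noteq> 0" using f by (simp add: sign_twist_def)
  ultimately have "lp_norm n 2 (level_proj n (sign_twist n f) (n - k)) \<le> level_bound n (sign_twist n f) p (n - k)"
    by (intro level_inequality_lower_half[OF n _ p])
  then show ?thesis
    by (simp add: level_proj_norm_sign_twist[OF k] level_bound_sign_twist[OF k])
qed

subsection \<open>Krawchouk polynomials\<close>

text \<open>The generating function of the values K_s(k) over s, as a polynomial in a formal
  variable z. Recurrences and orthogonality become statements about single coefficients.\<close>

definition kraw_gen :: "nat \<Rightarrow> nat \<Rightarrow> real poly" where
  "kraw_gen n k = [:1, - 1:] ^ k * [:1, 1:] ^ (n - k)"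

lemma coeff_kraw_gen:
  assumes "k \<le> n"
  shows "coeff (kraw_gen n k) s = krawchouk n s (real k)"
proof -
  have c: "coeff ([:1, b:] ^ m :: real poly) i = b ^ i * (real m gchoose i)" for b m i
  proof (cases "i \<le> m")
    case True
    then show ?thesis by (simp add: coeff_linear_poly_power binomial_gbinomial)
  next
    case False
    then have "degree ([:1, b:] ^ m) < i"
      using degree_power_le[of "[:1, b:]" m] by (auto split: if_splits)
    then show ?thesis
      using False by (simp add: coeff_eq_0 binomial_gbinomial[symmetric])
  qed
  have "coeff ([:1, - 1:] ^ k :: real poly) i = (- 1) ^ i * (real k gchoose i)"
    "coeff ([:1, 1:] ^ (n - k) :: real poly) i = (real n - real k) gchoose i" for i
    using assms by (simp_all add: c of_nat_diff)
  then show ?thesis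
    by (simp add: kraw_gen_def coeff_mult krawchouk_def)
qed

lemma krawchouk_0: "krawchouk n s 0 = real (n choose s)"
  by (simp add: krawchouk_def binomial_gbinomial gbinomial_0_left if_distrib[of "\<lambda>x. _ * x * _"] sum.delta cong: if_cong)

lemma krawchouk_reflect: "krawchouk n s (real n - t) = (- 1) ^ s * krawchouk n s t"
proof -
  have "krawchouk n s (real n - t)
      = (\<Sum>j\<le>s. (- 1) ^ (s - j) * ((real n - t) gchoose (s - j)) * (t gchoose (s - (s - j))))"
    unfolding krawchouk_def using sum.nat_diff_reindex[of "\<lambda>j. (- 1) ^ j * ((real n - t) gchoose j) * (t gchoose (s - j))" "Suc s"]
    by (simp add: lessThan_Suc_atMost)
  also have "\<dots> = (\<Sum>j\<le>s. (- 1) ^ s * ((- 1) ^ j * (t gchoose j) * ((real n - t) gchoose (s - j))))"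
  proof (intro sum.cong refl)
    fix j assume "j \<in> {..s}"
    then have "(- 1 :: real) ^ (s - j) = (- 1) ^ s * (- 1) ^ j" "s - (s - j) = j"
      by (auto simp: power_diff_conv_inverse power_inverse[symmetric] inverse_eq_divide)
    then show "(- 1) ^ (s - j) * ((real n - t) gchoose (s - j)) * (t gchoose (s - (s - j)))
        = (- 1) ^ s * ((- 1) ^ j * (t gchoose j) * ((real n - t) gchoose (s - j)))"
      by simp
  qed
  finally show ?thesis by (simp add: krawchouk_def sum_distrib_left)
qed

text \<open>With A = 1 - z and B = 1 + z one has 2z = B - A, so differentiating A^k B^(n-k) in z
  amounts to shifting k. At the ends k = 0 and k = n, the shifted term that would be meaningless
  carries a factor 0.\<close>

lemma kraw_gen_ode:
  assumes "k \<le> n"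
  shows "smult (real n) (kraw_gen n k) - smult 2 (pCons 0 (pderiv (kraw_gen n k)))
    = smult (real k) (kraw_gen n (k - 1)) + smult (real (n - k)) (kraw_gen n (k + 1))"
proof -
  define A B :: "real poly" where "A = [:1, - 1:]" and "B = [:1, 1:]"
  define m where "m = n - k"
  have n: "real n = real k + real m" using assms by (simp add: m_def)
  define Ak Bm where "Ak = smult (real k) (A ^ (k - 1))" and "Bm = smult (real m) (B ^ (m - 1))"
  have Ak: "Ak * A = smult (real k) (A ^ k)"
    by (cases k) (auto simp: Ak_def mult.commute)
  have Bm: "Bm * B = smult (real m) (B ^ m)"
    by (cases m) (auto simp: Bm_def mult.commute)
  have dA: "pderiv A = - 1" and dB: "pderiv B = 1"
    by (auto simp: A_def B_def pderiv_pCons one_pCons)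
  have pA: "pderiv (A ^ k) = - Ak" and pB: "pderiv (B ^ m) = Bm"
    by (auto simp: pderiv_power dA dB Ak_def Bm_def)
  have X: "smult 2 (pCons 0 q) = (B - A) * q" for q
    by (simp add: A_def B_def numeral_2_eq_2)
  have G: "kraw_gen n k = A ^ k * B ^ m" by (simp add: kraw_gen_def A_def B_def m_def)
  have G1: "smult (real k) (kraw_gen n (k - 1)) = Ak * (B ^ m * B)"
  proof (cases k)
    case (Suc j)
    then have "n - j = Suc m" using assms by (simp add: m_def)
    then show ?thesis using Suc by (simp add: kraw_gen_def A_def B_def Ak_def mult_ac)
  qed (simp add: Ak_def)
  have G2: "smult (real (n - k)) (kraw_gen n (k + 1)) = Bm * (A ^ k * A)"
  proof -
    have "n - (k + 1) = m - 1" by (simp add: m_def)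
    then show ?thesis by (simp add: kraw_gen_def A_def B_def Bm_def m_def mult_ac)
  qed
  have "smult (real n) (kraw_gen n k) = (Ak * A) * B ^ m + A ^ k * (Bm * B)"
    unfolding G n Ak Bm by (simp add: smult_add_left)
  moreover have "smult 2 (pCons 0 (pderiv (kraw_gen n k))) = (B - A) * (A ^ k * Bm - B ^ m * Ak)"
    unfolding X G pderiv_mult pA pB by (simp add: algebra_simps)
  ultimately show ?thesis
    unfolding G1 G2 by (simp add: algebra_simps)
qed

lemma krawchouk_recurrence:
  assumes "k \<le> n"
  shows "(real n - 2 * real s) * krawchouk n s (real k)
    = real k * krawchouk n s (real (k - 1)) + (real n - real k) * krawchouk n s (real (k + 1))"
proof -
  have c: "coeff (pCons 0 (pderiv p)) s = real s * coeff p s" for p :: "real poly"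
    by (cases s) (auto simp: coeff_pderiv)
  have "real n * coeff (kraw_gen n k) s - 2 * (real s * coeff (kraw_gen n k) s)
      = real k * coeff (kraw_gen n (k - 1)) s + real (n - k) * coeff (kraw_gen n (k + 1)) s"
    using arg_cong[OF kraw_gen_ode[OF assms], of "\<lambda>p. coeff p s"]
    by (simp only: coeff_diff coeff_smult coeff_add c)
  moreover have "real (n - k) * coeff (kraw_gen n (k + 1)) s = real (n - k) * krawchouk n s (real (k + 1))"
    using assms by (cases "k = n") (auto simp: coeff_kraw_gen)
  ultimately show ?thesis
    using assms by (simp add: coeff_kraw_gen of_nat_diff algebra_simps)
qed

section \<open>Orthogonality to polynomials of lower degree\<close>

lemma smult_sum_right: "smult c (\<Sum>i\<in>I. p i) = (\<Sum>i\<in>I. smult c (p i))"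
  by (induction I rule: infinite_finite_induct) (auto simp: smult_add_right)

text \<open>For q = 1 the sum is ((1 - z) + (1 + z))^n = 2^n, of degree 0. A factor k in q is
  absorbed into the binomial coefficient at the price of one factor 1 - z, so each degree of q costs
  at most one degree in z.\<close>

lemma degree_sum_kraw_gen:
  "degree (\<Sum>k\<le>n. smult (real (n choose k) * poly q (real k)) (kraw_gen n k)) \<le> degree q"
proof (induction "degree q" arbitrary: n q rule: less_induct)
  case less
  obtain c q' where q: "q = pCons c q'" by (cases q)
  have 0: "(\<Sum>k\<le>n. smult (real (n choose k)) (kraw_gen n k)) = [:2 ^ n:]" for n
  proof -
    have "(\<Sum>k\<le>n. smult (real (n choose k)) (kraw_gen n k)) = ([:1, - 1:] + [:1, 1:]) ^ n"
      unfolding binomial_ring by (intro sum.cong refl) (simp add: kraw_gen_def of_nat_poly)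
    also have "[:1, - 1:] + [:1, 1:] = [:2 :: real:]" by simp
    finally show ?thesis by (simp add: poly_const_pow)
  qed
  have 1: "(\<Sum>k\<le>n. smult (real (n choose k) * poly q (real k)) (kraw_gen n k))
      = smult c [:2 ^ n:] + (\<Sum>k\<le>n. smult (real (n choose k) * (real k * poly q' (real k))) (kraw_gen n k))"
    unfolding q 0[symmetric]
    by (simp add: smult_sum_right distrib_left smult_add_left sum.distrib mult_ac)
  show ?case
  proof (cases "q' = 0")
    case True
    then show ?thesis unfolding 1 by (simp add: degree_smult_eq)
  next
    case q'0: False
    have "degree (\<Sum>k\<le>n. smult (real (n choose k) * (real k * poly q' (real k))) (kraw_gen n k)) \<le> degree q"
    proof (cases n)
      case (Suc m)
      \<comment> \<open>k (n choose k) = n (m choose (k - 1)) lowers n to m = n - 1 and shifts the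
        summation index by one; the shift is compensated in the argument of
        \<open>q'\<close>.\<close>
      define q'' where "q'' = pcompose q' [:1, 1:]"
      have deg: "degree q'' = degree q'" by (simp add: q''_def degree_pcompose)
      have "(\<Sum>k\<le>n. smult (real (n choose k) * (real k * poly q' (real k))) (kraw_gen n k))
          = (\<Sum>k\<le>m. smult (real (n choose Suc k) * (real (Suc k) * poly q' (real (Suc k)))) (kraw_gen n (Suc k)))"
        unfolding Suc by (subst sum.atMost_Suc_shift) simp
      also have "\<dots> = (\<Sum>k\<le>m. smult (real n) ([:1, - 1:] * smult (real (m choose k) * poly q'' (real k)) (kraw_gen m k)))"
      proof (intro sum.cong refl)
        fix k
        have "real (Suc k) * real (n choose Suc k) = real n * real (m choose k)"
          unfolding Suc of_nat_mult[symmetric] Suc_times_binomial ..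
        then have "real (n choose Suc k) * (real (Suc k) * poly q' (real (Suc k)))
            = real n * (real (m choose k) * poly q'' (real k))"
          unfolding q''_def poly_pcompose by (simp add: mult_ac)
        moreover have "kraw_gen n (Suc k) = [:1, - 1:] * kraw_gen m k"
          by (simp only: kraw_gen_def Suc power_Suc diff_Suc_Suc mult.assoc)
        ultimately show "smult (real (n choose Suc k) * (real (Suc k) * poly q' (real (Suc k)))) (kraw_gen n (Suc k))
            = smult (real n) ([:1, - 1:] * smult (real (m choose k) * poly q'' (real k)) (kraw_gen m k))"
          by (simp only: mult_smult_right smult_smult)
      qed
      also have "\<dots> = smult (real n) ([:1, - 1:] * (\<Sum>k\<le>m. smult (real (m choose k) * poly q'' (real k)) (kraw_gen m k)))"
        by (simp only: smult_sum_right sum_distrib_left)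
      finally have eq: "(\<Sum>k\<le>n. smult (real (n choose k) * (real k * poly q' (real k))) (kraw_gen n k)) = \<dots>" .
      have "degree (smult (real n) ([:1, - 1:] * (\<Sum>k\<le>m. smult (real (m choose k) * poly q'' (real k)) (kraw_gen m k))))
          \<le> degree ([:1, - 1 :: real:]) + degree (\<Sum>k\<le>m. smult (real (m choose k) * poly q'' (real k)) (kraw_gen m k))"
        by (rule order_trans[OF degree_smult_le degree_mult_le])
      also have "\<dots> \<le> 1 + degree q''"
        using less.hyps[of q'' m] q q'0 deg by simp
      also have "\<dots> = degree q" using q q'0 deg by simp
      finally show ?thesis unfolding eq .
    qed simp
    then show ?thesis unfolding 1 by (intro degree_add_le) (auto simp: degree_smult_eq)
  qed
qed

lemma krawchouk_orthogonal:
  assumes "degree q < s"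
  shows "(\<Sum>k\<le>n. real (n choose k) * poly q (real k) * krawchouk n s (real k)) = 0"
proof -
  have "(\<Sum>k\<le>n. real (n choose k) * poly q (real k) * krawchouk n s (real k))
      = coeff (\<Sum>k\<le>n. smult (real (n choose k) * poly q (real k)) (kraw_gen n k)) s"
    by (simp add: coeff_sum coeff_kraw_gen)
  also have "\<dots> = 0"
    using degree_sum_kraw_gen[of n q] assms by (intro coeff_eq_0) linarith
  finally show ?thesis .
qed

section \<open>Krawchouk values as a polynomial in a real variable\<close>

lemma gbinomial_linear_poly:
  "\<exists>P :: real poly. degree P \<le> j \<and> (\<forall>t. poly P t = (a + b * t) gchoose j)"
proof (intro exI conjI allI)
  let ?P = "smult (1 / fact j) (\<Prod>i=0..<j. [:a - real i, b:])"
  have "degree (\<Prod>i=0..<j. [:a - real i, b:]) \<le> sum (degree \<circ> (\<lambda>i. [:a - real i, b:])) {0..<j}"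
    by (rule degree_prod_sum_le) simp
  also have "\<dots> \<le> (\<Sum>i=0..<j. 1)" by (intro sum_mono) simp
  finally show "degree ?P \<le> j" using degree_smult_le order_trans by fastforce
  show "poly ?P t = (a + b * t) gchoose j" for t
    by (simp add: gbinomial_prod_rev poly_prod algebra_simps)
qed

lemma krawchouk_poly:
  obtains P :: "real poly" where "degree P \<le> s" "\<And>t. poly P t = krawchouk n s t"
proof -
  obtain P where P: "\<And>j. degree (P j) \<le> j" "\<And>j t. poly (P j :: real poly) t = t gchoose j"
    using gbinomial_linear_poly[of _ 0 1] by simp metis
  obtain Q where Q: "\<And>j. degree (Q j) \<le> j" "\<And>j t. poly (Q j :: real poly) t = (real n - t) gchoose j"
    using gbinomial_linear_poly[of _ "real n" "- 1"] by simp metis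
  let ?R = "\<Sum>j\<le>s. smult ((- 1) ^ j) (P j * Q (s - j))"
  have "degree ?R \<le> s"
  proof (rule degree_sum_le)
    fix j assume "j \<in> {..s}"
    then have "degree (P j * Q (s - j)) \<le> s"
      using degree_mult_le[of "P j" "Q (s - j)"] P(1)[of j] Q(1)[of "s - j"] by simp
    then show "degree (smult ((- 1) ^ j) (P j * Q (s - j))) \<le> s"
      using degree_smult_le order_trans by blast
  qed simp
  moreover have "poly ?R t = krawchouk n s t" for t
    by (simp add: poly_sum P Q krawchouk_def mult.assoc)
  ultimately show thesis by (rule that)
qed

subsection \<open>Hamming spheres\<close>

text \<open>The sum of W_\<alpha>(y) z^|y| over the whole cube factorizes over the coordinates, with
  factor 1 - z where \<alpha> is nonzero and 1 + z elsewhere. The sphere of radius s is the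
  coefficient of z^s.\<close>

lemma sum_walsh_sphere:
  assumes \<alpha>: "\<alpha> \<in> cube n"
  shows "(\<Sum>y\<in>hamming_sphere n s. walsh n \<alpha> y) = krawchouk n s (real (hamming_weight n \<alpha>))"
proof -
  define k where "k = hamming_weight n \<alpha>"
  have kn: "k \<le> n" unfolding k_def by (rule hamming_weight_le)
  have "(\<Sum>y\<in>cube n. monom (walsh n \<alpha> y) (hamming_weight n y))
      = (\<Sum>y\<in>cube n. \<Prod>i<n. monom ((- 1) ^ (\<alpha> i * y i)) (y i))"
  proof (intro sum.cong refl)
    fix y assume "y \<in> cube n"
    have "(\<Prod>i\<in>I. monom ((- 1 :: real) ^ (\<alpha> i * y i)) (y i)) = monom ((- 1) ^ (\<Sum>i\<in>I. \<alpha> i * y i)) (\<Sum>i\<in>I. y i)"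
      if "finite I" for I
      using that by (induction I rule: finite_induct) (auto simp: mult_monom power_add)
    then show "monom (walsh n \<alpha> y) (hamming_weight n y) = (\<Prod>i<n. monom ((- 1) ^ (\<alpha> i * y i)) (y i))"
      using hamming_weight_eq_sum[OF \<open>y \<in> cube n\<close>] by (simp add: walsh_def)
  qed
  also have "\<dots> = (\<Prod>i<n. \<Sum>a\<in>{0, 1::nat}. monom ((- 1) ^ (\<alpha> i * a)) a)"
    unfolding cube_def by (subst prod_sum_PiE) auto
  also have "\<dots> = (\<Prod>i<n. if \<alpha> i \<noteq> 0 then [:1, - 1:] else [:1, 1:])"
    using cube_nth_cases[OF \<alpha>] by (intro prod.cong refl) (fastforce simp: monom_0 monom_Suc)
  also have "\<dots> = [:1, - 1:] ^ card ({..<n} \<inter> {i. \<alpha> i \<noteq> 0}) * [:1, 1:] ^ card ({..<n} \<inter> - {i. \<alpha> i \<noteq> 0})"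
    by (simp add: prod.If_cases)
  also have "{..<n} \<inter> {i. \<alpha> i \<noteq> 0} = {i. i < n \<and> \<alpha> i \<noteq> 0}" by auto
  also have "{..<n} \<inter> - {i. \<alpha> i \<noteq> 0} = {..<n} - {i. i < n \<and> \<alpha> i \<noteq> 0}" by auto
  also have "card ({..<n} - {i. i < n \<and> \<alpha> i \<noteq> 0}) = n - k"
    unfolding k_def hamming_weight_def by (subst card_Diff_subset) auto
  finally have "(\<Sum>y\<in>cube n. monom (walsh n \<alpha> y) (hamming_weight n y)) = kraw_gen n k"
    by (simp add: kraw_gen_def k_def hamming_weight_def)
  then have "krawchouk n s (real k) = coeff (\<Sum>y\<in>cube n. monom (walsh n \<alpha> y) (hamming_weight n y)) s"
    using coeff_kraw_gen[OF kn] by simp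
  also have "\<dots> = (\<Sum>y\<in>cube n. if hamming_weight n y = s then walsh n \<alpha> y else 0)"
    by (simp add: coeff_sum coeff_monom)
  also have "\<dots> = (\<Sum>y\<in>hamming_sphere n s. walsh n \<alpha> y)"
    by (simp add: hamming_sphere_def sum.inter_filter)
  finally show ?thesis by (simp add: k_def)
qed

lemma finite_hamming_sphere [simp]: "finite (hamming_sphere n s)"
  by (simp add: hamming_sphere_def)

lemma card_hamming_sphere: "card (hamming_sphere n s) = n choose s"
proof -
  define z where "z = (\<lambda>i\<in>{..<n}. 0 :: nat)"
  have z: "z \<in> cube n" "hamming_weight n z = 0"
    by (auto simp: z_def cube_def hamming_weight_def)
  have "walsh n z y = 1" for y by (simp add: walsh_def z_def)
  then have "real (card (hamming_sphere n s)) = real (n choose s)"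
    using sum_walsh_sphere[OF z(1), of s] z by (simp add: krawchouk_0)
  then show ?thesis by simp
qed

context
  fixes n s :: nat and c :: real and f :: "(nat \<Rightarrow> nat) \<Rightarrow> real"
  assumes f: "\<forall>x\<in>cube n. f x = c * indicator (hamming_sphere n s) x"
begin

lemma sphere_fourier_coeff:
  assumes "\<alpha> \<in> cube n"
  shows "fourier_coeff n f \<alpha> = c * krawchouk n s (real (hamming_weight n \<alpha>)) / 2 ^ n"
proof -
  have "(\<Sum>y\<in>cube n. f y * walsh n \<alpha> y) = (\<Sum>y\<in>cube n. if y \<in> hamming_sphere n s then c * walsh n \<alpha> y else 0)"
    using f by (intro sum.cong) (auto simp: indicator_def)
  also have "\<dots> = (\<Sum>y\<in>hamming_sphere n s. c * walsh n \<alpha> y)"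
    by (simp add: sum.inter_restrict[symmetric]) (intro sum.cong, auto simp: hamming_sphere_def)
  also have "\<dots> = c * krawchouk n s (real (hamming_weight n \<alpha>))"
    by (simp add: sum_distrib_left[symmetric] sum_walsh_sphere[OF assms])
  finally show ?thesis by (simp add: fourier_coeff_def)
qed

lemma sphere_level_norm_squared:
  "(lp_norm n 2 (level_proj n f k))\<^sup>2 = c\<^sup>2 * (real (n choose k) * (krawchouk n s (real k))\<^sup>2) / (2 ^ n)\<^sup>2"
proof -
  have "(lp_norm n 2 (level_proj n f k))\<^sup>2
      = (\<Sum>\<alpha>\<in>hamming_sphere n k. (c * krawchouk n s (real k) / 2 ^ n)\<^sup>2)"
    unfolding level_proj_norm_squared hamming_sphere_def
    by (intro sum.cong) (auto simp: sphere_fourier_coeff)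
  then show ?thesis by (simp add: card_hamming_sphere power_mult_distrib power_divide)
qed

lemma sphere_sum_powr:
  assumes "0 < p"
  shows "(\<Sum>x\<in>cube n. \<bar>f x\<bar> powr p) = real (n choose s) * \<bar>c\<bar> powr p"
proof -
  have "(\<Sum>x\<in>cube n. \<bar>f x\<bar> powr p) = (\<Sum>x\<in>cube n. if x \<in> hamming_sphere n s then \<bar>c\<bar> powr p else 0)"
    using f assms by (intro sum.cong) (auto simp: indicator_def)
  also have "\<dots> = (\<Sum>y\<in>hamming_sphere n s. \<bar>c\<bar> powr p)"
    by (simp only: sum.inter_restrict[symmetric] finite_cube) (intro sum.cong, auto simp: hamming_sphere_def)
  finally show ?thesis by (simp add: card_hamming_sphere)
qed

end

text \<open>Parseval for the indicator of the sphere, with the frequencies grouped by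
  weight.\<close>

lemma sum_krawchouk_squared:
  "(\<Sum>k\<le>n. real (n choose k) * (krawchouk n s (real k))\<^sup>2) = 2 ^ n * real (n choose s)"
proof -
  define f :: "(nat \<Rightarrow> nat) \<Rightarrow> real" where "f = indicator (hamming_sphere n s)"
  have f: "\<forall>x\<in>cube n. f x = 1 * indicator (hamming_sphere n s) x" by (simp add: f_def)
  have "(\<Sum>\<alpha>\<in>cube n. (fourier_coeff n f \<alpha>)\<^sup>2)
      = (\<Sum>k\<le>n. \<Sum>\<alpha> | \<alpha> \<in> cube n \<and> hamming_weight n \<alpha> = k. (fourier_coeff n f \<alpha>)\<^sup>2)"
    by (subst sum.group[of "cube n" "{..n}" "hamming_weight n", symmetric]) (auto simp: hamming_weight_le)
  also have "\<dots> = (\<Sum>k\<le>n. real (n choose k) * (krawchouk n s (real k))\<^sup>2) / (2 ^ n)\<^sup>2"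
    unfolding level_proj_norm_squared[symmetric] sphere_level_norm_squared[OF f] by (simp add: sum_divide_distrib)
  finally have "(\<Sum>k\<le>n. real (n choose k) * (krawchouk n s (real k))\<^sup>2) / (2 ^ n)\<^sup>2 = real (n choose s) / 2 ^ n"
    using sphere_sum_powr[OF f, of 2] by (simp add: parseval lp_norm_2_squared)
  then show ?thesis by (simp add: field_simps power2_eq_square)
qed

subsection \<open>Binomial coefficients and entropy\<close>

text \<open>Stirling's upper bound k! \<le> e sqrt(k) (k/e)^k. The induction step is (k + 1/2) ln((k
  + 1)/k) \<ge> 1, which is artanh z \<ge> z at z = 1/(2k + 1).\<close>

lemma ln_fact_le:
  assumes "1 \<le> k"
  shows "ln (fact k) \<le> 1 + ln (real k) / 2 + real k * ln (real k) - real k"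
  using assms
proof (induction k rule: dec_induct)
  case (step k)
  have k: "0 < real k" using step by simp
  define z :: real where "z = 1 / (2 * real k + 1)"
  have z: "0 < z" "z < 1" using k by (auto simp: z_def)
  have "(1 + z) / (1 - z) = (real k + 1) / real k"
  proof -
    have "1 + z = (real k + 1) * (2 * z)" "1 - z = real k * (2 * z)"
      using k by (auto simp: z_def field_simps)
    then show ?thesis using z by simp
  qed
  then have "artanh z = (ln (real k + 1) - ln (real k)) / 2"
    using k by (simp add: artanh_def ln_div)
  then have "z \<le> (ln (real k + 1) - ln (real k)) / 2"
    using artanh_ge_self[of z] z by simp
  then have "(2 * real k + 1) * z \<le> (2 * real k + 1) * ((ln (real k + 1) - ln (real k)) / 2)"
    using k by (intro mult_left_mono) auto
  then have "1 \<le> (real k + 1 / 2) * (ln (real k + 1) - ln (real k))"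
    using k by (simp add: z_def algebra_simps)
  moreover have "ln (fact (Suc k)) = ln (real k + 1) + ln (fact k)"
    by (simp add: ln_mult add.commute)
  ultimately show ?case
    using step.IH by (simp add: algebra_simps)
qed simp

text \<open>m^m / m! grows by (1 + 1/m)^m \<le> e in each step. Comparing n with n - k in this way
  spares Stirling for both, so the entropy bound for (n choose k) loses only the e sqrt(k) that
  comes from k!.\<close>

lemma entropy_le_ln_fact:
  assumes "k \<le> n"
  shows "real n * ln (real n) - ln (fact n)
    \<le> real k + real (n - k) * ln (real (n - k)) - ln (fact (n - k))"
proof -
  have step: "real (Suc m) * ln (real (Suc m)) - ln (fact (Suc m)) \<le> 1 + (real m * ln (real m) - ln (fact m))" for m
  proof (cases "m = 0")
    case False
    then have m: "0 < real m" by simp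
    have "ln (1 + 1 / real m) \<le> 1 / real m"
      using m by (intro ln_add_one_self_le_self) simp
    moreover have "1 + 1 / real m = (real m + 1) / real m" using m by (simp add: field_simps)
    ultimately have "ln (real m + 1) - ln (real m) \<le> 1 / real m"
      using m by (simp add: ln_div)
    then have "real m * (ln (real m + 1) - ln (real m)) \<le> real m * (1 / real m)"
      using m by (intro mult_left_mono) auto
    then have "real m * (ln (real m + 1) - ln (real m)) \<le> 1" using m by simp
    moreover have "ln (fact (Suc m)) = ln (real m + 1) + ln (fact m)"
      by (simp add: ln_mult add.commute)
    ultimately show ?thesis by (simp add: algebra_simps)
  qed simp
  have "real (m + k) * ln (real (m + k)) - ln (fact (m + k)) \<le> real k + real m * ln (real m) - ln (fact m)" for m
  proof (induction k)
    case (Suc k)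
    then show ?case using step[of "m + k"] by simp
  qed simp
  from this[of "n - k"] show ?thesis using assms by simp
qed

lemma entropy_ln:
  assumes "1 \<le> k" "k < n"
  shows "real n * binary_entropy (real k / real n) * ln 2
    = real n * ln (real n) - real k * ln (real k) - real (n - k) * ln (real (n - k))"
proof -
  have pos: "0 < real k" "0 < real n" "0 < real (n - k)" using assms by auto
  have 1: "1 - real k / real n = real (n - k) / real n" using assms by (simp add: field_simps of_nat_diff)
  have "real n * binary_entropy (real k / real n) * ln 2
      = - real k * (ln (real k) - ln (real n)) - real (n - k) * (ln (real (n - k)) - ln (real n))"
    unfolding binary_entropy_def 1 log_def using pos by (simp add: ln_div field_simps)
  also have "\<dots> = real n * ln (real n) - real k * ln (real k) - real (n - k) * ln (real (n - k))"
    using assms by (simp add: of_nat_diff algebra_simps)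
  finally show ?thesis .
qed

lemma two_powr_entropy_le_binomial:
  assumes "1 \<le> k" "k < n"
  shows "2 powr (real n * binary_entropy (real k / real n)) \<le> exp 1 * sqrt (real k) * real (n choose k)"
proof -
  have "ln (real (n choose k)) = ln (fact n) - ln (fact k) - ln (fact (n - k))"
    using assms by (simp add: binomial_fact ln_div ln_mult)
  then have "real n * binary_entropy (real k / real n) * ln 2 \<le> 1 + ln (real k) / 2 + ln (real (n choose k))"
    unfolding entropy_ln[OF assms] using ln_fact_le[OF assms(1)] entropy_le_ln_fact[of k n] assms by simp
  then have "exp (real n * binary_entropy (real k / real n) * ln 2)
      \<le> exp (1 + ln (real k) / 2 + ln (real (n choose k)))" by simp
  also have "\<dots> = exp 1 * sqrt (real k) * real (n choose k)"
    using assms by (simp add: exp_add ln_sqrt[symmetric])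
  finally show ?thesis by (simp add: powr_def)
qed

text \<open>A single term of the expansion of (Y + (1 - Y))^n = 1 at Y = k/n.\<close>

lemma binomial_le_two_powr_entropy:
  assumes "1 \<le> k" "k < n"
  shows "real (n choose k) \<le> 2 powr (real n * binary_entropy (real k / real n))"
proof -
  define Y where "Y = real k / real n"
  have Y: "0 < Y" "Y < 1" using assms by (auto simp: Y_def)
  have "real (n choose k) * Y ^ k * (1 - Y) ^ (n - k) \<le> (\<Sum>j\<le>n. real (n choose j) * Y ^ j * (1 - Y) ^ (n - j))"
    using assms Y by (intro member_le_sum[of k]) auto
  also have "\<dots> = 1" using binomial_ring[of Y "1 - Y" n] by simp
  finally have 1: "real (n choose k) * (Y ^ k * (1 - Y) ^ (n - k)) \<le> 1" by (simp add: mult.assoc)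
  have "Y ^ k * (1 - Y) ^ (n - k) = exp (real k * ln Y + real (n - k) * ln (1 - Y))"
    using Y by (simp add: exp_add exp_of_nat_mult)
  also have "real k * ln Y + real (n - k) * ln (1 - Y) = - (real n * binary_entropy Y * ln 2)"
  proof -
    have "real k = real n * Y" "real (n - k) = real n * (1 - Y)"
      using assms by (auto simp: Y_def field_simps of_nat_diff)
    then show ?thesis by (simp add: binary_entropy_def log_def field_simps)
  qed
  also have "exp \<dots> = 1 / 2 powr (real n * binary_entropy Y)"
    by (simp add: powr_def exp_minus field_simps)
  finally show ?thesis using 1 by (simp add: Y_def)
qed

subsection \<open>Tightness below the roots\<close>

text \<open>At the larger root w for x', the quadratic for x takes the value -(x' - x)(1 - w^2)
  \<le> 0, so w lies between the roots for x.\<close>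

lemma w_plus_antimono:
  assumes r: "saddle_region x' y" and x: "0 \<le> x" "x \<le> x'" and "0 < y"
  shows "w_plus x' y \<le> w_plus x y"
proof -
  have r': "saddle_region x y" using region_bounds[OF r] x by (intro saddle_region_mono[OF r]) auto
  define w where "w = w_plus x' y"
  have "0 \<le> w" "w < 1" using w_plus_nonneg[OF r] w_plus_less_1[OF r \<open>0 < y\<close>] by (auto simp: w_def)
  then have "w\<^sup>2 \<le> 1" by (simp add: abs_square_le_1)
  then have "(x' - x) * (1 - w\<^sup>2) \<ge> 0" using x by simp
  then have "(1 - x) * w\<^sup>2 - (1 - 2 * y) * w + x \<le> 0"
    using w_plus_root[OF r, folded w_def] by (simp add: algebra_simps)
  then show ?thesis using between_w(2)[OF r'] by (simp add: w_def)
qed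

lemma saddle_0_left:
  assumes "0 < y" "y < 1"
  shows "saddle 0 y (1 - 2 * y) = 1 - binary_entropy y"
proof -
  have "log 2 (2 * (1 - y)) = log 2 2 + log 2 (1 - y)" "log 2 (2 * y) = log 2 2 + log 2 y"
    using assms by (subst log_mult; simp)+
  moreover have "1 + (1 - 2 * y) = 2 * (1 - y)" "1 - (1 - 2 * y) = 2 * y" by auto
  ultimately have "saddle 0 y (1 - 2 * y) = (1 - y) * (1 + log 2 (1 - y)) + y * (1 + log 2 y)"
    unfolding saddle_def by simp
  then show ?thesis by (simp add: binary_entropy_def algebra_simps)
qed

lemma radius_less:
  assumes "1 \<le> s" "real s \<le> real n / 2"
  shows "0 < real n" "s < n"
  using assms by auto

context
  fixes n s :: nat and Y :: real
  assumes s: "1 \<le> s" "real s \<le> real n / 2" and Y_def: "Y = real s / real n"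
begin

lemmas n_pos = radius_less[OF s]

lemma radius_bounds: "0 < Y" "Y \<le> 1 / 2"
  using s n_pos by (auto simp: Y_def field_simps)

lemma w_plus_0: "w_plus 0 Y = 1 - 2 * Y"
proof -
  have "sqrt ((1 - 2 * Y)\<^sup>2) = 1 - 2 * Y" using radius_bounds by simp
  then show ?thesis unfolding w_plus_def by simp
qed

text \<open>The quotients R_k = K(k + 1)/K(k) satisfy (n - k) R_k = (n - 2s) - k / R_(k-1), which is
  increasing in R_(k-1) and has \<open>w_plus (k/n)\<close> as a fixed point. Since
  \<open>w_plus\<close> decreases in k, the bound for R_(k-1) is more than is needed for R_k.
  Positivity of K is carried along; at k = 0 there is equality.\<close>

lemma krawchouk_growth:
  assumes "saddle_region (real k / real n) Y"
  shows "0 < krawchouk n s (real k)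
    \<and> w_plus (real k / real n) Y * krawchouk n s (real k) \<le> krawchouk n s (real (k + 1))"
  using assms
proof (induction k)
  case 0
  have "0 < krawchouk n s (real 0)" using n_pos by (simp add: krawchouk_0)
  moreover have "real n * krawchouk n s (real 1) = (real n - 2 * real s) * krawchouk n s (real 0)"
    using krawchouk_recurrence[of 0 n s] by simp
  then have "krawchouk n s (real 1) = (1 - 2 * Y) * krawchouk n s (real 0)"
    using n_pos by (simp add: Y_def field_simps)
  ultimately show ?case by (simp add: w_plus_0)
next
  case (Suc k)
  define x where "x = real (Suc k) / real n"
  have r: "saddle_region x Y" using Suc.prems by (simp add: x_def)
  have x: "0 < x" "x \<le> 1 / 2" using region_bounds[OF r] n_pos by (auto simp: x_def)
  have r0: "saddle_region (real k / real n) Y"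
    using radius_bounds n_pos by (intro saddle_region_mono[OF r]) (auto simp: x_def divide_right_mono)
  define W where "W = w_plus x Y"
  have W: "0 < W" using w_minus_pos[OF r x(1)] w_minus_le_w_plus[OF r] by (simp add: W_def)
  have "W \<le> w_plus (real k / real n) Y"
    unfolding W_def using radius_bounds n_pos by (intro w_plus_antimono[OF r]) (auto simp: x_def divide_right_mono)
  moreover note IH = Suc.IH[OF r0]
  ultimately have "W * krawchouk n s (real k)
      \<le> w_plus (real k / real n) Y * krawchouk n s (real k)"
    by (intro mult_right_mono) auto
  also have "\<dots> \<le> krawchouk n s (real (Suc k))" using IH by simp
  finally have "W * krawchouk n s (real k) \<le> krawchouk n s (real (Suc k))" .
  moreover have "0 < W * krawchouk n s (real k)" using W IH by simp
  ultimately have pos: "0 < krawchouk n s (real (Suc k))" and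
    le: "W * krawchouk n s (real k) \<le> krawchouk n s (real (Suc k))" by linarith+
  have kn: "Suc k < n" using x n_pos by (simp add: x_def field_simps)
  have rec: "(real n - real (Suc k)) * krawchouk n s (real (Suc k + 1))
      = (real n - 2 * real s) * krawchouk n s (real (Suc k)) - real (Suc k) * krawchouk n s (real k)"
    using krawchouk_recurrence[of "Suc k" n s] kn by simp
  have root: "(real n - real (Suc k)) * W * W = (real n - 2 * real s) * W - real (Suc k)"
  proof -
    have nx: "real n * x = real (Suc k)" and ns: "real n * Y = real s"
      using n_pos by (auto simp: x_def Y_def)
    have "(real n - real n * x) * W * W - (real n - 2 * (real n * Y)) * W + real n * x
        = real n * ((1 - x) * W\<^sup>2 - (1 - 2 * Y) * W + x)"
      by (simp only: algebra_simps power2_eq_square)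
    also have "\<dots> = 0" unfolding W_def w_plus_root[OF r] by simp
    finally show ?thesis unfolding nx ns by linarith
  qed
  have "W * ((real n - real (Suc k)) * (W * krawchouk n s (real (Suc k))))
      = ((real n - real (Suc k)) * W * W) * krawchouk n s (real (Suc k))" by simp
  also have "\<dots> = W * ((real n - 2 * real s) * krawchouk n s (real (Suc k)))
      - real (Suc k) * krawchouk n s (real (Suc k))"
    unfolding root by (simp add: algebra_simps)
  also have "\<dots> \<le> W * ((real n - 2 * real s) * krawchouk n s (real (Suc k)))
      - real (Suc k) * (W * krawchouk n s (real k))"
    using le by (intro diff_left_mono mult_left_mono) auto
  also have "\<dots> = W * ((real n - real (Suc k)) * krawchouk n s (real (Suc k + 1)))"
    unfolding rec by (simp add: algebra_simps)
  finally have "(real n - real (Suc k)) * (W * krawchouk n s (real (Suc k)))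
      \<le> (real n - real (Suc k)) * krawchouk n s (real (Suc k + 1))"
    using W by (rule mult_left_le_imp_le)
  then have "W * krawchouk n s (real (Suc k)) \<le> krawchouk n s (real (Suc k + 1))"
    by (rule mult_left_le_imp_le) (use kn in simp)
  then show ?case using pos by (simp add: W_def x_def)
qed

text \<open>A discrete envelope argument: from \<open>w_plus\<close> upwards \<open>saddle\<close>
  decreases, so keeping the old w while x grows by 1/n can only underestimate the new critical
  value. With w fixed, the step changes n times \<open>saddle\<close> by exactly -log w, the
  logarithm of the bound for K(k + 1)/K(k), and the product telescopes without error.\<close>

lemma krawchouk_ge_saddle:
  assumes "saddle_region (real k / real n) Y"
  shows "real (n choose s) * 2 powr (real n *
      (1 - binary_entropy Y - saddle (real k / real n) Y (w_plus (real k / real n) Y))) \<le> krawchouk n s (real k)"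
  using assms
proof (induction k)
  case 0
  have "1 - binary_entropy Y
      - saddle 0 Y (w_plus 0 Y) = 0"
    using saddle_0_left[of Y] radius_bounds by (simp add: w_plus_0)
  then have "1 - binary_entropy Y - saddle (real 0 / real n) Y (w_plus (real 0 / real n) Y) = 0"
    by simp
  then show ?case by (simp only: mult_zero_right powr_zero_eq_one) (simp add: krawchouk_0)
next
  case (Suc k)
  define x' x where "x' = real (Suc k) / real n" and "x = real k / real n"
  have r': "saddle_region x' Y" using Suc.prems by (simp add: x'_def)
  have xx: "0 \<le> x" "x \<le> x'" "0 < x'" using n_pos by (auto simp: x_def x'_def divide_right_mono)
  have r: "saddle_region x Y" using xx radius_bounds by (intro saddle_region_mono[OF r']) auto
  define w' w where "w' = w_plus x' Y" and "w = w_plus x Y"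
  have w'0: "0 < w'" using w_minus_pos[OF r' xx(3)] w_minus_le_w_plus[OF r'] by (simp add: w'_def)
  have ww: "w' \<le> w" unfolding w_def w'_def using xx radius_bounds by (intro w_plus_antimono[OF r']) auto
  have w1: "w < 1" unfolding w_def using radius_bounds by (intro w_plus_less_1[OF r]) auto
  have "saddle x' Y w \<le> saddle x' Y w'"
    using w'0 ww w1 by (intro saddle_antimono_above[OF r']) (auto simp: w'_def)
  moreover have "saddle x' Y w = saddle x Y w - (x' - x) * log 2 w"
    by (simp add: saddle_def algebra_simps)
  moreover have "x' - x = 1 / real n" by (simp add: x_def x'_def diff_divide_distrib[symmetric])
  ultimately have "saddle x Y w - log 2 w / real n \<le> saddle x' Y w'" by simp
  then have "real n * (1 - binary_entropy Y - saddle x' Y w')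
      \<le> real n * (1 - binary_entropy Y - (saddle x Y w - log 2 w / real n))"
    by (intro mult_left_mono) auto
  also have "\<dots> = log 2 w + real n * (1 - binary_entropy Y - saddle x Y w)"
    using n_pos by (simp add: field_simps)
  finally have "2 powr (real n * (1 - binary_entropy Y - saddle x' Y w'))
      \<le> 2 powr (log 2 w + real n * (1 - binary_entropy Y - saddle x Y w))" by simp
  also have "\<dots> = w * 2 powr (real n * (1 - binary_entropy Y - saddle x Y w))"
    using w'0 ww by (simp add: powr_add)
  finally have "real (n choose s) * 2 powr (real n * (1 - binary_entropy Y - saddle x' Y w'))
      \<le> w * (real (n choose s) * 2 powr (real n * (1 - binary_entropy Y - saddle x Y w)))"
    by (subst mult.left_commute) (rule mult_left_mono, auto)
  also have "\<dots> \<le> w * krawchouk n s (real k)"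
    using Suc.IH r w'0 ww by (intro mult_left_mono) (auto simp: x_def w_def)
  also have "\<dots> \<le> krawchouk n s (real (Suc k))"
    using krawchouk_growth[of k] r by (simp add: x_def w_def)
  finally show ?case by (simp only: x'_def w'_def)
qed

lemma krawchouk_ge:
  assumes r: "saddle_region (real k / real n) Y"
  shows "real (n choose s) * 2 powr (real n * (pi_fun (real k / real n) Y
      - (binary_entropy (real k / real n) + binary_entropy Y - 1) / 2)) \<le> krawchouk n s (real k)"
proof (cases "k = 0")
  case True
  then show ?thesis using radius_bounds by (simp add: pi_fun_0_left krawchouk_0)
next
  case False
  then have "0 < real k / real n" using n_pos by simp
  from pi_fun_eq_saddle[OF r this radius_bounds(1)]
  have "pi_fun (real k / real n) Y - (binary_entropy (real k / real n) + binary_entropy Y - 1) / 2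
      = 1 - binary_entropy Y - saddle (real k / real n) Y (w_plus (real k / real n) Y)"
    by argo
  then show ?thesis using krawchouk_ge_saddle[OF r] by (simp only:)
qed

end

subsection \<open>Tightness for spheres\<close>

lemma two_powr_squared: "(2 powr e)\<^sup>2 = (2::real) powr (2 * e)"
  by (simp add: powr_power mult.commute)

text \<open>The second argument of \<pi> for a multiple of a sphere indicator: its deficit is 1 -
  log (n choose s) / n, whatever p is.\<close>

definition entropy_radius :: "nat \<Rightarrow> nat \<Rightarrow> real" where
  "entropy_radius n s = binary_entropy_inv (log 2 (real (n choose s)) / real n)"

context
  fixes n s :: nat and c :: real and f :: "(nat \<Rightarrow> nat) \<Rightarrow> real" and Y :: real
  assumes s: "1 \<le> s" "real s \<le> real n / 2" and Y_def: "Y = real s / real n" and c: "c \<noteq> 0"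
    and f: "\<forall>x\<in>cube n. f x = c * indicator (hamming_sphere n s) x"
begin

lemma sphere_nonzero: "\<exists>x\<in>cube n. f x \<noteq> 0"
proof (rule ccontr)
  assume "\<not> ?thesis"
  then have "(\<Sum>x\<in>cube n. \<bar>f x\<bar> powr 1) = 0" by simp
  then show False using sphere_sum_powr[OF f, of 1] c radius_less[OF s] by simp
qed

lemma sphere_lp_norm:
  assumes "0 < p"
  shows "lp_norm n p f = \<bar>c\<bar> * (real (n choose s) / 2 ^ n) powr (1 / p)"
proof -
  have "lp_norm n p f = (\<bar>c\<bar> powr p * (real (n choose s) / 2 ^ n)) powr (1 / p)"
    using sphere_sum_powr[OF f assms] by (simp add: lp_norm_def mult.commute)
  also have "\<dots> = (\<bar>c\<bar> powr p) powr (1 / p) * (real (n choose s) / 2 ^ n) powr (1 / p)"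
    by (rule powr_mult)
  finally show ?thesis using assms c by (simp add: powr_powr)
qed

lemma sphere_entropy_deficit:
  assumes "2 \<le> p"
  shows "entropy_deficit n f p = 1 - log 2 (real (n choose s)) / real n"
proof -
  define \<sigma> where "\<sigma> = real (n choose s) / 2 ^ n"
  have B: "0 < real (n choose s)" using radius_less[OF s] by simp
  then have \<sigma>: "0 < \<sigma>" by (simp add: \<sigma>_def)
  have "lp_norm n p f / lp_norm n 1 f = \<sigma> powr (1 / p - 1)"
    using sphere_lp_norm[of p] sphere_lp_norm[of 1] assms c \<sigma>
    by (simp add: powr_diff flip: \<sigma>_def)
  then have "norm_rate n f p = 1 / real n * ((1 / p - 1) * log 2 \<sigma>)"
    using \<sigma> by (simp add: norm_rate_def log_powr)
  then have "entropy_deficit n f p = (p / (p - 1) * (1 / p - 1)) * (log 2 \<sigma> / real n)"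
    by (simp add: entropy_deficit_def)
  also have "p / (p - 1) * (1 / p - 1) = - 1" using assms by (simp add: field_simps)
  also have "log 2 \<sigma> = log 2 (real (n choose s)) - real n"
    using B by (simp add: \<sigma>_def log_divide log_nat_power)
  finally show ?thesis using radius_less[OF s] by (simp add: field_simps)
qed

lemma entropy_radius_bounds: "0 < entropy_radius n s" "entropy_radius n s \<le> Y" "entropy_radius n s \<le> 1 / 2"
proof -
  note n = radius_less[OF s] and Y = radius_bounds[OF s Y_def]
  \<comment> \<open>Pascal's rule with two positive summands makes the binomial coefficient exceed
    1; this gives a strictly positive radius, as \<open>pi_fun_mono\<close> demands.\<close>
  have "n choose s = (n - 1 choose (s - 1)) + (n - 1 choose s)"
    using s n by (intro choose_reduce_nat) auto
  moreover have "0 < (n - 1 choose (s - 1))" "0 < (n - 1 choose s)" using s n by auto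
  ultimately have B: "1 < real (n choose s)" by linarith
  define h where "h = log 2 (real (n choose s)) / real n"
  have h0: "0 < h" using B n by (simp add: h_def)
  have "log 2 (real (n choose s)) \<le> log 2 (2 powr (real n * binary_entropy Y))"
    using binomial_le_two_powr_entropy[of s n] B s n unfolding Y_def by (intro log_mono) auto
  then have hY: "h \<le> binary_entropy Y" using n by (simp add: h_def pos_divide_le_eq mult.commute)
  then have h1: "h \<le> 1" using binary_entropy_le_1[of Y] Y by simp
  have y: "entropy_radius n s \<in> {0..1/2}" "binary_entropy (entropy_radius n s) = h"
    using binary_entropy_inv[of h] h0 h1 by (auto simp: entropy_radius_def h_def)
  then show "entropy_radius n s \<le> 1 / 2" by simp
  show "0 < entropy_radius n s" using y h0 by (cases "entropy_radius n s = 0") auto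
  show "entropy_radius n s \<le> Y"
    using binary_entropy_strict_mono[of Y "entropy_radius n s"] y hY Y by (cases "entropy_radius n s \<le> Y") auto
qed

text \<open>2 to the power n times the deficit is 2^n / (n choose s), so for spheres the level bound
  is 2^(n \<pi>) times the 2-norm of f. Squares avoid its root.\<close>

lemma sphere_level_bound:
  assumes "2 \<le> p"
  shows "(level_bound n f p k)\<^sup>2
    = (2 powr (real n * pi_fun (min (real k / real n) ((real n - real k) / real n)) (entropy_radius n s)))\<^sup>2
      * (c\<^sup>2 * real (n choose s) / 2 ^ n)"
proof -
  define \<pi> where "\<pi> = pi_fun (min (real k / real n) ((real n - real k) / real n)) (entropy_radius n s)"
  define B where "B = real (n choose s)"
  note n = radius_less[OF s]
  have B: "0 < B" using n by (simp add: B_def)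
  have y: "binary_entropy_inv (1 - entropy_deficit n f p) = entropy_radius n s"
    unfolding entropy_radius_def sphere_entropy_deficit[OF assms] by simp
  have "level_bound n f p k
      = 2 powr (real n * (\<pi> + (1 - log 2 B / real n) / 2)) * (\<bar>c\<bar> * (B / 2 ^ n))"
    using level_bound_eq[OF sphere_nonzero _ assms, of k] n sphere_lp_norm[of 1]
    unfolding y unfolding sphere_entropy_deficit[OF assms] \<pi>_def B_def by simp
  then have "(level_bound n f p k)\<^sup>2
      = (2 powr (real n * (\<pi> + (1 - log 2 B / real n) / 2)))\<^sup>2 * (c\<^sup>2 * (B / 2 ^ n)\<^sup>2)"
    by (simp only: power_mult_distrib power2_abs)
  also have "(2 powr (real n * (\<pi> + (1 - log 2 B / real n) / 2)))\<^sup>2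
      = (2 powr (real n * \<pi>))\<^sup>2 * (2 ^ n / B)"
  proof -
    have "(2 powr (real n * (\<pi> + (1 - log 2 B / real n) / 2)))\<^sup>2
        = 2 powr (2 * (real n * \<pi>) + (real n - log 2 B))"
    proof -
      have "2 * (real n * (\<pi> + (1 - log 2 B / real n) / 2)) = 2 * (real n * \<pi>) + (real n - log 2 B)"
        using n by (simp add: distrib_left right_diff_distrib)
      then show ?thesis using two_powr_squared by (simp only:)
    qed
    also have "\<dots> = (2 powr (real n * \<pi>))\<^sup>2 * (2 ^ n / B)"
      using B by (simp add: powr_add powr_diff powr_power powr_realpow mult.commute)
    finally show ?thesis .
  qed
  also have "(2 powr (real n * \<pi>))\<^sup>2 * (2 ^ n / B) * (c\<^sup>2 * (B / 2 ^ n)\<^sup>2)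
      = (2 powr (real n * \<pi>))\<^sup>2 * (c\<^sup>2 * B / 2 ^ n)"
    using B by (simp add: power2_eq_square field_simps)
  finally show ?thesis by (simp add: \<pi>_def B_def)
qed

lemma sphere_level_norm_reflect:
  assumes "k \<le> n"
  shows "lp_norm n 2 (level_proj n f (n - k)) = lp_norm n 2 (level_proj n f k)"
proof -
  have "(krawchouk n s (real (n - k)))\<^sup>2 = (krawchouk n s (real k))\<^sup>2"
    using krawchouk_reflect[of n s "real k"] assms
    by (simp add: of_nat_diff power_mult_distrib flip: power_mult)
  moreover have "n choose (n - k) = n choose k" using assms by (simp add: binomial_symmetric[symmetric])
  ultimately have "(lp_norm n 2 (level_proj n f (n - k)))\<^sup>2 = (lp_norm n 2 (level_proj n f k))\<^sup>2"
    by (simp add: sphere_level_norm_squared[OF f])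
  then show ?thesis by (simp add: power2_eq_iff_nonneg lp_norm_nonneg)
qed

text \<open>Squared, the lower bound for K(k) matches the upper bound up to replacing P = 2^(n
  H(k/n)) and Q = 2^(n H(s/n)) by binomial coefficients. This costs e sqrt(max(k, 1)) and e sqrt(s);
  the root of their product is the constant e and the power 1/4.\<close>

lemma sphere_tight_lower:
  assumes p: "2 \<le> p" and r: "saddle_region (real k / real n) Y"
  shows "level_bound n f p k
    \<le> exp 1 * (real (max k 1) * real s) powr (1 / 4) * lp_norm n 2 (level_proj n f k)"
proof -
  note n = radius_less[OF s] and Y = radius_bounds[OF s Y_def] and y = entropy_radius_bounds
  define x where "x = real k / real n"
  have x: "0 \<le> x" "x \<le> 1 / 2" using region_bounds[OF r] by (auto simp: x_def)
  have kn: "k < n" using x n by (simp add: x_def field_simps)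
  have min: "min (real k / real n) ((real n - real k) / real n) = x"
    using x n by (simp add: x_def min_def field_simps)
  define B Ck \<kappa> T P Q where "B = real (n choose s)" and "Ck = real (n choose k)"
    and "\<kappa> = krawchouk n s (real k)" and "T = 2 powr (real n * pi_fun x Y)"
    and "P = 2 powr (real n * binary_entropy x)" and "Q = 2 powr (real n * binary_entropy Y)"
  have B: "0 < B" using n by (simp add: B_def)
  have PQ: "0 < P" "0 < Q" by (auto simp: P_def Q_def)
  define M where "M = real (max k 1)"
  have P: "P \<le> exp 1 * sqrt M * Ck"
  proof (cases "k = 0")
    case True
    then show ?thesis by (simp add: P_def x_def M_def Ck_def)
  next
    case False
    then have "M = real k" by (simp add: M_def max_def)
    then show ?thesis using two_powr_entropy_le_binomial[of k n] kn False
      by (simp add: P_def x_def Ck_def)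
  qed
  have Q: "Q \<le> exp 1 * sqrt (real s) * B"
    using two_powr_entropy_le_binomial[of s n] n s by (simp add: Q_def Y_def B_def)
  have "T\<^sup>2 * B\<^sup>2 * 2 ^ n \<le> \<kappa>\<^sup>2 * (P * Q)"
  proof -
    have ge: "B * 2 powr (real n * (pi_fun x Y - (binary_entropy x + binary_entropy Y - 1) / 2)) \<le> \<kappa>"
      using krawchouk_ge[OF s Y_def r] by (simp add: B_def \<kappa>_def x_def)
    have "(B * 2 powr (real n * (pi_fun x Y - (binary_entropy x + binary_entropy Y - 1) / 2)))\<^sup>2
        = B\<^sup>2 * 2 powr (real n * (2 * pi_fun x Y) - (real n * binary_entropy x + real n * binary_entropy Y) + real n)"
    proof -
      have "2 * (real n * (pi_fun x Y - (binary_entropy x + binary_entropy Y - 1) / 2))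
          = real n * (2 * pi_fun x Y) - (real n * binary_entropy x + real n * binary_entropy Y) + real n"
        by (simp add: field_simps)
      then show ?thesis unfolding power_mult_distrib two_powr_squared by (simp only:)
    qed
    also have "\<dots> = B\<^sup>2 * (T\<^sup>2 / (P * Q) * 2 ^ n)"
      by (simp add: powr_add powr_diff T_def P_def Q_def powr_power powr_realpow mult_ac)
    finally have "B\<^sup>2 * (T\<^sup>2 / (P * Q) * 2 ^ n) \<le> \<kappa>\<^sup>2"
      using ge B by (metis power_mono mult_nonneg_nonneg less_imp_le powr_ge_zero)
    then show ?thesis using PQ by (simp add: field_simps)
  qed
  also have "\<dots> \<le> \<kappa>\<^sup>2 * ((exp 1 * sqrt M * Ck) * (exp 1 * sqrt (real s) * B))"
    using P Q PQ by (intro mult_left_mono mult_mono) (auto simp: M_def Ck_def)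
  finally have "(T\<^sup>2 * B * 2 ^ n) * B \<le> ((exp 1)\<^sup>2 * sqrt (M * real s) * (Ck * \<kappa>\<^sup>2)) * B"
    by (simp add: power2_eq_square real_sqrt_mult mult_ac)
  then have key: "T\<^sup>2 * B * 2 ^ n \<le> (exp 1)\<^sup>2 * sqrt (M * real s) * (Ck * \<kappa>\<^sup>2)"
    using B by (rule mult_right_le_imp_le)
  have "(level_bound n f p k)\<^sup>2 = (2 powr (real n * pi_fun x (entropy_radius n s)))\<^sup>2 * (c\<^sup>2 * B / 2 ^ n)"
    unfolding sphere_level_bound[OF p] min B_def ..
  \<comment> \<open>Here the entropy radius is replaced by the larger s/n.\<close>
  also have "\<dots> \<le> T\<^sup>2 * (c\<^sup>2 * B / 2 ^ n)"
    unfolding T_def using pi_fun_mono[OF r y(1) y(2)] B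
    by (intro mult_right_mono power_mono powr_mono mult_left_mono) (auto simp: x_def)
  also have "\<dots> = c\<^sup>2 * (T\<^sup>2 * B * 2 ^ n) / (2 ^ n)\<^sup>2"
    by (simp add: power2_eq_square)
  also have "\<dots> \<le> c\<^sup>2 * ((exp 1)\<^sup>2 * sqrt (M * real s) * (Ck * \<kappa>\<^sup>2)) / (2 ^ n)\<^sup>2"
    using key by (intro divide_right_mono mult_left_mono) auto
  also have "\<dots> = (exp 1)\<^sup>2 * sqrt (M * real s) * (lp_norm n 2 (level_proj n f k))\<^sup>2"
    unfolding sphere_level_norm_squared[OF f] Ck_def \<kappa>_def by simp
  also have "sqrt (M * real s) = ((M * real s) powr (1 / 4))\<^sup>2"
  proof -
    have "((M * real s) powr (1 / 4))\<^sup>2 = (M * real s) powr (1 / 2)"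
      by (simp add: power2_eq_square flip: powr_add)
    then show ?thesis by (simp add: powr_half_sqrt M_def)
  qed
  finally have "(level_bound n f p k)\<^sup>2
      \<le> (exp 1 * (M * real s) powr (1 / 4) * lp_norm n 2 (level_proj n f k))\<^sup>2"
    by (simp add: power_mult_distrib)
  then show ?thesis
    unfolding M_def[symmetric] by (rule power2_le_imp_le) (simp add: lp_norm_nonneg)
qed

lemma sphere_tight:
  assumes p: "2 \<le> p"
    and k: "real k \<le> real n / 2 - sqrt (real s * (real n - real s))
      \<or> real n / 2 + sqrt (real s * (real n - real s)) \<le> real k \<and> k \<le> n"
  shows "level_bound n f p k
    \<le> exp 1 * (real (max k 1) * real s) powr (1 / 4) * lp_norm n 2 (level_proj n f k)"
proof -
  note n = radius_less[OF s] and Y = radius_bounds[OF s Y_def]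
  \<comment> \<open>The hypothesis bounds j/n in terms of s/n, the reverse of the roles in \<pi>;
    the region is symmetric.\<close>
  have region: "saddle_region (real j / real n) Y"
    if j: "real j \<le> real n / 2 - sqrt (real s * (real n - real s))" for j
  proof -
    have "sqrt (Y * (1 - Y)) = sqrt (real s * (real n - real s)) / real n"
    proof -
      have "Y * (1 - Y) = real s * (real n - real s) / (real n)\<^sup>2"
        using n by (simp add: Y_def field_simps power2_eq_square)
      then show ?thesis using n by (simp add: real_sqrt_divide)
    qed
    moreover have "real j / real n \<le> (real n / 2 - sqrt (real s * (real n - real s))) / real n"
      using j by (intro divide_right_mono) auto
    ultimately have le: "real j / real n \<le> 1 / 2 - sqrt (Y * (1 - Y))"
      using n by (simp add: diff_divide_distrib)
    moreover have "0 \<le> sqrt (Y * (1 - Y))" using Y by simp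
    ultimately have "real j / real n \<le> 1 / 2" by linarith
    with le have "saddle_region Y (real j / real n)"
      using saddle_region_iff[of Y "real j / real n"] Y by simp
    then show ?thesis using saddle_region_sym by blast
  qed
  from k show ?thesis
  proof (elim disjE)
    assume "real k \<le> real n / 2 - sqrt (real s * (real n - real s))"
    then show ?thesis by (intro sphere_tight_lower[OF p] region)
  next
    assume k: "real n / 2 + sqrt (real s * (real n - real s)) \<le> real k \<and> k \<le> n"
    have nn: "0 \<le> sqrt (real s * (real n - real s))"
      using n by (intro real_sqrt_ge_zero mult_nonneg_nonneg) auto
    have k': "real (n - k) \<le> real n / 2 - sqrt (real s * (real n - real s))" using k by (simp add: of_nat_diff)
    \<comment> \<open>Reflection replaces k by the smaller n - k, so the factor max(k, 1)^(1/4) does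
      not suffer.\<close>
    have le: "real (n - k) \<le> real k" using k k' nn by linarith
    have "level_bound n f p k = level_bound n f p (n - k)"
      using k by (simp add: level_bound_def of_nat_diff min.commute)
    also have "\<dots> \<le> exp 1 * (real (max (n - k) 1) * real s) powr (1 / 4) * lp_norm n 2 (level_proj n f (n - k))"
      by (intro sphere_tight_lower[OF p] region k')
    also have "\<dots> \<le> exp 1 * (real (max k 1) * real s) powr (1 / 4) * lp_norm n 2 (level_proj n f (n - k))"
      using le by (intro mult_right_mono mult_left_mono powr_mono2 lp_norm_nonneg) auto
    finally show ?thesis using sphere_level_norm_reflect[of k] k by simp
  qed
qed

text \<open>As \<pi> \<le> 0, the level bound is at most the 2-norm of f. The assumption
  \<open>large\<close> says that level k carries at least the fraction (n + 1)^(-4) of its square,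
  and (n + 1)^2 \<le> 4 n^2 \<le> 4 n^(5/2).\<close>

lemma sphere_level_bound_le:
  assumes p: "2 \<le> p" and k: "k \<le> n"
    and large: "2 ^ n * real (n choose s) \<le> (real n + 1) ^ 4 * (real (n choose k) * (krawchouk n s (real k))\<^sup>2)"
  shows "level_bound n f p k \<le> 4 * real n powr (5 / 2) * lp_norm n 2 (level_proj n f k)"
proof -
  note n = radius_less[OF s] and y = entropy_radius_bounds
  define x where "x = min (real k / real n) ((real n - real k) / real n)"
  have x: "0 \<le> x" "x \<le> 1 / 2" using k n by (auto simp: x_def min_def field_simps)
  have "2 powr (real n * pi_fun x (entropy_radius n s)) \<le> 2 powr 0"
    using pi_fun_nonpos[OF x, of "entropy_radius n s"] y n by (intro powr_mono) (auto simp: mult_le_0_iff)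
  then have "(level_bound n f p k)\<^sup>2 \<le> 1 * (c\<^sup>2 * real (n choose s) / 2 ^ n)"
    unfolding sphere_level_bound[OF p] x_def[symmetric]
    by (intro mult_right_mono) (auto simp: power_le_one)
  also have "\<dots> = c\<^sup>2 * (2 ^ n * real (n choose s)) / (2 ^ n)\<^sup>2"
    by (simp add: power2_eq_square)
  also have "\<dots> \<le> c\<^sup>2 * ((real n + 1) ^ 4 * (real (n choose k) * (krawchouk n s (real k))\<^sup>2)) / (2 ^ n)\<^sup>2"
    by (intro divide_right_mono mult_left_mono large) auto
  also have "\<dots> = (real n + 1) ^ 4 * (lp_norm n 2 (level_proj n f k))\<^sup>2"
    unfolding sphere_level_norm_squared[OF f] by simp
  also have "\<dots> = ((real n + 1)\<^sup>2 * lp_norm n 2 (level_proj n f k))\<^sup>2"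
    by (simp add: power_mult_distrib flip: power_mult)
  finally have "level_bound n f p k \<le> (real n + 1)\<^sup>2 * lp_norm n 2 (level_proj n f k)"
    by (rule power2_le_imp_le) (simp add: lp_norm_nonneg)
  also have "(real n + 1)\<^sup>2 \<le> 4 * real n powr (5 / 2)"
  proof -
    have n1: "1 \<le> real n" using n by simp
    then have "(real n + 1)\<^sup>2 \<le> (2 * real n)\<^sup>2" by (intro power_mono) auto
    also have "\<dots> = 4 * real n powr 2" using n1 by (simp add: power_mult_distrib powr_numeral)
    also have "\<dots> \<le> 4 * real n powr (5 / 2)" using n1 by (intro mult_left_mono powr_mono) auto
    finally show ?thesis .
  qed
  finally show ?thesis by (simp add: lp_norm_nonneg mult_right_mono)
qed

end

subsection \<open>Roots of Krawchouk polynomials\<close>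

context
  fixes n s :: nat
  assumes s: "1 \<le> s" "real s \<le> real n / 2"
begin

abbreviation (input) "K \<equiv> krawchouk n s"

text \<open>Orthogonality to the cofactor \<open>q\<close>: all the terms of \<open>\<Sum>\<^sub>j (n choose j) K(j) q(j) = 0\<close> would be nonnegative.\<close>

lemma krawchouk_no_nonneg_factor:
  assumes P: "degree P \<le> s" "\<And>t. poly P t = K t" and R: "P = R * q" "1 \<le> degree R"
    and nonneg: "\<And>j. j \<le> n \<Longrightarrow> 0 \<le> poly R (real j)"
  shows False
proof -
  have K0: "K 0 \<noteq> 0" using radius_less[OF s] by (simp add: krawchouk_0)
  have "q \<noteq> 0" "R \<noteq> 0" using K0 P(2)[of 0] R by auto
  then have "degree q < s" using P(1) R by (simp add: degree_mult_eq)
  then have "(\<Sum>j\<le>n. real (n choose j) * poly q (real j) * K (real j)) = 0"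
    by (rule krawchouk_orthogonal)
  moreover have "real (n choose j) * poly q (real j) * K (real j)
      = real (n choose j) * (poly R (real j) * (poly q (real j))\<^sup>2)" for j
    unfolding P(2)[symmetric] R(1) by (simp add: power2_eq_square)
  ultimately have "(\<Sum>j\<le>n. real (n choose j) * (poly R (real j) * (poly q (real j))\<^sup>2)) = 0"
    by simp
  then have "\<forall>j\<in>{..n}. real (n choose j) * (poly R (real j) * (poly q (real j))\<^sup>2) = 0"
    using nonneg by (subst (asm) sum_nonneg_eq_0_iff) auto
  \<comment> \<open>The term j = 0 already contradicts K(0) = (n choose s) > 0.\<close>
  then have "real (n choose 0) * (poly R (real 0) * (poly q (real 0))\<^sup>2) = 0" by blast
  then have "poly P 0 = 0" by (auto simp: R(1))
  then show False using K0 P(2) by simp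
qed

text \<open>If t \<le> 0 were a root, its linear factor would be nonnegative at 0, ..., n.\<close>

lemma krawchouk_root_pos:
  assumes "K t = 0"
  shows "0 < t"
proof (rule ccontr)
  assume t: "\<not> 0 < t"
  obtain P :: "real poly" where P: "degree P \<le> s" "\<And>t. poly P t = K t" by (rule krawchouk_poly[where n = n and s = s], blast)
  have "poly P t = 0" using P assms by simp
  then obtain q where "P = [:- t, 1:] * q" by (auto simp: poly_eq_0_iff_dvd dvd_def)
  then show False by (rule krawchouk_no_nonneg_factor[OF P]) (use t in auto)
qed

lemma krawchouk_reflect_eq_0: "K (real n - t) = 0 \<longleftrightarrow> K t = 0"
  by (simp add: krawchouk_reflect)

lemma krawchouk_root_less: "K t = 0 \<Longrightarrow> t < real n"
  using krawchouk_root_pos[of "real n - t"] by (simp add: krawchouk_reflect_eq_0)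

text \<open>No integer lies strictly between i and i + 1, so (j - u)(j - v) \<ge> 0 at every integer
  j. Stated for factors rather than roots, this also excludes a double root u = v.\<close>

lemma krawchouk_no_double_factor:
  assumes P: "degree P \<le> s" "\<And>t. poly P t = K t" and "P = [:- u, 1:] * [:- v, 1:] * q"
    and i: "real i \<le> u" "u \<le> real i + 1" "real i \<le> v" "v \<le> real i + 1"
  shows False
proof (rule krawchouk_no_nonneg_factor[OF P assms(3)])
  show "1 \<le> degree ([:- u, 1:] * [:- v, 1:])" by (subst degree_mult_eq) auto
  fix j
  have "real j \<le> real i \<or> real i + 1 \<le> real j" by (cases "j \<le> i") auto
  then have "0 \<le> (real j - u) * (real j - v)"
    using i by (auto intro: mult_nonneg_nonneg mult_nonpos_nonpos)
  then show "0 \<le> poly ([:- u, 1:] * [:- v, 1:]) (real j)" by (simp add: algebra_simps)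
qed

lemma krawchouk_two_roots_factor:
  assumes "poly P u = 0" "poly P v = 0" "u \<noteq> v"
  obtains q :: "real poly" where "P = [:- u, 1:] * [:- v, 1:] * q"
proof -
  obtain q1 where q1: "P = [:- u, 1:] * q1" using assms by (auto simp: poly_eq_0_iff_dvd dvd_def)
  then have "poly q1 v = 0" using assms by simp
  then obtain q where "q1 = [:- v, 1:] * q" by (auto simp: poly_eq_0_iff_dvd dvd_def)
  then show thesis using that q1 by (simp only: mult.assoc)
qed

text \<open>Equal signs at both ends force an even number of roots inside: after dividing out u, the
  cofactor changes sign and has a root v, possibly equal to u.\<close>

lemma krawchouk_no_root_between_pos:
  assumes "0 < K (real i)" "0 < K (real i + 1)" "K u = 0" "real i \<le> u" "u \<le> real i + 1"
  shows False
proof -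
  obtain P :: "real poly" where P: "degree P \<le> s" "\<And>t. poly P t = K t" by (rule krawchouk_poly[where n = n and s = s], blast)
  have u: "real i < u" "u < real i + 1" using assms by (auto simp: order_le_less)
  have "poly P u = 0" using P assms by simp
  then obtain q where q: "P = [:- u, 1:] * q" by (auto simp: poly_eq_0_iff_dvd dvd_def)
  have Kq: "K t = (t - u) * poly q t" for t using P(2)[of t] q by (simp add: algebra_simps)
  have "poly q (real i) < 0" using assms(1) u unfolding Kq by (auto simp: zero_less_mult_iff)
  moreover have "0 < poly q (real i + 1)" using assms(2) u unfolding Kq by (auto simp: zero_less_mult_iff)
  ultimately obtain v where v: "real i < v" "v < real i + 1" "poly q v = 0"
    using poly_IVT_pos[of "real i" "real i + 1" q] by auto
  then obtain q' where "q = [:- v, 1:] * q'" by (auto simp: poly_eq_0_iff_dvd dvd_def)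
  then have "P = [:- u, 1:] * [:- v, 1:] * q'" using q by (simp only: mult.assoc)
  then show False using krawchouk_no_double_factor[OF P, of u v q' i] u v by simp
qed

text \<open>Let i be the first integer above t1; t2 exceeds it, or both roots would lie in
  [i - 1, i]. If also i + 1 < t2, then K has one sign on [i, i + 1]. Otherwise t2 \<le> i + 1, and
  the cofactor of the two roots has no zero on [i - 1, i + 1]; so K(i - 1) and K(i + 1) are zero or
  of sign opposite to K(i). The recurrence at i, with n - 2s \<ge> 0, then forces n = 2s and both
  neighbours to vanish.\<close>

lemma krawchouk_consecutive_roots:
  assumes "consecutive_roots K t1 t2"
  obtains (pair) i where "t1 < real i" "real (i + 1) < t2" "0 < K (real i) * K (real (i + 1))"
  | (single) i where "1 \<le> i" "t1 < real i" "real i < t2" "n = 2 * s" "K (real (i - 1)) = 0" "K (real (i + 1)) = 0"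
proof -
  have t: "t1 < t2" "K t1 = 0" "K t2 = 0" and between: "\<And>t. t1 < t \<Longrightarrow> t < t2 \<Longrightarrow> K t \<noteq> 0"
    using assms by (auto simp: consecutive_roots_def)
  obtain P :: "real poly" where P: "degree P \<le> s" "\<And>t. poly P t = K t" by (rule krawchouk_poly[where n = n and s = s], blast)
  obtain q where q: "P = [:- t1, 1:] * [:- t2, 1:] * q"
    using krawchouk_two_roots_factor[of P t1 t2] t P by auto
  have Kq: "K t = (t - t1) * (t - t2) * poly q t" for t
    using P(2)[of t] unfolding q by (simp add: algebra_simps)
  define i where "i = nat \<lfloor>t1\<rfloor> + 1"
  have "0 < t1" using krawchouk_root_pos t by blast
  then have i: "real i - 1 \<le> t1" "t1 < real i" "1 \<le> i" by (auto simp: i_def) linarith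
  have i1: "real (i - 1) = real i - 1" using i by (simp add: of_nat_diff)
  have t2: "real i < t2"
    using krawchouk_no_double_factor[OF P q, of "i - 1"] t i i1 by (cases "real i < t2") auto
  have "t2 < real n" using krawchouk_root_less t by blast
  then have "i < n" using t2 by linarith
  show thesis
  proof (cases "real (i + 1) < t2")
    case True
    have "0 < K (real i) * K (real (i + 1))"
    proof (rule ccontr)
      assume "\<not> ?thesis"
      moreover have "K (real i) \<noteq> 0" "K (real (i + 1)) \<noteq> 0"
        using between[of "real i"] between[of "real (i + 1)"] i t2 True by auto
      ultimately have "poly P (real i) * poly P (real (i + 1)) < 0"
        unfolding P by (metis linorder_neqE_linordered_idom mult_eq_0_iff)
      then obtain v where "real i < v" "v < real (i + 1)" "poly P v = 0"
        using poly_IVT[of "real i" "real (i + 1)" P] by auto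
      then show False using between[of v] i True P by auto
    qed
    then show thesis using pair[of i] i True by simp
  next
    case False
    then have le: "t2 \<le> real i + 1" by simp
    have q0: "poly q v \<noteq> 0" if v: "real i - 1 \<le> v" "v \<le> real i + 1" for v
    proof
      assume "poly q v = 0"
      then obtain q' where q': "q = [:- v, 1:] * q'" by (auto simp: poly_eq_0_iff_dvd dvd_def)
      show False
      proof (cases "v \<le> real i")
        case True
        have "P = [:- t1, 1:] * [:- v, 1:] * ([:- t2, 1:] * q')"
          unfolding q q' by (simp only: mult_ac)
        then show False
          by (rule krawchouk_no_double_factor[OF P, of _ _ _ "i - 1"]) (use i i1 v True in auto)
      next
        case False
        have "P = [:- t2, 1:] * [:- v, 1:] * ([:- t1, 1:] * q')"
          unfolding q q' by (simp only: mult_ac)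
        then show False
          by (rule krawchouk_no_double_factor[OF P, of _ _ _ i]) (use i t2 le v False in auto)
      qed
    qed
    have same: "0 < poly q v * poly q (real i)" if v: "real i - 1 \<le> v" "v \<le> real i + 1" "v \<noteq> real i" for v
    proof (rule ccontr)
      assume "\<not> ?thesis"
      then have neg: "poly q v * poly q (real i) < 0"
        using q0[of v] q0[of "real i"] v by (metis linorder_neqE_linordered_idom mult_eq_0_iff add_increasing2
            diff_le_eq le_add_same_cancel1 zero_le_one)
      show False
      proof (cases "v < real i")
        case True
        then show False using poly_IVT[of v "real i" q] neg q0 v by force
      next
        case False
        then have "real i < v" using v by simp
        then show False using poly_IVT[of "real i" v q] neg q0 v by (force simp: mult.commute)
      qed
    qed
    \<comment> \<open>Multiplication by \<open>poly q (real i)\<close> normalizes the signs: A, C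
      \<ge> 0 > B.\<close>
    define A B C where "A = K (real (i - 1)) * poly q (real i)" and "B = K (real i) * poly q (real i)"
      and "C = K (real (i + 1)) * poly q (real i)"
    have "0 \<le> A"
    proof -
      have "A = (t1 - (real i - 1)) * (t2 - (real i - 1)) * (poly q (real i - 1) * poly q (real i))"
        unfolding A_def i1 Kq by (simp add: algebra_simps)
      then show ?thesis using i t2 same[of "real i - 1"] by simp
    qed
    moreover have "0 \<le> C"
    proof -
      have "C = (real i + 1 - t1) * (real i + 1 - t2) * (poly q (real i + 1) * poly q (real i))"
        unfolding C_def Kq by (simp add: algebra_simps)
      then show ?thesis using i le same[of "real i + 1"] by simp
    qed
    moreover have "B < 0"
    proof -
      have "B = - ((real i - t1) * (t2 - real i) * (poly q (real i))\<^sup>2)"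
        unfolding B_def Kq by (simp add: algebra_simps power2_eq_square)
      moreover have "0 < (real i - t1) * (t2 - real i) * (poly q (real i))\<^sup>2"
        using i t2 q0[of "real i"] by simp
      ultimately show ?thesis by simp
    qed
    moreover have "(real n - 2 * real s) * B = real i * A + (real n - real i) * C"
    proof -
      have "(real n - 2 * real s) * B = ((real n - 2 * real s) * K (real i)) * poly q (real i)"
        by (simp add: B_def)
      also have "\<dots> = (real i * K (real (i - 1)) + (real n - real i) * K (real (i + 1))) * poly q (real i)"
        by (simp only: krawchouk_recurrence[OF less_imp_le[OF \<open>i < n\<close>]])
      also have "\<dots> = real i * A + (real n - real i) * C"
        by (simp only: A_def C_def distrib_right mult.assoc)
      finally show ?thesis .
    qed
    moreover have "0 \<le> real i * A" "0 \<le> (real n - real i) * C" "(real n - 2 * real s) * B \<le> 0"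
      using \<open>0 \<le> A\<close> \<open>0 \<le> C\<close> \<open>B < 0\<close> s \<open>i < n\<close> by (auto simp: mult_le_0_iff)
    ultimately have "(real n - 2 * real s) * B = 0" "real i * A = 0" "(real n - real i) * C = 0"
      by linarith+
    then have "real n = 2 * real s" "A = 0" "C = 0" using \<open>B < 0\<close> i \<open>i < n\<close> by auto
    then have "K (real (i - 1)) = 0" "K (real (i + 1)) = 0"
      using q0[of "real i"] unfolding A_def C_def by simp_all
    moreover have "n = 2 * s" using \<open>real n = 2 * real s\<close> by linarith
    ultimately show thesis using single[of i] i t2 by blast
  qed
qed

subsection \<open>Tightness between the roots\<close>

definition kraw_mass :: "nat \<Rightarrow> real" where
  "kraw_mass k = real (n choose k) * (K (real k))\<^sup>2"

text \<open>With the weights n - 2j the partial sums telescope into a quadratic form in two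
  neighbouring values. The weights are nonnegative up to j = n/2, the range in which the energy is
  compared.\<close>

definition kraw_energy :: "nat \<Rightarrow> real" where
  "kraw_energy k = (\<Sum>j\<le>k. (real n - 2 * real j) * kraw_mass j)"

text \<open>The determinant of the form (k + 1) a^2 + (n - k) b^2 - (n - 2s) a b; for k < n the form
  is positive definite exactly when it is positive.\<close>

definition kraw_disc :: "nat \<Rightarrow> real" where
  "kraw_disc k = (real n - real k) * (real k + 1) - (real n - 2 * real s)\<^sup>2 / 4"

lemma kraw_mass_nonneg: "0 \<le> kraw_mass k"
  by (simp add: kraw_mass_def)

lemma kraw_mass_reflect: "k \<le> n \<Longrightarrow> kraw_mass (n - k) = kraw_mass k"
  using krawchouk_reflect[of n s "real k"]
  by (simp add: kraw_mass_def of_nat_diff power_mult_distrib binomial_symmetric[symmetric] flip: power_mult)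

lemma binomial_absorb:
  assumes "k < n"
  shows "(real n - real k) * real (n choose k) = (real k + 1) * real (n choose (k + 1))"
proof -
  have "(n - k) * (n choose k) = Suc k * (n choose Suc k)"
    unfolding binomial_absorb_comp binomial_absorption ..
  then have "real (n - k) * real (n choose k) = real (Suc k) * real (n choose Suc k)"
    by (metis of_nat_mult)
  then show ?thesis using assms by (simp add: of_nat_diff add.commute)
qed

text \<open>In the induction step the recurrence eliminates K(k) in favour of K(k + 2). The term
  added to the energy at k + 1 is exactly what turns the form in K(k), K(k + 1) into the next
  one.\<close>

lemma kraw_energy_eq:
  assumes "k \<le> n"
  shows "kraw_energy k = real (n choose k) * (real n - real k) *
    ((real k + 1) * (K (real k))\<^sup>2 + (real n - real k) * (K (real (k + 1)))\<^sup>2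
      - (real n - 2 * real s) * K (real k) * K (real (k + 1)))"
  using assms
proof (induction k)
  case 0
  define a b where "a = K (real 0)" and "b = K (real (0 + 1))"
  have rec: "(real n - 2 * real s) * a = real n * b"
    using krawchouk_recurrence[of 0 n s] by (simp add: a_def b_def)
  have "kraw_energy 0 = real n * a\<^sup>2" by (simp add: kraw_energy_def kraw_mass_def a_def)
  also have "\<dots> = real n * (a\<^sup>2 + (real n * b) * b - ((real n - 2 * real s) * a) * b)"
    unfolding rec by simp
  finally show ?case
    unfolding a_def[symmetric] b_def[symmetric] by (simp add: power2_eq_square mult_ac)
next
  case (Suc k)
  define a b d where "a = K (real k)" and "b = K (real (k + 1))" and "d = K (real (k + 2))"
  define l m :: real where "l = real n - 2 * real s" and "m = real n - real k - 1"
  define C where "C = real (n choose (k + 1))"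
  have rec: "m * d = l * b - (real k + 1) * a"
    using krawchouk_recurrence[of "k + 1" n s] Suc.prems by (simp add: a_def b_def d_def l_def m_def algebra_simps)
  have "kraw_energy k = (real n - real k) * real (n choose k) *
      ((real k + 1) * a\<^sup>2 + (real n - real k) * b\<^sup>2 - l * a * b)"
    using Suc by (simp add: a_def b_def l_def mult_ac)
  also have "\<dots> = C * (real k + 1) * ((real k + 1) * a\<^sup>2 + (m + 1) * b\<^sup>2 - l * a * b)"
    using binomial_absorb[of k] Suc.prems by (simp add: C_def m_def mult_ac)
  finally have "kraw_energy (Suc k) = C * (real k + 1) * ((real k + 1) * a\<^sup>2 + (m + 1) * b\<^sup>2 - l * a * b)
      + (m - real k - 1) * (C * b\<^sup>2)"
    by (simp add: kraw_energy_def kraw_mass_def C_def b_def m_def algebra_simps)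
  also have "\<dots> = C * (m * (real k + 2) * b\<^sup>2 + (m * d) * (m * d) - l * b * (m * d))"
    unfolding rec by (simp add: algebra_simps power2_eq_square)
  finally show ?case
    by (simp add: a_def b_def d_def l_def m_def C_def power2_eq_square algebra_simps)
qed

lemma kraw_energy_ge:
  assumes "k < n"
  shows "kraw_disc k * kraw_mass (k + 1) \<le> kraw_energy k"
proof -
  define a b l C where "a = K (real k)" and "b = K (real (k + 1))" and "l = real n - 2 * real s"
    and "C = real (n choose (k + 1))"
  have "kraw_energy k = ((real n - real k) * real (n choose k)) * ((real k + 1) * a\<^sup>2 + (real n - real k) * b\<^sup>2 - l * a * b)"
    using assms by (simp add: kraw_energy_eq a_def b_def l_def mult_ac)
  also have "\<dots> = C * ((real k + 1) * ((real k + 1) * a\<^sup>2 + (real n - real k) * b\<^sup>2 - l * a * b))"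
    unfolding binomial_absorb[OF assms] C_def by simp
  also have "(real k + 1) * ((real k + 1) * a\<^sup>2 + (real n - real k) * b\<^sup>2 - l * a * b)
      = ((real k + 1) * a - l * b / 2)\<^sup>2 + kraw_disc k * b\<^sup>2"
  proof -
    have D: "kraw_disc k = (real n - real k) * (real k + 1) - l\<^sup>2 / 4" by (simp add: kraw_disc_def l_def)
    show ?thesis unfolding D by (simp add: power2_eq_square field_simps)
  qed
  also have "C * \<dots> = C * ((real k + 1) * a - l * b / 2)\<^sup>2 + kraw_disc k * (C * b\<^sup>2)"
    by (simp add: algebra_simps)
  finally show ?thesis by (simp add: kraw_mass_def b_def C_def)
qed

text \<open>Energy over determinant does not increase up to n/2: one step adds \<delta> times the
  mass at k + 1 to the energy and the same \<delta> = n - 2(k + 1) to the determinant, and by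
  completing the square that mass is at most the current quotient.\<close>

lemma kraw_energy_ratio:
  assumes "0 < kraw_disc j" "j \<le> k" "2 * k \<le> n"
  shows "kraw_energy k * kraw_disc j \<le> kraw_energy j * kraw_disc k \<and> kraw_disc j \<le> kraw_disc k"
  using assms(2,3)
proof (induction k rule: dec_induct)
  case (step k)
  define \<delta> where "\<delta> = real n - 2 * real (Suc k)"
  have \<delta>: "0 \<le> \<delta>" using step.prems by (simp add: \<delta>_def)
  have IH: "kraw_energy k * kraw_disc j \<le> kraw_energy j * kraw_disc k" "kraw_disc j \<le> kraw_disc k"
    using step by auto
  then have Dk: "0 < kraw_disc k" using assms by simp
  have D: "kraw_disc (Suc k) = kraw_disc k + \<delta>" by (simp add: kraw_disc_def \<delta>_def algebra_simps)
  have E: "kraw_energy (Suc k) = kraw_energy k + \<delta> * kraw_mass (k + 1)"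
    by (simp add: kraw_energy_def \<delta>_def)
  have "kraw_disc k * (kraw_mass (k + 1) * kraw_disc j) \<le> kraw_energy k * kraw_disc j"
    using kraw_energy_ge[of k] step.prems assms(1) by (simp add: mult_right_mono flip: mult.assoc)
  also have "\<dots> \<le> kraw_disc k * kraw_energy j" using IH by (simp add: mult.commute)
  finally have "kraw_mass (k + 1) * kraw_disc j \<le> kraw_energy j" using Dk by simp
  then have "\<delta> * (kraw_mass (k + 1) * kraw_disc j) \<le> \<delta> * kraw_energy j"
    using \<delta> by (rule mult_left_mono)
  then show ?case unfolding D E using IH \<delta> by (simp add: algebra_simps)
qed simp

text \<open>By reflection the levels up to n/2 carry at least half of the total mass. For odd n
  every weight there is at least 1. For even n the weights below n/2 are at least 2, but the middle
  level has weight 0; its mass is bounded through the determinant at n/2 - 1, which is at least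
  1.\<close>

lemma kraw_energy_center: "2 ^ n * real (n choose s) \<le> 2 * kraw_energy (n div 2)"
proof -
  define m where "m = n div 2"
  have tot: "(\<Sum>j\<le>n. kraw_mass j) = 2 ^ n * real (n choose s)"
    using sum_krawchouk_squared[of n s] by (simp add: kraw_mass_def)
  have "(\<Sum>j\<in>{m<..n}. kraw_mass j) = (\<Sum>j<n - m. kraw_mass j)"
    by (rule sum.reindex_bij_witness[of _ "\<lambda>j. n - j" "\<lambda>j. n - j"]) (auto simp: kraw_mass_reflect m_def)
  moreover have "(\<Sum>j\<le>n. kraw_mass j) = (\<Sum>j\<le>m. kraw_mass j) + (\<Sum>j\<in>{m<..n}. kraw_mass j)"
  proof -
    have "{..n} = {..m} \<union> {m<..n}" by (auto simp: m_def)
    then have "(\<Sum>j\<le>n. kraw_mass j) = sum kraw_mass ({..m} \<union> {m<..n})" by (simp only:)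
    also have "\<dots> = (\<Sum>j\<le>m. kraw_mass j) + (\<Sum>j\<in>{m<..n}. kraw_mass j)"
      by (rule sum.union_disjoint) auto
    finally show ?thesis .
  qed
  ultimately have split: "2 ^ n * real (n choose s) = (\<Sum>j\<le>m. kraw_mass j) + (\<Sum>j<n - m. kraw_mass j)"
    using tot by simp
  show ?thesis
  proof (cases "odd n")
    case True
    then have nm: "n = 2 * m + 1" by (simp add: m_def)
    have "(\<Sum>j\<le>m. kraw_mass j) \<le> kraw_energy m"
      unfolding kraw_energy_def
    proof (rule sum_mono)
      fix j assume "j \<in> {..m}"
      then have "1 \<le> real n - 2 * real j" using nm by simp
      then show "kraw_mass j \<le> (real n - 2 * real j) * kraw_mass j"
        using mult_right_mono[OF _ kraw_mass_nonneg] by fastforce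
    qed
    moreover have "{..<n - m} = {..m}" using nm by auto
    ultimately show ?thesis using split by (simp add: m_def)
  next
    case False
    then have nm: "n = 2 * m" by (simp add: m_def)
    have m: "1 \<le> m" "s \<le> m" and rn: "real n = 2 * real m" using s nm by auto
    have e: "kraw_energy m = (\<Sum>j<m. (real n - 2 * real j) * kraw_mass j)"
      unfolding kraw_energy_def lessThan_Suc_atMost[symmetric] using nm by simp
    have "2 * (\<Sum>j<m. kraw_mass j) \<le> kraw_energy m"
      unfolding e sum_distrib_left
    proof (rule sum_mono)
      fix j assume "j \<in> {..<m}"
      then have "2 \<le> real n - 2 * real j" using nm by auto
      then show "2 * kraw_mass j \<le> (real n - 2 * real j) * kraw_mass j"
        using mult_right_mono[OF _ kraw_mass_nonneg] by blast
    qed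
    moreover have "kraw_mass m \<le> kraw_energy m"
    proof -
      have "kraw_energy (m - 1) = kraw_energy m"
        unfolding e kraw_energy_def lessThan_Suc_atMost[symmetric] using m nm by simp
      moreover have "1 \<le> kraw_disc (m - 1)"
      proof -
        have "(real m - real s)\<^sup>2 \<le> (real m - 1)\<^sup>2" using m s by (intro power_mono) auto
        moreover have "kraw_disc (m - 1) = (real m + 1) * real m - (real m - real s)\<^sup>2"
          using m rn by (simp add: kraw_disc_def of_nat_diff power2_eq_square field_simps)
        moreover have "(real m + 1) * real m = (real m - 1)\<^sup>2 + (3 * real m - 1)"
          by (simp add: power2_eq_square algebra_simps)
        moreover have "1 \<le> real m" using m by simp
        ultimately show ?thesis by linarith
      qed
      then have "1 * kraw_mass m \<le> kraw_disc (m - 1) * kraw_mass m"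
        by (intro mult_right_mono kraw_mass_nonneg)
      moreover have "m - 1 < n" "m - 1 + 1 = m" using m nm by auto
      ultimately show ?thesis using kraw_energy_ge[of "m - 1"] by simp
    qed
    moreover have "(\<Sum>j\<le>m. kraw_mass j) = (\<Sum>j<m. kraw_mass j) + kraw_mass m"
      unfolding lessThan_Suc_atMost[symmetric] by simp
    moreover have "n - m = m" using nm by simp
    ultimately have "2 ^ n * real (n choose s) \<le> 2 * kraw_energy m"
      using split by simp
    then show ?thesis unfolding m_def .
  qed
qed

lemma mult_le_quarter_square: "(real n - real k) * (real k + 1) \<le> (real n + 1)\<^sup>2 / 4"
proof -
  have "(real n + 1)\<^sup>2 / 4 - (real n - real k) * (real k + 1) = (real n - 2 * real k - 1)\<^sup>2 / 4"
    by (simp add: power2_eq_square field_simps)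
  then show ?thesis by (smt (verit) divide_nonneg_nonneg zero_le_power2)
qed

text \<open>From the middle down to j the energy loses at most the quotient of the determinants.
  Four times the determinant is a positive integer at j and at most (n + 1)^2 in the middle.\<close>

lemma kraw_energy_large:
  assumes "0 < kraw_disc j" "2 * j \<le> n"
  shows "2 ^ n * real (n choose s) \<le> 2 * (real n + 1)\<^sup>2 * kraw_energy j"
proof -
  define m where "m = n div 2"
  have jm: "j \<le> m" "2 * m \<le> n" using assms by (auto simp: m_def)
  note r = kraw_energy_ratio[OF assms(1) jm]
  have j4: "1 \<le> 4 * kraw_disc j"
  proof -
    have "4 * kraw_disc j = of_int (4 * ((int n - int j) * (int j + 1)) - (int n - 2 * int s)\<^sup>2)"
      by (simp add: kraw_disc_def)
    then show ?thesis using assms(1) by (smt (verit) of_int_0_less_iff of_int_1_le_iff)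
  qed
  have m4: "4 * kraw_disc m \<le> (real n + 1)\<^sup>2"
  proof -
    have "kraw_disc m \<le> (real n - real m) * (real m + 1)" by (simp add: kraw_disc_def)
    also have "\<dots> \<le> (real n + 1)\<^sup>2 / 4" by (rule mult_le_quarter_square)
    finally show ?thesis by simp
  qed
  have N: "0 < 2 ^ n * real (n choose s)" using radius_less[OF s] by simp
  then have Em: "0 < kraw_energy m" using kraw_energy_center by (simp add: m_def)
  then have "0 < kraw_energy j"
    using r assms(1) by (smt (verit) mult_pos_pos zero_less_mult_pos2)
  have "2 ^ n * real (n choose s) \<le> 2 * (kraw_energy m * 1)"
    using kraw_energy_center by (simp add: m_def)
  also have "\<dots> \<le> 2 * (kraw_energy m * (4 * kraw_disc j))"
    using j4 Em by (intro mult_left_mono) auto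
  also have "\<dots> \<le> 2 * (kraw_energy j * (4 * kraw_disc m))" using r by simp
  also have "\<dots> \<le> 2 * (kraw_energy j * (real n + 1)\<^sup>2)"
    using m4 \<open>0 < kraw_energy j\<close> by (intro mult_left_mono) auto
  finally show ?thesis by (simp add: mult_ac)
qed

text \<open>If the form were not definite at j, then j/n would be in the saddle region and K
  positive at 0, ..., j; the root u would then lie in a unit interval with positive values at both
  ends.\<close>

lemma kraw_disc_pos:
  assumes u: "K u = 0" "u < real j" and j: "2 * j \<le> n"
  shows "0 < kraw_disc j"
proof (rule ccontr)
  assume "\<not> 0 < kraw_disc j"
  then have D: "4 * ((real n - real j) * (real j + 1)) \<le> (real n - 2 * real s)\<^sup>2"
    by (simp add: kraw_disc_def)
  define Y where "Y = real s / real n"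
  note n = radius_less[OF s] and Y = radius_bounds[OF s Y_def]
  have r: "saddle_region (real j / real n) Y"
  proof -
    have "4 * ((real n - real j) * real j) \<le> 4 * ((real n - real j) * (real j + 1))"
      using j by (intro mult_left_mono) auto
    then have "4 * ((real n - real j) * real j) / (real n)\<^sup>2 \<le> (real n - 2 * real s)\<^sup>2 / (real n)\<^sup>2"
      using D by (intro divide_right_mono) auto
    moreover have "4 * ((real n - real j) * real j) / (real n)\<^sup>2 = 4 * (real j / real n) * (1 - real j / real n)"
      using n by (simp add: field_simps power2_eq_square)
    moreover have "(real n - 2 * real s)\<^sup>2 / (real n)\<^sup>2 = (1 - 2 * Y)\<^sup>2"
      using n by (simp add: Y_def diff_divide_distrib flip: power_divide)
    ultimately have "4 * (real j / real n) * (1 - real j / real n) \<le> (1 - 2 * Y)\<^sup>2"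
      by (simp only:)
    moreover have "real j / real n \<le> 1 / 2" using j n by (simp add: field_simps)
    ultimately show ?thesis using Y unfolding saddle_region_def by auto
  qed
  have pos: "0 < K (real i)" if "i \<le> j" for i
  proof -
    have "saddle_region (real i / real n) Y"
      using that Y by (intro saddle_region_mono[OF r]) (auto simp: divide_right_mono)
    then show ?thesis using krawchouk_growth[OF s Y_def] by blast
  qed
  define i where "i = nat \<lfloor>u\<rfloor>"
  have "0 < u" using krawchouk_root_pos u by blast
  then have i: "real i \<le> u" "u < real i + 1" by (auto simp: i_def)
  then have "i + 1 \<le> j" using u by linarith
  then show False
    using krawchouk_no_root_between_pos[of i u] pos[of i] pos[of "i + 1"] u i by (simp add: add.commute)
qed

text \<open>The sign condition lets the mixed term be dropped, leaving (n - j)(j + 1) \<le> (n +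
  1)^2 / 4 times the two masses. The factor 2 on the left makes at least one of the two masses large
  enough by itself.\<close>

lemma kraw_mass_large:
  assumes u: "K u = 0" "u < real j" and j: "2 * j \<le> n" "j < n"
    and sgn: "0 \<le> (real n - 2 * real s) * (K (real j) * K (real (j + 1)))"
  shows "2 * (2 ^ n * real (n choose s)) \<le> (real n + 1) ^ 4 * (kraw_mass j + kraw_mass (j + 1))"
proof -
  define b where "b = (real n - real j) * (real j + 1)"
  have "kraw_energy j = b * (kraw_mass j + kraw_mass (j + 1))
      - real (n choose j) * (real n - real j) * ((real n - 2 * real s) * (K (real j) * K (real (j + 1))))"
  proof -
    have "b * kraw_mass (j + 1) = (real n - real j) * ((real n - real j) * real (n choose j)) * (K (real (j + 1)))\<^sup>2"
      unfolding binomial_absorb[OF j(2)] by (simp add: b_def kraw_mass_def mult_ac)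
    then show ?thesis
      using j by (simp add: kraw_energy_eq b_def kraw_mass_def algebra_simps)
  qed
  then have "kraw_energy j \<le> b * (kraw_mass j + kraw_mass (j + 1))"
    using sgn j by simp
  also have "\<dots> \<le> (real n + 1)\<^sup>2 / 4 * (kraw_mass j + kraw_mass (j + 1))"
    unfolding b_def using kraw_mass_nonneg by (intro mult_right_mono mult_le_quarter_square) (simp add: add_nonneg_nonneg)
  finally have "2 * (real n + 1)\<^sup>2 * kraw_energy j
      \<le> 2 * (real n + 1)\<^sup>2 * ((real n + 1)\<^sup>2 / 4 * (kraw_mass j + kraw_mass (j + 1)))"
    by (intro mult_left_mono) auto
  moreover have "2 * (real n + 1)\<^sup>2 * ((real n + 1)\<^sup>2 / 4 * M) = (real n + 1) ^ 4 * M / 2" for M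
    by (simp add: power2_eq_square power4_eq_xxxx)
  ultimately show ?thesis
    using kraw_energy_large[OF kraw_disc_pos[OF u j(1)] j(1)] by simp
qed

text \<open>In the left half, t1 is the root below the integers in question. In the right half
  everything is reflected, and n - t2 takes its place. When only one integer is available, n - 2s =
  0 removes the mixed term and the neighbour used has mass 0.\<close>

lemma krawchouk_large_between_roots:
  assumes "consecutive_roots K t1 t2"
  shows "\<exists>k. t1 < real k \<and> real k < t2 \<and> k \<le> n
    \<and> 2 ^ n * real (n choose s) \<le> (real n + 1) ^ 4 * (real (n choose k) * (K (real k))\<^sup>2)"
proof -
  define N where "N = 2 ^ n * real (n choose s)"
  have t: "K t1 = 0" "K t2 = 0" using assms by (auto simp: consecutive_roots_def)
  have t2n: "t2 < real n" using krawchouk_root_less t by blast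
  have l: "0 \<le> real n - 2 * real s" using s by simp
  have nt2: "K (real n - t2) = 0" using t by (simp add: krawchouk_reflect_eq_0)
  have "\<exists>k. t1 < real k \<and> real k < t2 \<and> k \<le> n \<and> N \<le> (real n + 1) ^ 4 * kraw_mass k"
    using assms
  proof (cases rule: krawchouk_consecutive_roots)
    case (pair i)
    then have "i + 1 < n" using t2n by linarith
    have "2 * N \<le> (real n + 1) ^ 4 * (kraw_mass i + kraw_mass (i + 1))"
    proof (cases "2 * i \<le> n")
      case True
      show ?thesis
        unfolding N_def using pair \<open>i + 1 < n\<close> True l by (intro kraw_mass_large[OF t(1)]) auto
    next
      case False
      \<comment> \<open>Reflection reverses the pair, so its lower member is the image of i +
        1.\<close>
      define i' where "i' = n - (i + 1)"
      have i': "n - i = i' + 1" "2 * i' \<le> n" "i' < n" "real i' = real n - real (i + 1)" "real (i' + 1) = real n - real i"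
        using False \<open>i + 1 < n\<close> by (auto simp: i'_def of_nat_diff)
      have "K (real i') * K (real (i' + 1)) = ((- 1) ^ s * (- 1) ^ s) * (K (real i) * K (real (i + 1)))"
        unfolding i' krawchouk_reflect by (simp add: mult_ac)
      also have "(- 1 :: real) ^ s * (- 1) ^ s = 1" by (simp flip: power_mult_distrib)
      finally have sgn: "0 \<le> (real n - 2 * real s) * (K (real i') * K (real (i' + 1)))"
        using pair l by simp
      have "2 * N \<le> (real n + 1) ^ 4 * (kraw_mass i' + kraw_mass (i' + 1))"
        unfolding N_def by (rule kraw_mass_large[OF nt2 _ i'(2,3) sgn]) (use pair i'(4) in simp)
      moreover have "kraw_mass i' = kraw_mass (i + 1)" "kraw_mass (i' + 1) = kraw_mass i"
        using kraw_mass_reflect[of "i + 1"] kraw_mass_reflect[of i] \<open>i + 1 < n\<close> i' by (auto simp: i'_def)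
      ultimately show ?thesis by (simp add: add.commute)
    qed
    then have "N \<le> (real n + 1) ^ 4 * kraw_mass i \<or> N \<le> (real n + 1) ^ 4 * kraw_mass (i + 1)"
      unfolding distrib_left by linarith
    then show ?thesis
    proof
      assume "N \<le> (real n + 1) ^ 4 * kraw_mass i"
      then show ?thesis using pair \<open>i + 1 < n\<close> by (intro exI[of _ i]) auto
    next
      assume "N \<le> (real n + 1) ^ 4 * kraw_mass (i + 1)"
      then show ?thesis using pair \<open>i + 1 < n\<close> by (intro exI[of _ "i + 1"]) auto
    qed
  next
    case (single i)
    then have "i < n" using t2n by linarith
    have "2 * N \<le> (real n + 1) ^ 4 * kraw_mass i"
    proof (cases "2 * i \<le> n")
      case True
      have "2 * N \<le> (real n + 1) ^ 4 * (kraw_mass i + kraw_mass (i + 1))"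
        unfolding N_def using single \<open>i < n\<close> True by (intro kraw_mass_large[OF t(1)]) auto
      moreover have "kraw_mass (i + 1) = 0" using single(6) by (simp only: kraw_mass_def) simp
      ultimately show ?thesis by (simp only: add_0_right)
    next
      case False
      define i' where "i' = n - i"
      have i': "2 * i' \<le> n" "i' < n" "real i' = real n - real i" "i' + 1 = n - (i - 1)"
        using False \<open>i < n\<close> single by (auto simp: i'_def of_nat_diff)
      have m: "kraw_mass (i' + 1) = 0"
      proof -
        have "kraw_mass (i' + 1) = kraw_mass (i - 1)"
          unfolding i' using \<open>i < n\<close> by (intro kraw_mass_reflect) simp
        also have "\<dots> = 0" using single(5) by (simp only: kraw_mass_def) simp
        finally show ?thesis .
      qed
      have "2 * N \<le> (real n + 1) ^ 4 * (kraw_mass i' + kraw_mass (i' + 1))"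
        unfolding N_def using single i' by (intro kraw_mass_large[OF nt2]) auto
      then show ?thesis using m kraw_mass_reflect[of i] \<open>i < n\<close> by (simp add: i'_def)
    qed
    moreover have "0 \<le> N" by (simp add: N_def)
    ultimately show ?thesis using single \<open>i < n\<close> by (intro exI[of _ i]) auto
  qed
  then show ?thesis by (simp add: N_def kraw_mass_def)
qed

end

theorem theorem1p10:
  shows "(\<forall>(n::nat) f :: (nat \<Rightarrow> nat) \<Rightarrow> real.
            n \<ge> 1 \<longrightarrow> (\<exists>x\<in>cube n. f x \<noteq> 0) \<longrightarrow>
            (\<forall>(p::real) (k::nat). p \<ge> 2 \<longrightarrow> k \<le> n \<longrightarrow>
               lp_norm n 2 (level_proj n f k) \<le> level_bound n f p k))
       \<and> (\<exists>C::real. \<forall>(n::nat) (s::nat) (c::real) f :: (nat \<Rightarrow> nat) \<Rightarrow> real.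
            1 \<le> s \<longrightarrow> real s \<le> real n / 2 \<longrightarrow> c \<noteq> 0 \<longrightarrow>
            (\<forall>x\<in>cube n. f x = c * indicator (hamming_sphere n s) x) \<longrightarrow>
            (\<forall>p::real. p \<ge> 2 \<longrightarrow>
               (\<forall>k::nat.
                  real k \<le> real n / 2 - sqrt (real s * (real n - real s))
                  \<or> real n / 2 + sqrt (real s * (real n - real s)) \<le> real k \<and> k \<le> n \<longrightarrow>
                  level_bound n f p k
                    \<le> C * (real (max k 1) * real s) powr (1 / 4)
                        * lp_norm n 2 (level_proj n f k))
               \<and> (\<forall>t\<^sub>1 t\<^sub>2. consecutive_roots (krawchouk n s) t\<^sub>1 t\<^sub>2 \<longrightarrow>
                    (\<exists>k::nat. t\<^sub>1 < real k \<and> real k < t\<^sub>2 \<and>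
                       level_bound n f p k
                         \<le> C * real n powr (5 / 2) * lp_norm n 2 (level_proj n f k)))))"
proof (intro conjI)
  show "\<forall>n f. n \<ge> 1 \<longrightarrow> (\<exists>x\<in>cube n. f x \<noteq> 0) \<longrightarrow>
      (\<forall>p k. p \<ge> 2 \<longrightarrow> k \<le> n \<longrightarrow> lp_norm n 2 (level_proj n f k) \<le> level_bound n f p k)"
    using level_inequality by blast
next
  have e: "exp 1 * N \<le> 4 * N" if "0 \<le> N" for N :: real
    using exp_le that by (intro mult_right_mono) auto
  show "\<exists>C::real. \<forall>(n::nat) (s::nat) (c::real) f :: (nat \<Rightarrow> nat) \<Rightarrow> real.
      1 \<le> s \<longrightarrow> real s \<le> real n / 2 \<longrightarrow> c \<noteq> 0 \<longrightarrow>
      (\<forall>x\<in>cube n. f x = c * indicator (hamming_sphere n s) x) \<longrightarrow>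
      (\<forall>p::real. p \<ge> 2 \<longrightarrow>
         (\<forall>k::nat.
            real k \<le> real n / 2 - sqrt (real s * (real n - real s))
            \<or> real n / 2 + sqrt (real s * (real n - real s)) \<le> real k \<and> k \<le> n \<longrightarrow>
            level_bound n f p k
              \<le> C * (real (max k 1) * real s) powr (1 / 4)
                  * lp_norm n 2 (level_proj n f k))
         \<and> (\<forall>t\<^sub>1 t\<^sub>2. consecutive_roots (krawchouk n s) t\<^sub>1 t\<^sub>2 \<longrightarrow>
              (\<exists>k::nat. t\<^sub>1 < real k \<and> real k < t\<^sub>2 \<and>
                 level_bound n f p k
                   \<le> C * real n powr (5 / 2) * lp_norm n 2 (level_proj n f k))))"
  \<comment> \<open>The second bound comes with the constant 4, which also exceeds the e of the
    first.\<close>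
  proof (rule exI[of _ 4], intro allI impI conjI)
    fix n s k :: nat and c p :: real and f :: "(nat \<Rightarrow> nat) \<Rightarrow> real"
    assume *: "1 \<le> s" "real s \<le> real n / 2" "c \<noteq> 0"
      "\<forall>x\<in>cube n. f x = c * indicator (hamming_sphere n s) x" "2 \<le> p"
      "real k \<le> real n / 2 - sqrt (real s * (real n - real s))
        \<or> real n / 2 + sqrt (real s * (real n - real s)) \<le> real k \<and> k \<le> n"
    have "level_bound n f p k
        \<le> exp 1 * ((real (max k 1) * real s) powr (1 / 4) * lp_norm n 2 (level_proj n f k))"
      using sphere_tight[OF *(1,2) refl *(3-6)] by (simp only: mult.assoc)
    also have "\<dots> \<le> 4 * ((real (max k 1) * real s) powr (1 / 4) * lp_norm n 2 (level_proj n f k))"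
      by (intro e mult_nonneg_nonneg lp_norm_nonneg) simp
    finally show "level_bound n f p k
        \<le> 4 * (real (max k 1) * real s) powr (1 / 4) * lp_norm n 2 (level_proj n f k)"
      by (simp only: mult.assoc)
  next
    fix n s :: nat and c p t\<^sub>1 t\<^sub>2 :: real and f :: "(nat \<Rightarrow> nat) \<Rightarrow> real"
    assume *: "1 \<le> s" "real s \<le> real n / 2" "c \<noteq> 0"
      "\<forall>x\<in>cube n. f x = c * indicator (hamming_sphere n s) x" "2 \<le> p"
      and roots: "consecutive_roots (krawchouk n s) t\<^sub>1 t\<^sub>2"
    show "\<exists>k::nat. t\<^sub>1 < real k \<and> real k < t\<^sub>2 \<and>
        level_bound n f p k \<le> 4 * real n powr (5 / 2) * lp_norm n 2 (level_proj n f k)"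
      using krawchouk_large_between_roots[OF *(1,2) roots] sphere_level_bound_le[OF *(1,2) refl *(3-5)]
      by blast
  qed
qed

end
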